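(* The inclusion $\widetilde{\mathrm{vTr}}(\mathcal{U}_Q(\mathfrak{gl}_m)^{0\le2})\hookrightarrow\mathrm{hTr}(\mathcal{U}_Q(\mathfrak{gl}_m)^{0\le2})$ is an equivalence of categories.
   Context: Work over $\mathbb{C}$; powers of $q$ denote formal grading shifts; $m\ge2$. **Categorified $\mathfrak{gl}_m$.** $\mathcal{U}_Q(\mathfrak{gl}_m)$ is the Khovanov–Lauda 2-category with scalars $t_{i,i+1}=-1$, $t_{i+1,i}=1$, $t_{ij}=1$ for $|i-j|>1$. Objects: $\mathbf a\in\mathbb{Z}^m$ (put $\lambda_i=a_i-a_{i+1}$). 1-morphisms: formal direct sums of shifts $q^k$ of composites of $\mathcal{E}_i\mathbf 1_{\mathbf a}:\mathbf a\to\mathbf a+\epsilon_i$ and $\mathcal{F}_i\mathbf 1_{\mathbf a}:\mathbf a\to\mathbf a-\epsilon_i$, where $1\le i\le m-1$ and $\epsilon_i=[0,\dots,1,-1,\dots,0]$ with $1$ in position $i$. 2-morphisms: matrices of degree-zero combinations of composites of $x_i:\mathcal{E}_i\to\mathcal{E}_i$ (dot, degree $2$), $\tau_{ij}:\mathcal{E}_i\mathcal{E}_j\to\mathcal{E}_j\mathcal{E}_i$ (degree $-2$ if $i=j$, $1$ if $|i-j|=1$, $0$ otherwise), $\eta_i:\mathbf 1_{\mathbf a}\to\mathcal{F}_i\mathcal{E}_i\mathbf 1_{\mathbf a}$ (degree $1+\lambda_i$), $\kappa_i:\mathcal{E}_i\mathcal{F}_i\mathbf 1_{\mathbf a}\to\mathbf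 1_{\mathbf a}$ (degree $1-\lambda_i$); a map $q^{d_1}G\to q^{d_2}H$ given by a diagram $D$ has degree $\deg D+d_1-d_2$. Relations (Rouquier's equivalent presentation): $\tau_{ij}(x_i\mathcal{E}_j)-(\mathcal{E}_jx_i)\tau_{ij}=\delta_{ij}\,\mathrm{id}=(x_j\mathcal{E}_i)\tau_{ij}-\tau_{ij}(\mathcal{E}_ix_j)$; $\tau_{ji}\tau_{ij}=0$ if $i=j$, $\mathrm{id}$ if $|i-j|>1$, $t_{ij}x_i\mathcal{E}_j+t_{ji}\mathcal{E}_ix_j$ if $|i-j|=1$; $(\tau_{jk}\mathcal{E}_i)(\mathcal{E}_j\tau_{ik})(\tau_{ij}\mathcal{E}_k)-(\mathcal{E}_k\tau_{ij})(\tau_{ik}\mathcal{E}_j)(\mathcal{E}_i\tau_{jk})$ is $t_{ij}\,\mathrm{id}$ if $i=k$, $|i-j|=1$ and $0$ otherwise; $\eta_i,\kappa_i$ satisfy the zigzag identities; and with $\sigma_{ij}=(\mathcal{F}_j\mathcal{E}_i\kappa_j)(\mathcal{F}_j\tau_{ji}\mathcal{F}_j)(\eta_j\mathcal{E}_i\mathcal{F}_j):\mathcal{E}_i\mathcal{F}_j\to\mathcal{F}_j\mathcal{E}_i$ the following are (up to shifts) isomorphisms: $\sigma_{ij}$ for $i\ne j$; $(\sigma_{ii},\kappa_i,\kappa_i(x_i\mathcal{F}_i),\dots,\kappa_i(x_i^{\lambda_i-1}\mathcal{F}_i)):\mathcal{E}_i\mathcal{F}_i\mathbf 1_{\mathbf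 a}\to\mathcal{F}_i\mathcal{E}_i\mathbf 1_{\mathbf a}\oplus\mathbf 1_{\mathbf a}^{\oplus\lambda_i}$ if $\lambda_i\ge0$; $(\sigma_{ii},\eta_i,(\mathcal{F}_ix_i)\eta_i,\dots,(\mathcal{F}_ix_i^{-\lambda_i-1})\eta_i):\mathcal{E}_i\mathcal{F}_i\mathbf 1_{\mathbf a}\oplus\mathbf 1_{\mathbf a}^{\oplus-\lambda_i}\to\mathcal{F}_i\mathcal{E}_i\mathbf 1_{\mathbf a}$ if $\lambda_i\le0$. $\mathcal{U}_Q(\mathfrak{gl}_m)^{0\le2}$ is the quotient of $\mathcal{U}_Q(\mathfrak{gl}_m)$ killing (the identity 2-morphisms of the identity 1-morphisms of) all weights with an entry not in $\{0,1,2\}$. **Traces.** For such a graded linear 2-category $\mathcal{D}$, $\mathcal{D}^*$ is the version without shifts and with 2-morphisms of all degrees. $\widetilde{\mathrm{vTr}}(\mathcal{D})$: objects are finite formal direct sums of $q^kc$, $c$ an object of $\mathcal{D}$; morphisms $q^{k_1}c\to q^{k_2}d$ are elements of degree zero (degree of the 2-morphism plus $k_1-k_2$) in $\bigoplus_{p:c\to d}\mathrm{End}_{\mathcal{D}^*}(p)/\mathrm{span}\{fg-gf\}$. $\mathrm{hTr}(\mathcal{D})$ (graded horizontal trace): objects are finite direct sums of $q^kf$, $f:c\to c$ a 1-morphism; morphisms $q^{k_1}f\to q^{k_2}g$ ($f:c\to c$, $g:d\to d$) are degree-zero classes of pairs $(p,\sigma)$, $p:c\to d$, $\sigma:pf\to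 gp$ in $\mathcal{D}^*$, modulo linearity and $(p,\sigma\circ(\tau f))\sim(p',(g\tau)\circ\sigma)$ for $\tau:p\to p'$, $\sigma:p'f\to gp$; composition $(r,\rho)(p,\sigma)=(rp,(\rho p)(r\sigma))$. The inclusion is $q^kc\mapsto q^k\mathbf 1_c$, $[\sigma:p\to p]\mapsto(p,\sigma)$. *)

theory Defs
  imports Complex_Main "HOL-Library.Poly_Mapping"
begin

section \<open>Categories and equivalences\<close>

text \<open>Hom-sets need not be disjoint: composition and morphism maps take the objects involved as
  arguments. \<open>cmp C x y z g f\<close> is the composite of \<open>f : x \<rightarrow> y\<close> and \<open>g : y \<rightarrow> z\<close>.\<close>

record ('o, 'm) cat =
  ob :: "'o set"
  hom :: "'o \<Rightarrow> 'o \<Rightarrow> 'm set"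
  idn :: "'o \<Rightarrow> 'm"
  cmp :: "'o \<Rightarrow> 'o \<Rightarrow> 'o \<Rightarrow> 'm \<Rightarrow> 'm \<Rightarrow> 'm"

definition category :: "('o, 'm) cat \<Rightarrow> bool" where
  "category C \<longleftrightarrow>
     (\<forall>x\<in>ob C. idn C x \<in> hom C x x) \<and>
     (\<forall>x\<in>ob C. \<forall>y\<in>ob C. \<forall>z\<in>ob C. \<forall>f\<in>hom C x y. \<forall>g\<in>hom C y z. cmp C x y z g f \<in> hom C x z) \<and>
     (\<forall>x\<in>ob C. \<forall>y\<in>ob C. \<forall>f\<in>hom C x y.
        cmp C x x y f (idn C x) = f \<and> cmp C x y y (idn C y) f = f) \<and>
     (\<forall>w\<in>ob C. \<forall>x\<in>ob C. \<forall>y\<in>ob C. \<forall>z\<in>ob C.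
        \<forall>f\<in>hom C w x. \<forall>g\<in>hom C x y. \<forall>h\<in>hom C y z.
        cmp C w x z (cmp C x y z h g) f = cmp C w y z h (cmp C w x y g f))"

definition is_functor ::
  "('o, 'm) cat \<Rightarrow> ('p, 'n) cat \<Rightarrow> ('o \<Rightarrow> 'p) \<Rightarrow> ('o \<Rightarrow> 'o \<Rightarrow> 'm \<Rightarrow> 'n) \<Rightarrow> bool" where
  "is_functor C D Fo Fm \<longleftrightarrow>
     (\<forall>x\<in>ob C. Fo x \<in> ob D) \<and>
     (\<forall>x\<in>ob C. \<forall>y\<in>ob C. \<forall>f\<in>hom C x y. Fm x y f \<in> hom D (Fo x) (Fo y)) \<and>
     (\<forall>x\<in>ob C. Fm x x (idn C x) = idn D (Fo x)) \<and>
     (\<forall>x\<in>ob C. \<forall>y\<in>ob C. \<forall>z\<in>ob C. \<forall>f\<in>hom C x y. \<forall>g\<in>hom C y z.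
        Fm x z (cmp C x y z g f) = cmp D (Fo x) (Fo y) (Fo z) (Fm y z g) (Fm x y f))"

definition is_iso :: "('o, 'm) cat \<Rightarrow> 'o \<Rightarrow> 'o \<Rightarrow> 'm \<Rightarrow> bool" where
  "is_iso C x y f \<longleftrightarrow> f \<in> hom C x y \<and>
     (\<exists>g\<in>hom C y x. cmp C x y x g f = idn C x \<and> cmp C y x y f g = idn C y)"

definition naturally_isomorphic ::
  "('o, 'm) cat \<Rightarrow> ('p, 'n) cat \<Rightarrow> ('o \<Rightarrow> 'p) \<Rightarrow> ('o \<Rightarrow> 'o \<Rightarrow> 'm \<Rightarrow> 'n) \<Rightarrow>
   ('o \<Rightarrow> 'p) \<Rightarrow> ('o \<Rightarrow> 'o \<Rightarrow> 'm \<Rightarrow> 'n) \<Rightarrow> bool" where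
  "naturally_isomorphic C D Fo Fm Go Gm \<longleftrightarrow>
     (\<exists>\<theta>. (\<forall>x\<in>ob C. is_iso D (Fo x) (Go x) (\<theta> x)) \<and>
        (\<forall>x\<in>ob C. \<forall>y\<in>ob C. \<forall>f\<in>hom C x y.
           cmp D (Fo x) (Fo y) (Go y) (\<theta> y) (Fm x y f)
             = cmp D (Fo x) (Go x) (Go y) (Gm x y f) (\<theta> x)))"

definition equivalence_of_categories ::
  "('o, 'm) cat \<Rightarrow> ('p, 'n) cat \<Rightarrow> ('o \<Rightarrow> 'p) \<Rightarrow> ('o \<Rightarrow> 'o \<Rightarrow> 'm \<Rightarrow> 'n) \<Rightarrow> bool" where
  "equivalence_of_categories C D Fo Fm \<longleftrightarrow>
     category C \<and> category D \<and> is_functor C D Fo Fm \<and>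
     (\<exists>Go Gm. is_functor D C Go Gm \<and>
        naturally_isomorphic C C
          (\<lambda>x. x) (\<lambda>x y f. f)
          (\<lambda>x. Go (Fo x)) (\<lambda>x y f. Gm (Fo x) (Fo y) (Fm x y f)) \<and>
        naturally_isomorphic D D
          (\<lambda>x. Fo (Go x)) (\<lambda>x y f. Fm (Go x) (Go y) (Gm x y f))
          (\<lambda>x. x) (\<lambda>x y f. f))"


section \<open>Free complex vector spaces and their quotients\<close>

definition scl :: "complex \<Rightarrow> ('a \<Rightarrow>\<^sub>0 complex) \<Rightarrow> ('a \<Rightarrow>\<^sub>0 complex)" where
  "scl c x = Poly_Mapping.map ((*) c) x"

lemma lookup_scl [simp]: "Poly_Mapping.lookup (scl c x) k = c * Poly_Mapping.lookup x k"
  by (simp add: scl_def Poly_Mapping.map.rep_eq when_def)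

global_interpretation free_vs: vector_space scl
  by standard (auto intro!: poly_mapping_eqI simp: lookup_add algebra_simps)

abbreviation basis :: "'a \<Rightarrow> ('a \<Rightarrow>\<^sub>0 complex)" where
  "basis k \<equiv> Poly_Mapping.single k 1"

definition lin_ext :: "('a \<Rightarrow> ('b \<Rightarrow>\<^sub>0 complex)) \<Rightarrow> ('a \<Rightarrow>\<^sub>0 complex) \<Rightarrow> ('b \<Rightarrow>\<^sub>0 complex)" where
  "lin_ext h x = (\<Sum>k\<in>Poly_Mapping.keys x. scl (Poly_Mapping.lookup x k) (h k))"

definition bilin_ext ::
  "('a \<Rightarrow> 'b \<Rightarrow> 'c) \<Rightarrow> ('a \<Rightarrow>\<^sub>0 complex) \<Rightarrow> ('b \<Rightarrow>\<^sub>0 complex) \<Rightarrow> ('c \<Rightarrow>\<^sub>0 complex)" where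
  "bilin_ext h x y = lin_ext (\<lambda>k. lin_ext (\<lambda>l. basis (h k l)) y) x"

text \<open>An element of the quotient by a subspace \<open>I\<close> is a coset of \<open>I\<close>. Operations on cosets are
  computed on arbitrarily chosen representatives.\<close>

definition coset :: "('a \<Rightarrow>\<^sub>0 complex) set \<Rightarrow> ('a \<Rightarrow>\<^sub>0 complex) \<Rightarrow> ('a \<Rightarrow>\<^sub>0 complex) set" where
  "coset I x = {y. y - x \<in> I}"

definition rep :: "('a \<Rightarrow>\<^sub>0 complex) set \<Rightarrow> ('a \<Rightarrow>\<^sub>0 complex)" where
  "rep X = (SOME x. x \<in> X)"

text \<open>An \<open>r\<close> by \<open>s\<close> matrix; entries outside the index range get the junk value \<open>{}\<close> (never a coset),
  so that a matrix is determined by its entries in the range.\<close>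

definition mat :: "nat \<Rightarrow> nat \<Rightarrow> (nat \<Rightarrow> nat \<Rightarrow> 'x set) \<Rightarrow> nat \<Rightarrow> nat \<Rightarrow> 'x set" where
  "mat r s M = (\<lambda>i j. if i < r \<and> j < s then M i j else {})"


section \<open>Traces of graded linear 2-categories\<close>

text \<open>The data \<open>\<D>\<^sup>*\<close> of a graded linear (strict) 2-category \<open>\<D>\<close>: 1-morphisms without
  grading shifts, 2-morphisms of all degrees. \<open>homog C n\<close> consists of the homogeneous 2-morphisms of
  degree \<open>n\<close>. 1- and 2-morphisms determine their sources and targets. The 1-morphisms of \<open>\<D>\<close> are the
  direct sums of shifts of 1-morphisms of \<open>\<D>\<^sup>*\<close>, and its 2-morphisms are the matrices
  whose entry \<open>q^k f \<rightarrow> q^l g\<close> is homogeneous of degree \<open>l - k\<close>; the traces only use \<open>\<D>\<^sup>*\<close>.\<close>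

record ('o, 'f, 's) graded_2cat =
  obj :: "'o set"
  cells1 :: "'o \<Rightarrow> 'o \<Rightarrow> 'f set"
  cells2 :: "'f \<Rightarrow> 'f \<Rightarrow> 's set"
  homog :: "int \<Rightarrow> 's set"
  id1 :: "'o \<Rightarrow> 'f"
  comp1 :: "'f \<Rightarrow> 'f \<Rightarrow> 'f"
  id2 :: "'f \<Rightarrow> 's"
  vcomp :: "'s \<Rightarrow> 's \<Rightarrow> 's"
  hcomp :: "'s \<Rightarrow> 's \<Rightarrow> 's"
  add2 :: "'s \<Rightarrow> 's \<Rightarrow> 's"
  scale2 :: "complex \<Rightarrow> 's \<Rightarrow> 's"

text \<open>The category of finite formal direct sums of objects of a linear category whose space of
  morphisms from \<open>x\<close> to \<open>y\<close> is spanned by \<open>gens x y\<close> modulo the relations \<open>rels x y\<close>.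
  Objects are lists; a morphism is a matrix whose \<open>(i, j)\<close> entry goes from summand \<open>j\<close> of the source
  to summand \<open>i\<close> of the target.\<close>

definition sum_cat ::
  "'x set \<Rightarrow> ('x \<Rightarrow> 'x \<Rightarrow> 'g set) \<Rightarrow> ('x \<Rightarrow> 'x \<Rightarrow> ('g \<Rightarrow>\<^sub>0 complex) set) \<Rightarrow> ('x \<Rightarrow> 'g) \<Rightarrow>
   ('g \<Rightarrow> 'g \<Rightarrow> 'g) \<Rightarrow> ('x list, nat \<Rightarrow> nat \<Rightarrow> ('g \<Rightarrow>\<^sub>0 complex) set) cat" where
  "sum_cat X gens rels one mult =
     \<lparr> ob = lists X,
       hom = (\<lambda>xs ys. {mat (length ys) (length xs) M | M.
          \<forall>i<length ys. \<forall>j<length xs.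
            M i j \<in> coset (rels (xs ! j) (ys ! i)) ` free_vs.span (basis ` gens (xs ! j) (ys ! i))}),
       idn = (\<lambda>xs. mat (length xs) (length xs) (\<lambda>i j.
          coset (rels (xs ! j) (xs ! i)) (if i = j then basis (one (xs ! i)) else 0))),
       cmp = (\<lambda>xs ys zs N M. mat (length zs) (length xs) (\<lambda>i k.
          coset (rels (xs ! k) (zs ! i))
            (\<Sum>j<length ys. bilin_ext mult (rep (N i j)) (rep (M j k))))) \<rparr>"

text \<open>The relations making \<open>\<sigma> \<mapsto> (p, \<sigma>)\<close> linear on a space \<open>S p\<close> of 2-morphisms: the free vector
  space on the pairs \<open>(p, \<sigma>)\<close> modulo these is the direct sum over \<open>p\<close> of the spaces \<open>S p\<close>.\<close>

definition linearity_rels ::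
  "('o, 'f, 's) graded_2cat \<Rightarrow> 'f set \<Rightarrow> ('f \<Rightarrow> 's set) \<Rightarrow> (('f \<times> 's) \<Rightarrow>\<^sub>0 complex) set" where
  "linearity_rels C P S =
     {basis (p, add2 C (scale2 C a \<sigma>) (scale2 C b \<sigma>'))
        - scl a (basis (p, \<sigma>)) - scl b (basis (p, \<sigma>')) | p \<sigma> \<sigma>' a b.
        p \<in> P \<and> \<sigma> \<in> S p \<and> \<sigma>' \<in> S p}"

text \<open>Vertical trace. The pair \<open>(k, c)\<close> stands for \<open>q^k c\<close>.\<close>

definition vTr_rels ::
  "('o, 'f, 's) graded_2cat \<Rightarrow> (int \<times> 'o) \<Rightarrow> (int \<times> 'o) \<Rightarrow> (('f \<times> 's) \<Rightarrow>\<^sub>0 complex) set" where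
  "vTr_rels C = (\<lambda>(k, c) (l, d). free_vs.span
     (linearity_rels C (cells1 C c d) (\<lambda>p. cells2 C p p) \<union>
      {basis (p', vcomp C f g) - basis (p, vcomp C g f) | p p' f g.
         p \<in> cells1 C c d \<and> p' \<in> cells1 C c d \<and> f \<in> cells2 C p p' \<and> g \<in> cells2 C p' p}))"

definition vTr_gens ::
  "('o, 'f, 's) graded_2cat \<Rightarrow> (int \<times> 'o) \<Rightarrow> (int \<times> 'o) \<Rightarrow> ('f \<times> 's) set" where
  "vTr_gens C = (\<lambda>(k, c) (l, d).
     {(p, \<sigma>). p \<in> cells1 C c d \<and> \<sigma> \<in> cells2 C p p \<inter> homog C (l - k)})"

definition vTr ::
  "('o, 'f, 's) graded_2cat \<Rightarrow>
   ((int \<times> 'o) list, nat \<Rightarrow> nat \<Rightarrow> (('f \<times> 's) \<Rightarrow>\<^sub>0 complex) set) cat" where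
  "vTr C = sum_cat (UNIV \<times> obj C) (vTr_gens C) (vTr_rels C)
     (\<lambda>(k, c). (id1 C c, id2 C (id1 C c)))
     (\<lambda>(r, \<rho>) (p, \<sigma>). (comp1 C r p, hcomp C \<rho> \<sigma>))"

text \<open>Horizontal trace. The triple \<open>(k, c, f)\<close> stands for \<open>q^k f\<close> with \<open>f : c \<rightarrow> c\<close>.\<close>

definition hTr_rels ::
  "('o, 'f, 's) graded_2cat \<Rightarrow> (int \<times> 'o \<times> 'f) \<Rightarrow> (int \<times> 'o \<times> 'f) \<Rightarrow>
   (('f \<times> 's) \<Rightarrow>\<^sub>0 complex) set" where
  "hTr_rels C = (\<lambda>(k, c, f) (l, d, g). free_vs.span
     (linearity_rels C (cells1 C c d) (\<lambda>p. cells2 C (comp1 C p f) (comp1 C g p)) \<union>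
      {basis (p, vcomp C \<sigma> (hcomp C \<tau> (id2 C f))) - basis (p', vcomp C (hcomp C (id2 C g) \<tau>) \<sigma>) | p p' \<sigma> \<tau>.
         p \<in> cells1 C c d \<and> p' \<in> cells1 C c d \<and> \<tau> \<in> cells2 C p p' \<and>
         \<sigma> \<in> cells2 C (comp1 C p' f) (comp1 C g p)}))"

definition hTr_gens ::
  "('o, 'f, 's) graded_2cat \<Rightarrow> (int \<times> 'o \<times> 'f) \<Rightarrow> (int \<times> 'o \<times> 'f) \<Rightarrow> ('f \<times> 's) set" where
  "hTr_gens C = (\<lambda>(k, c, f) (l, d, g).
     {(p, \<sigma>). p \<in> cells1 C c d \<and>
        \<sigma> \<in> cells2 C (comp1 C p f) (comp1 C g p) \<inter> homog C (l - k)})"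

definition hTr ::
  "('o, 'f, 's) graded_2cat \<Rightarrow>
   ((int \<times> 'o \<times> 'f) list, nat \<Rightarrow> nat \<Rightarrow> (('f \<times> 's) \<Rightarrow>\<^sub>0 complex) set) cat" where
  "hTr C = sum_cat {(k, c, f). c \<in> obj C \<and> f \<in> cells1 C c c} (hTr_gens C) (hTr_rels C)
     (\<lambda>(k, c, f). (id1 C c, id2 C f))
     (\<lambda>(r, \<rho>) (p, \<sigma>). (comp1 C r p, vcomp C (hcomp C \<rho> (id2 C p)) (hcomp C (id2 C r) \<sigma>)))"

text \<open>The inclusion. Since \<open>p \<circ> 1\<^sub>c = p = 1\<^sub>d \<circ> p\<close> strictly, it sends the class of \<open>(p, \<sigma>)\<close> to the
  class of the same pair.\<close>

definition incl_ob :: "('o, 'f, 's) graded_2cat \<Rightarrow> (int \<times> 'o) list \<Rightarrow> (int \<times> 'o \<times> 'f) list" where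
  "incl_ob C = map (\<lambda>(k, c). (k, c, id1 C c))"

definition incl_mor ::
  "('o, 'f, 's) graded_2cat \<Rightarrow> (int \<times> 'o) list \<Rightarrow> (int \<times> 'o) list \<Rightarrow>
   (nat \<Rightarrow> nat \<Rightarrow> (('f \<times> 's) \<Rightarrow>\<^sub>0 complex) set) \<Rightarrow>
   (nat \<Rightarrow> nat \<Rightarrow> (('f \<times> 's) \<Rightarrow>\<^sub>0 complex) set)" where
  "incl_mor C xs ys M = mat (length ys) (length xs) (\<lambda>i j.
     coset (hTr_rels C (incl_ob C xs ! j) (incl_ob C ys ! i)) (rep (M i j)))"


section \<open>The Khovanov--Lauda 2-category of gl(m)\<close>

type_synonym weight = "int list"

definition weights :: "nat \<Rightarrow> weight set" where
  "weights m = {a. length a = m}"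

text \<open>Nodes are \<open>1, \<dots>, m - 1\<close> while list positions start at 0.\<close>

definition lam :: "weight \<Rightarrow> nat \<Rightarrow> int" where
  "lam a i = a ! (i - 1) - a ! i"

definition add_root :: "int \<Rightarrow> nat \<Rightarrow> weight \<Rightarrow> weight" where
  "add_root s i a = a[i - 1 := a ! (i - 1) + s, i := a ! i - s]"

datatype letter = \<E> nat | \<F> nat

primrec node :: "letter \<Rightarrow> nat" where
  "node (\<E> i) = i"
| "node (\<F> i) = i"

text \<open>A word is a composite of generating 1-morphisms, the rightmost letter being applied first.\<close>

type_synonym word = "letter list"

definition words :: "nat \<Rightarrow> word set" where
  "words m = {w. \<forall>x\<in>set w. node x \<in> {1..<m}}"

fun wt :: "word \<Rightarrow> weight \<Rightarrow> weight" where
  "wt [] a = a"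
| "wt (\<E> i # w) a = add_root 1 i (wt w a)"
| "wt (\<F> i # w) a = add_root (-1) i (wt w a)"

text \<open>Besides \<open>x\<^sub>i\<close>, \<open>\<tau>\<^sub>i\<^sub>j\<close>, \<open>\<eta>\<^sub>i\<close>, \<open>\<kappa>\<^sub>i\<close> there are generators for the entries of the
  inverses of the 2-morphisms that are required to be isomorphisms: \<open>SigmaInv i j\<close> for \<open>\<sigma>\<^sub>i\<^sub>j\<close>,
  \<open>KappaInv i k\<close> for \<open>\<kappa>\<^sub>i (x\<^sub>i\<^sup>k \<F>\<^sub>i)\<close> and \<open>EtaInv i k\<close> for \<open>(\<F>\<^sub>i x\<^sub>i\<^sup>k) \<eta>\<^sub>i\<close>.\<close>

datatype gen =
    Dot nat | Cross nat nat | Eta nat | Kappa nat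
  | SigmaInv nat nat | KappaInv nat nat | EtaInv nat nat

primrec gsrc :: "gen \<Rightarrow> word" where
  "gsrc (Dot i) = [\<E> i]"
| "gsrc (Cross i j) = [\<E> i, \<E> j]"
| "gsrc (Eta i) = []"
| "gsrc (Kappa i) = [\<E> i, \<F> i]"
| "gsrc (SigmaInv i j) = [\<F> j, \<E> i]"
| "gsrc (KappaInv i k) = []"
| "gsrc (EtaInv i k) = [\<F> i, \<E> i]"

primrec gtgt :: "gen \<Rightarrow> word" where
  "gtgt (Dot i) = [\<E> i]"
| "gtgt (Cross i j) = [\<E> j, \<E> i]"
| "gtgt (Eta i) = [\<F> i, \<E> i]"
| "gtgt (Kappa i) = []"
| "gtgt (SigmaInv i j) = [\<E> i, \<F> j]"
| "gtgt (KappaInv i k) = [\<E> i, \<F> i]"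
| "gtgt (EtaInv i k) = []"

text \<open>Validity and degree of a generator whose source 1-morphism starts at the weight \<open>a\<close>
  (the weight to its right). The degrees of the inverses are forced: \<open>\<sigma>\<^sub>i\<^sub>j\<close> has degree 0.\<close>

fun gen_ok :: "nat \<Rightarrow> weight \<Rightarrow> gen \<Rightarrow> bool" where
  "gen_ok m a (KappaInv i k) \<longleftrightarrow> i \<in> {1..<m} \<and> int k < lam a i"
| "gen_ok m a (EtaInv i k) \<longleftrightarrow> i \<in> {1..<m} \<and> int k < - lam a i"
| "gen_ok m a g \<longleftrightarrow> gsrc g \<in> words m \<and> gtgt g \<in> words m"

primrec gdeg :: "weight \<Rightarrow> gen \<Rightarrow> int" where
  "gdeg a (Dot i) = 2"
| "gdeg a (Cross i j) = (if i = j then -2 else if i = Suc j \<or> j = Suc i then 1 else 0)"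
| "gdeg a (Eta i) = 1 + lam a i"
| "gdeg a (Kappa i) = 1 - lam a i"
| "gdeg a (SigmaInv i j) = 0"
| "gdeg a (KappaInv i k) = - (1 - lam a i + 2 * int k)"
| "gdeg a (EtaInv i k) = - (1 + lam a i + 2 * int k)"

text \<open>The layer \<open>(l, g, r)\<close> is the whiskering \<open>l g r\<close> of a generator by words; a diagram is a vertical
  composite of layers, written in composition order (the last layer of the list is applied first).
  The identity of a word is the empty diagram.\<close>

type_synonym layer = "word \<times> gen \<times> word"
type_synonym diagram = "layer list"
type_synonym lindiag = "diagram \<Rightarrow>\<^sub>0 complex"

fun is_diagram :: "nat \<Rightarrow> weight \<Rightarrow> word \<Rightarrow> word \<Rightarrow> diagram \<Rightarrow> bool" where
  "is_diagram m a u v [] \<longleftrightarrow> u = v \<and> u \<in> words m"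
| "is_diagram m a u v ((l, g, r) # D) \<longleftrightarrow>
     v = l @ gtgt g @ r \<and> gen_ok m (wt r a) g \<and> is_diagram m a u (l @ gsrc g @ r) D"

definition deg :: "weight \<Rightarrow> diagram \<Rightarrow> int" where
  "deg a D = (\<Sum>(l, g, r)\<leftarrow>D. gdeg (wt r a) g)"

definition whisker :: "word \<Rightarrow> word \<Rightarrow> lindiag \<Rightarrow> lindiag" where
  "whisker l r = lin_ext (\<lambda>D. basis (map (\<lambda>(l', g, r'). (l @ l', g, r' @ r)) D))"

abbreviation vmul :: "lindiag \<Rightarrow> lindiag \<Rightarrow> lindiag" where
  "vmul \<equiv> bilin_ext (@)"

text \<open>For \<open>x : u \<rightarrow> u'\<close> and \<open>y : v \<rightarrow> v'\<close> the horizontal composite is \<open>(x v') (u y) : u v \<rightarrow> u' v'\<close>.\<close>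

definition hmul :: "word \<Rightarrow> word \<Rightarrow> lindiag \<Rightarrow> lindiag \<Rightarrow> lindiag" where
  "hmul u v' x y = vmul (whisker [] v' x) (whisker u [] y)"

text \<open>The scalars \<open>t\<^sub>i\<^sub>j\<close> (only used for \<open>i \<noteq> j\<close>).\<close>

definition tQ :: "nat \<Rightarrow> nat \<Rightarrow> complex" where
  "tQ i j = (if j = Suc i then -1 else 1)"

definition adj :: "nat \<Rightarrow> nat \<Rightarrow> bool" where
  "adj i j \<longleftrightarrow> i = Suc j \<or> j = Suc i"

definition sigma :: "nat \<Rightarrow> nat \<Rightarrow> diagram" where
  "sigma i j = [([\<F> j, \<E> i], Kappa j, []), ([\<F> j], Cross j i, [\<F> j]), ([], Eta j, [\<E> i, \<F> j])]"

definition kappa_dots :: "nat \<Rightarrow> nat \<Rightarrow> diagram" where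
  "kappa_dots i k = ([], Kappa i, []) # replicate k ([], Dot i, [\<F> i])"

definition eta_dots :: "nat \<Rightarrow> nat \<Rightarrow> diagram" where
  "eta_dots i k = replicate k ([\<F> i], Dot i, []) @ [([], Eta i, [])]"

text \<open>\<open>relator m a u v x\<close>: the relation \<open>x = 0\<close> is imposed on 2-morphisms \<open>u \<rightarrow> v\<close>, where \<open>u\<close> and \<open>v\<close>
  start at the weight \<open>a\<close>.\<close>

inductive relator :: "nat \<Rightarrow> weight \<Rightarrow> word \<Rightarrow> word \<Rightarrow> lindiag \<Rightarrow> bool" for m :: nat where
  interchange:
    "a \<in> weights m \<Longrightarrow> w \<in> words m \<Longrightarrow> gen_ok m (wt (w @ gsrc h) a) g \<Longrightarrow> gen_ok m a h \<Longrightarrow>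
     relator m a (gsrc g @ w @ gsrc h) (gtgt g @ w @ gtgt h)
       (basis [([], g, w @ gtgt h), (gsrc g @ w, h, [])]
        - basis [(gtgt g @ w, h, []), ([], g, w @ gsrc h)])"
| dot_slide_left:
    "a \<in> weights m \<Longrightarrow> i \<in> {1..<m} \<Longrightarrow> j \<in> {1..<m} \<Longrightarrow>
     relator m a [\<E> i, \<E> j] [\<E> j, \<E> i]
       (basis [([], Cross i j, []), ([], Dot i, [\<E> j])]
        - basis [([\<E> j], Dot i, []), ([], Cross i j, [])]
        - (if i = j then basis [] else 0))"
| dot_slide_right:
    "a \<in> weights m \<Longrightarrow> i \<in> {1..<m} \<Longrightarrow> j \<in> {1..<m} \<Longrightarrow>
     relator m a [\<E> i, \<E> j] [\<E> j, \<E> i]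
       (basis [([], Dot j, [\<E> i]), ([], Cross i j, [])]
        - basis [([], Cross i j, []), ([\<E> i], Dot j, [])]
        - (if i = j then basis [] else 0))"
| quadratic:
    "a \<in> weights m \<Longrightarrow> i \<in> {1..<m} \<Longrightarrow> j \<in> {1..<m} \<Longrightarrow>
     relator m a [\<E> i, \<E> j] [\<E> i, \<E> j]
       (basis [([], Cross j i, []), ([], Cross i j, [])]
        - (if i = j then 0
           else if adj i j then
             scl (tQ i j) (basis [([], Dot i, [\<E> j])]) + scl (tQ j i) (basis [([\<E> i], Dot j, [])])
           else basis []))"
| braid:
    "a \<in> weights m \<Longrightarrow> i \<in> {1..<m} \<Longrightarrow> j \<in> {1..<m} \<Longrightarrow> k \<in> {1..<m} \<Longrightarrow>
     relator m a [\<E> i, \<E> j, \<E> k] [\<E> k, \<E> j, \<E> i]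
       (basis [([], Cross j k, [\<E> i]), ([\<E> j], Cross i k, []), ([], Cross i j, [\<E> k])]
        - basis [([\<E> k], Cross i j, []), ([], Cross i k, [\<E> j]), ([\<E> i], Cross j k, [])]
        - (if i = k \<and> adj i j then scl (tQ i j) (basis []) else 0))"
| zigzag_E:
    "a \<in> weights m \<Longrightarrow> i \<in> {1..<m} \<Longrightarrow>
     relator m a [\<E> i] [\<E> i]
       (basis [([], Kappa i, [\<E> i]), ([\<E> i], Eta i, [])] - basis [])"
| zigzag_F:
    "a \<in> weights m \<Longrightarrow> i \<in> {1..<m} \<Longrightarrow>
     relator m a [\<F> i] [\<F> i]
       (basis [([\<F> i], Kappa i, []), ([], Eta i, [\<F> i])] - basis [])"
(* \<sigma>\<^sub>i\<^sub>j is invertible for i \<noteq> j. *)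
| mixed_FE:
    "a \<in> weights m \<Longrightarrow> i \<in> {1..<m} \<Longrightarrow> j \<in> {1..<m} \<Longrightarrow> i \<noteq> j \<Longrightarrow>
     relator m a [\<F> j, \<E> i] [\<F> j, \<E> i]
       (basis (sigma i j @ [([], SigmaInv i j, [])]) - basis [])"
| mixed_EF:
    "a \<in> weights m \<Longrightarrow> i \<in> {1..<m} \<Longrightarrow> j \<in> {1..<m} \<Longrightarrow> i \<noteq> j \<Longrightarrow>
     relator m a [\<E> i, \<F> j] [\<E> i, \<F> j]
       (basis (([], SigmaInv i j, []) # sigma i j) - basis [])"
(* For \<lambda>\<^sub>i \<ge> 0 the column (\<sigma>\<^sub>i\<^sub>i, \<kappa>\<^sub>i, \<dots>) and the row of SigmaInv, KappaInv are
  mutually inverse. *)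
| pos_EF:
    "a \<in> weights m \<Longrightarrow> i \<in> {1..<m} \<Longrightarrow> lam a i \<ge> 0 \<Longrightarrow>
     relator m a [\<E> i, \<F> i] [\<E> i, \<F> i]
       (basis (([], SigmaInv i i, []) # sigma i i)
        + (\<Sum>k<nat (lam a i). basis (([], KappaInv i k, []) # kappa_dots i k)) - basis [])"
| pos_FE:
    "a \<in> weights m \<Longrightarrow> i \<in> {1..<m} \<Longrightarrow> lam a i \<ge> 0 \<Longrightarrow>
     relator m a [\<F> i, \<E> i] [\<F> i, \<E> i]
       (basis (sigma i i @ [([], SigmaInv i i, [])]) - basis [])"
| pos_1_FE:
    "a \<in> weights m \<Longrightarrow> i \<in> {1..<m} \<Longrightarrow> int k < lam a i \<Longrightarrow>
     relator m a [] [\<F> i, \<E> i] (basis (sigma i i @ [([], KappaInv i k, [])]))"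
| pos_FE_1:
    "a \<in> weights m \<Longrightarrow> i \<in> {1..<m} \<Longrightarrow> int k < lam a i \<Longrightarrow>
     relator m a [\<F> i, \<E> i] [] (basis (kappa_dots i k @ [([], SigmaInv i i, [])]))"
| pos_1_1:
    "a \<in> weights m \<Longrightarrow> i \<in> {1..<m} \<Longrightarrow> int k < lam a i \<Longrightarrow> int l < lam a i \<Longrightarrow>
     relator m a [] []
       (basis (kappa_dots i k @ [([], KappaInv i l, [])]) - (if k = l then basis [] else 0))"
(* For \<lambda>\<^sub>i \<le> 0 the row (\<sigma>\<^sub>i\<^sub>i, \<eta>\<^sub>i, \<dots>) and the column of SigmaInv, EtaInv are mutually
  inverse. *)
| neg_FE:
    "a \<in> weights m \<Longrightarrow> i \<in> {1..<m} \<Longrightarrow> lam a i \<le> 0 \<Longrightarrow>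
     relator m a [\<F> i, \<E> i] [\<F> i, \<E> i]
       (basis (sigma i i @ [([], SigmaInv i i, [])])
        + (\<Sum>k<nat (- lam a i). basis (eta_dots i k @ [([], EtaInv i k, [])])) - basis [])"
| neg_EF:
    "a \<in> weights m \<Longrightarrow> i \<in> {1..<m} \<Longrightarrow> lam a i \<le> 0 \<Longrightarrow>
     relator m a [\<E> i, \<F> i] [\<E> i, \<F> i]
       (basis (([], SigmaInv i i, []) # sigma i i) - basis [])"
| neg_1_EF:
    "a \<in> weights m \<Longrightarrow> i \<in> {1..<m} \<Longrightarrow> int k < - lam a i \<Longrightarrow>
     relator m a [] [\<E> i, \<F> i] (basis (([], SigmaInv i i, []) # eta_dots i k))"
| neg_EF_1:
    "a \<in> weights m \<Longrightarrow> i \<in> {1..<m} \<Longrightarrow> int k < - lam a i \<Longrightarrow>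
     relator m a [\<E> i, \<F> i] [] (basis (([], EtaInv i k, []) # sigma i i))"
| neg_1_1:
    "a \<in> weights m \<Longrightarrow> i \<in> {1..<m} \<Longrightarrow> int k < - lam a i \<Longrightarrow> int l < - lam a i \<Longrightarrow>
     relator m a [] []
       (basis (([], EtaInv i k, []) # eta_dots i l) - (if k = l then basis [] else 0))"

text \<open>The relations on 2-morphisms \<open>u \<rightarrow> v\<close> starting at \<open>a\<close>: the two-sided ideal (for both
  compositions) generated by the relators and by the identity 2-morphisms of \<open>1\<^sub>b\<close> for the weights
  \<open>b\<close> in \<open>K\<close>.\<close>

definition ideal :: "nat \<Rightarrow> weight set \<Rightarrow> weight \<Rightarrow> word \<Rightarrow> word \<Rightarrow> lindiag set" where
  "ideal m K a u v = free_vs.span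
     {vmul (basis P) (vmul (whisker l r x) (basis Q)) | P Q l r x u' v'.
        l \<in> words m \<and> r \<in> words m \<and>
        (relator m (wt r a) u' v' x \<or> wt r a \<in> K \<and> u' = [] \<and> v' = [] \<and> x = basis []) \<and>
        is_diagram m a u (l @ u' @ r) Q \<and> is_diagram m a (l @ v' @ r) v P}"

definition diagrams :: "nat \<Rightarrow> weight \<Rightarrow> word \<Rightarrow> word \<Rightarrow> diagram set" where
  "diagrams m a u v = {D. is_diagram m a u v D}"

definition diagrams_of_deg :: "nat \<Rightarrow> weight \<Rightarrow> int \<Rightarrow> word \<Rightarrow> word \<Rightarrow> diagram set" where
  "diagrams_of_deg m a n u v = {D. is_diagram m a u v D \<and> deg a D = n}"

text \<open>\<open>(a, b, [w\<^sub>1, \<dots>, w\<^sub>r])\<close> is the formal direct sum of the composites \<open>w\<^sub>1, \<dots>, w\<^sub>r : a \<rightarrow> b\<close>.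
  A 2-morphism between such sums consists of source, target and matrix.\<close>

type_synonym cell1 = "weight \<times> weight \<times> word list"
type_synonym cell2 = "cell1 \<times> cell1 \<times> (nat \<Rightarrow> nat \<Rightarrow> lindiag set)"

definition UQ_cells1 :: "nat \<Rightarrow> weight \<Rightarrow> weight \<Rightarrow> cell1 set" where
  "UQ_cells1 m a b = {(a, b, ws) | ws. a \<in> weights m \<and> b \<in> weights m \<and> (\<forall>w\<in>set ws. w \<in> words m \<and> wt w a = b)}"

text \<open>The 2-morphisms all of whose matrix entries are classes of combinations of the diagrams in
  \<open>S a u v\<close>.\<close>

definition UQ_matrices ::
  "nat \<Rightarrow> weight set \<Rightarrow> (weight \<Rightarrow> word \<Rightarrow> word \<Rightarrow> diagram set) \<Rightarrow> cell1 \<Rightarrow> cell1 \<Rightarrow> cell2 set" where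
  "UQ_matrices m K S = (\<lambda>(a, b, us) (a', b', vs).
     {((a, b, us), (a', b', vs), mat (length vs) (length us) M) | M.
        a = a' \<and> b = b' \<and> (a, b, us) \<in> UQ_cells1 m a b \<and> (a, b, vs) \<in> UQ_cells1 m a b \<and>
        (\<forall>i<length vs. \<forall>j<length us.
           M i j \<in> coset (ideal m K a (us ! j) (vs ! i)) ` free_vs.span (basis ` S a (us ! j) (vs ! i)))})"

text \<open>\<open>UQ m K\<close> is \<open>\<U>\<^sub>Q(gl\<^sub>m)\<^sup>*\<close> with the weights in \<open>K\<close> killed. Composition of 1-morphisms
  distributes over direct sums; summands of a composite are ordered lexicographically, so that it is
  strictly associative, and horizontal composites of matrices are Kronecker products.\<close>

definition UQ :: "nat \<Rightarrow> weight set \<Rightarrow> (weight, cell1, cell2) graded_2cat" where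
  "UQ m K =
     \<lparr> obj = weights m,
       cells1 = UQ_cells1 m,
       cells2 = UQ_matrices m K (diagrams m),
       homog = (\<lambda>n. \<Union>f g. UQ_matrices m K (\<lambda>a. diagrams_of_deg m a n) f g),
       id1 = (\<lambda>a. (a, a, [[]])),
       comp1 = (\<lambda>(b, c, us) (a, b', vs). (a, c, map (\<lambda>(u, v). u @ v) (List.product us vs))),
       id2 = (\<lambda>(a, b, us). ((a, b, us), (a, b, us), mat (length us) (length us) (\<lambda>i j.
          coset (ideal m K a (us ! j) (us ! i)) (if i = j then basis [] else 0)))),
       vcomp = (\<lambda>(g, (a, b, ws), N) ((a', b', us), (a'', b'', vs), M).
          ((a', b', us), (a, b, ws), mat (length ws) (length us) (\<lambda>i k.
             coset (ideal m K a (us ! k) (ws ! i))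
               (\<Sum>j<length vs. vmul (rep (N i j)) (rep (M j k)))))),
       hcomp = (\<lambda>((b, c, us), (b', c', us'), N) ((a, b'', vs), (a', b''', vs'), M).
          ((a, c, map (\<lambda>(u, v). u @ v) (List.product us vs)),
           (a, c, map (\<lambda>(u, v). u @ v) (List.product us' vs')),
           mat (length us' * length vs') (length us * length vs) (\<lambda>i j.
             let i1 = i div length vs'; i2 = i mod length vs';
                 j1 = j div length vs; j2 = j mod length vs
             in coset (ideal m K a (us ! j1 @ vs ! j2) (us' ! i1 @ vs' ! i2))
                  (hmul (us ! j1) (vs' ! i2) (rep (N i1 j1)) (rep (M i2 j2)))))),
       add2 = (\<lambda>((a, b, us), (a', b', vs), M) (f, g, N).
          ((a, b, us), (a', b', vs), mat (length vs) (length us) (\<lambda>i j.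
             coset (ideal m K a (us ! j) (vs ! i)) (rep (M i j) + rep (N i j))))),
       scale2 = (\<lambda>t ((a, b, us), (a', b', vs), M).
          ((a, b, us), (a', b', vs), mat (length vs) (length us) (\<lambda>i j.
             coset (ideal m K a (us ! j) (vs ! i)) (scl t (rep (M i j)))))) \<rparr>"

definition UQ_le2 :: "nat \<Rightarrow> (weight, cell1, cell2) graded_2cat" where
  "UQ_le2 m = UQ m {a \<in> weights m. \<not> set a \<subseteq> {0, 1, 2}}"

end

theory Submission
  imports Defs
begin

text \<open>
  Because the unit laws are strict, a pair \<open>(p, \<sigma>)\<close> with \<open>\<sigma> : p 1\<^sub>c \<rightarrow> 1\<^sub>d p\<close> is the same as a 1-morphism
  \<open>p : c \<rightarrow> d\<close> with an endomorphism of \<open>p\<close>, and under this identification the relations of the two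
  traces agree. Hence the vertical trace is the full subcategory of the horizontal trace on the
  identity 1-morphisms (\<open>equivalence_if_splits\<close>), and the point is to see that every endo-1-morphism
  of every weight is, in the horizontal trace, a direct sum of shifts of identities. A formal direct
  sum of words is the direct sum of its words, so this concerns a single word \<open>w : a \<rightarrow> a\<close> in the
  letters \<open>\<E>\<^sub>i\<close>, \<open>\<F>\<^sub>i\<close> (\<open>good_closed_word\<close>). Three facts suffice.

  \<^item> A word that passes through a killed weight is a zero object (\<open>good_killed\<close>).
  \<^item> A factor \<open>\<E>\<^sub>i \<F>\<^sub>j\<close> can be replaced by \<open>\<F>\<^sub>j \<E>\<^sub>i\<close>, up to shifted copies of the shorter word without
    this factor if \<open>i = j\<close> (\<open>good_swap\<close>): if \<open>i \<noteq> j\<close> or \<open>\<lambda>\<^sub>i \<ge> 0\<close>, this is what the invertibility of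
    \<open>\<sigma>\<^sub>i\<^sub>j\<close>, or of its extension by the \<open>\<kappa>\<^sub>i (x\<^sub>i\<^sup>k \<F>\<^sub>i)\<close>, says; if \<open>i = j\<close> and \<open>\<lambda>\<^sub>i < 0\<close>, the word is zero,
    since \<open>\<F>\<^sub>i\<close> leads from a weight with entries in \<open>{0, 1, 2}\<close> to one with an entry \<open>-1\<close> or \<open>3\<close>.
  \<^item> \<open>\<F>\<^sub>i w\<close> and \<open>w \<F>\<^sub>i\<close> are isomorphic in the horizontal trace, because \<open>\<F>\<^sub>i\<close> has the left adjoint
    \<open>\<E>\<^sub>i\<close> (\<open>hTr_rotate\<close>, \<open>good_rotate\<close>).

  Assume that all words shorter than \<open>w\<close> split. By the second fact \<open>w\<close> may be assumed to have the
  form \<open>\<F> \<dots> \<F> \<E> \<dots> \<E>\<close>. Rotating all letters \<open>\<F>\<close> to the right end gives \<open>\<E> \<dots> \<E> \<F> \<dots> \<F>\<close>, now at the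
  weight reached from \<open>a\<close> by the letters \<open>\<E>\<close>, and straightening gives the original word at this weight.
  Every letter \<open>\<E>\<close> lowers \<open>\<Sum>\<^sub>k k a\<^sub>k\<close>, which is nonnegative on the surviving weights; so after finitely
  many rounds the word starts at a killed weight, unless it contains no \<open>\<E>\<close>, in which case it is empty
  (\<open>good_straight_word\<close>).

  The remaining work is to show that the traces of a strict linear 2-category are categories and that
  the 2-category at hand is one (\<open>linear_2cat_UQ\<close>); the interchange law is derived from the interchange
  relation for two generators.
\<close>

section \<open>Linear maps between free vector spaces\<close>

text \<open>Linearity for maps between free complex vector spaces.\<close>

definition lin :: "(('a \<Rightarrow>\<^sub>0 complex) \<Rightarrow> ('b \<Rightarrow>\<^sub>0 complex)) \<Rightarrow> bool" where
  "lin f \<longleftrightarrow> (\<forall>x y. f (x + y) = f x + f y) \<and> (\<forall>c x. f (scl c x) = scl c (f x))"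

lemma linI: "(\<And>x y. f (x + y) = f x + f y) \<Longrightarrow> (\<And>c x. f (scl c x) = scl c (f x)) \<Longrightarrow> lin f"
  by (simp add: lin_def)

lemma lin_add: "lin f \<Longrightarrow> f (x + y) = f x + f y"
  and lin_scl: "lin f \<Longrightarrow> f (scl c x) = scl c (f x)"
  by (simp_all add: lin_def)

lemma lin_0: "lin f \<Longrightarrow> f 0 = 0"
  using lin_scl[of f 0 0] by simp

lemma lin_diff: "lin f \<Longrightarrow> f (x - y) = f x - f y"
  using lin_add[of f "x - y" y] by (simp add: algebra_simps)

lemma lin_sum: "lin f \<Longrightarrow> f (\<Sum>i\<in>A. g i) = (\<Sum>i\<in>A. f (g i))"
  by (induction A rule: infinite_finite_induct) (auto simp: lin_0 lin_add)

lemma lin_ident: "lin (\<lambda>x. x)"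
  by (simp add: lin_def)

lemma lin_comp: "lin f \<Longrightarrow> lin g \<Longrightarrow> lin (\<lambda>x. f (g x))"
  by (simp add: lin_def)

lemma lin_plus: "lin f \<Longrightarrow> lin g \<Longrightarrow> lin (\<lambda>x. f x + g x)"
  by (simp add: lin_def free_vs.scale_right_distrib algebra_simps)

lemma lin_minus: "lin f \<Longrightarrow> lin g \<Longrightarrow> lin (\<lambda>x. f x - g x)"
  by (simp add: lin_def free_vs.scale_right_diff_distrib algebra_simps)

lemma lin_eq_on_span:
  assumes "lin f" "lin g" "x \<in> free_vs.span S" "\<And>b. b \<in> S \<Longrightarrow> f b = g b"
  shows "f x = g x"
  using assms(3)
  by (induction rule: free_vs.span_induct_alt) (simp_all add: assms lin_0 lin_add lin_scl)

lemma lin_into_span: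
  assumes "lin f" "free_vs.subspace T" "x \<in> free_vs.span S" "\<And>b. b \<in> S \<Longrightarrow> f b \<in> T"
  shows "f x \<in> T"
  using assms(3)
  by (induction rule: free_vs.span_induct_alt)
    (simp_all add: assms lin_0 lin_add lin_scl free_vs.subspace_0 free_vs.subspace_add
      free_vs.subspace_scale)

lemma basis_expansion:
  fixes x :: "'a \<Rightarrow>\<^sub>0 complex"
  shows "x = (\<Sum>k\<in>Poly_Mapping.keys x. scl (Poly_Mapping.lookup x k) (basis k))"
proof (rule poly_mapping_eqI)
  fix l
  have "Poly_Mapping.lookup (\<Sum>k\<in>A. scl (Poly_Mapping.lookup x k) (basis k)) l
      = (\<Sum>k\<in>A. Poly_Mapping.lookup x k * (if l = k then 1 else 0))" for A
    by (induction A rule: infinite_finite_induct)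
      (auto simp: lookup_add lookup_single when_def)
  then show "Poly_Mapping.lookup x l
      = Poly_Mapping.lookup (\<Sum>k\<in>Poly_Mapping.keys x. scl (Poly_Mapping.lookup x k) (basis k)) l"
    by (simp add: if_distrib[of "\<lambda>y. _ * y"] sum.delta in_keys_iff cong: if_cong)
qed

lemma span_basis_UNIV: "x \<in> free_vs.span (basis ` UNIV)"
  by (subst basis_expansion[of x])
    (intro free_vs.span_sum free_vs.span_scale free_vs.span_base, simp)

lemma lin_eqI: "lin f \<Longrightarrow> lin g \<Longrightarrow> (\<And>k. f (basis k) = g (basis k)) \<Longrightarrow> f x = g x"
  using lin_eq_on_span[OF _ _ span_basis_UNIV, of f g x] by blast

lemma lin_ext_superset:
  assumes "finite A" "Poly_Mapping.keys x \<subseteq> A"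
  shows "lin_ext h x = (\<Sum>k\<in>A. scl (Poly_Mapping.lookup x k) (h k))"
  unfolding lin_ext_def using assms by (intro sum.mono_neutral_left) (auto simp: in_keys_iff)

lemma lin_lin_ext: "lin (lin_ext h)"
proof (rule linI)
  fix x y :: "'a \<Rightarrow>\<^sub>0 complex"
  let ?A = "Poly_Mapping.keys x \<union> Poly_Mapping.keys y"
  have "Poly_Mapping.keys (x + y) \<subseteq> ?A" by (rule Poly_Mapping.keys_add)
  then show "lin_ext h (x + y) = lin_ext h x + lin_ext h y"
    by (simp add: lin_ext_superset[of ?A] lookup_add free_vs.scale_left_distrib sum.distrib)
next
  fix c and x :: "'a \<Rightarrow>\<^sub>0 complex"
  have "Poly_Mapping.keys (scl c x) \<subseteq> Poly_Mapping.keys x" by (auto simp: in_keys_iff)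
  then show "lin_ext h (scl c x) = scl c (lin_ext h x)"
    by (simp add: lin_ext_superset[of "Poly_Mapping.keys x"] free_vs.scale_sum_right)
qed

lemma lin_ext_basis [simp]: "lin_ext h (basis k) = h k"
  by (simp add: lin_ext_def)

lemma bilin_ext_basis [simp]: "bilin_ext h (basis k) (basis l) = basis (h k l)"
  by (simp add: bilin_ext_def)

lemma lin_bilin_left: "lin (\<lambda>x. bilin_ext h x y)"
  unfolding bilin_ext_def by (rule lin_lin_ext)

lemma lin_bilin_right: "lin (bilin_ext h x)"
proof (rule linI)
  fix y z
  show "bilin_ext h x (y + z) = bilin_ext h x y + bilin_ext h x z"
    by (rule lin_eqI[OF lin_bilin_left lin_plus[OF lin_bilin_left lin_bilin_left]])
      (simp add: bilin_ext_def lin_add[OF lin_lin_ext])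
next
  fix c y
  have "lin (\<lambda>x. scl c (bilin_ext h x y))"
    by (rule linI)
      (simp_all add: lin_add[OF lin_bilin_left] lin_scl[OF lin_bilin_left] free_vs.scale_right_distrib
        mult.commute)
  from lin_eqI[OF lin_bilin_left this, of h "scl c y" x]
  show "bilin_ext h x (scl c y) = scl c (bilin_ext h x y)"
    by (simp add: bilin_ext_def lin_scl[OF lin_lin_ext])
qed

lemmas bilin_simps =
  lin_add[OF lin_bilin_left] lin_add[OF lin_bilin_right]
  lin_diff[OF lin_bilin_left] lin_diff[OF lin_bilin_right]
  lin_scl[OF lin_bilin_left] lin_scl[OF lin_bilin_right]
  lin_0[OF lin_bilin_left] lin_0[OF lin_bilin_right]

lemmas bilin_sum = lin_sum[OF lin_bilin_left] lin_sum[OF lin_bilin_right]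

lemma bilin_into_subspace:
  assumes "free_vs.subspace T" "x \<in> free_vs.span S" "y \<in> free_vs.span S'"
    "\<And>b b'. b \<in> S \<Longrightarrow> b' \<in> S' \<Longrightarrow> bilin_ext h b b' \<in> T"
  shows "bilin_ext h x y \<in> T"
  using lin_into_span[OF lin_bilin_left assms(1,2)] lin_into_span[OF lin_bilin_right assms(1,3)]
    assms(4) by blast

lemma bilin_eq_on_span:
  assumes "x \<in> free_vs.span (basis ` A)" "y \<in> free_vs.span (basis ` B)"
    and "\<And>a b. a \<in> A \<Longrightarrow> b \<in> B \<Longrightarrow> h a b = h' a b"
  shows "bilin_ext h x y = bilin_ext h' x y"
  by (rule lin_eq_on_span[OF lin_bilin_left lin_bilin_left assms(1)],
      rule lin_eq_on_span[OF lin_bilin_right lin_bilin_right assms(2)])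
    (use assms(3) in auto)

lemma coset_eq_iff:
  assumes "free_vs.subspace I"
  shows "coset I x = coset I y \<longleftrightarrow> x - y \<in> I"
proof
  assume "coset I x = coset I y"
  moreover have "x \<in> coset I x" using assms by (simp add: coset_def free_vs.subspace_0)
  ultimately show "x - y \<in> I" by (simp add: coset_def)
next
  assume *: "x - y \<in> I"
  have "z - x \<in> I \<longleftrightarrow> z - y \<in> I" for z
    using free_vs.subspace_add[OF assms _ *, of "z - x"]
      free_vs.subspace_diff[OF assms _ *, of "z - y"] by (auto simp: algebra_simps)
  then show "coset I x = coset I y" by (simp add: coset_def)
qed

lemma rep_coset:
  assumes "free_vs.subspace I"
  shows "rep (coset I x) - x \<in> I"
proof -
  have "x \<in> coset I x" using assms by (simp add: coset_def free_vs.subspace_0)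
  then have "rep (coset I x) \<in> coset I x" unfolding rep_def by (rule someI)
  then show ?thesis by (simp add: coset_def)
qed

lemma coset_rep:
  assumes "free_vs.subspace I"
  shows "coset I (rep (coset I x)) = coset I x"
  by (simp add: coset_eq_iff[OF assms] rep_coset[OF assms])

lemma mat_cong: "(\<And>i j. i < r \<Longrightarrow> j < s \<Longrightarrow> M i j = N i j) \<Longrightarrow> mat r s M = mat r s N"
  by (auto simp: mat_def fun_eq_iff)

lemma mat_nth [simp]: "i < r \<Longrightarrow> j < s \<Longrightarrow> mat r s M i j = M i j"
  by (simp add: mat_def)

lemma sum_single:
  assumes "(n::nat) < N" "\<And>j. j < N \<Longrightarrow> j \<noteq> n \<Longrightarrow> f j = 0"
  shows "(\<Sum>j<N. f j) = (f n :: 'b :: comm_monoid_add)"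
proof -
  have "(\<Sum>j<N. f j) = (\<Sum>j\<in>{n}. f j)"
    using assms by (intro sum.mono_neutral_right) auto
  then show ?thesis by simp
qed

lemma div_mod_less: "(i::nat) < r * s \<Longrightarrow> i div s < r \<and> i mod s < s"
  by (metis less_mult_imp_div_less mod_less_divisor mult_0_right neq0_conv not_less0)

lemma sum_div_mod:
  fixes f :: "nat \<Rightarrow> nat \<Rightarrow> 'b :: comm_monoid_add"
  shows "(\<Sum>j<r * s. f (j div s) (j mod s)) = (\<Sum>j1<r. \<Sum>j2<s. f j1 j2)"
proof (cases "s = 0")
  case False
  have "(\<Sum>j<r * s. f (j div s) (j mod s)) = (\<Sum>(j1, j2)\<in>{..<r} \<times> {..<s}. f j1 j2)"
  proof (rule sum.reindex_bij_witness[of _ "\<lambda>(j1, j2). j1 * s + j2" "\<lambda>j. (j div s, j mod s)"])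
    fix t assume "t \<in> {..<r} \<times> {..<s}"
    then obtain j1 j2 where t: "t = (j1, j2)" "j1 < r" "j2 < s" by auto
    have "Suc j1 * s \<le> r * s" using t by (intro mult_le_mono1) simp
    then show "(case t of (j1, j2) \<Rightarrow> j1 * s + j2) \<in> {..<r * s}" using t by simp
    show "((case t of (j1, j2) \<Rightarrow> j1 * s + j2) div s, (case t of (j1, j2) \<Rightarrow> j1 * s + j2) mod s) = t"
      using t by simp
  qed (use div_mod_less in auto)
  then show ?thesis by (simp add: sum.cartesian_product)
qed simp

section \<open>Essentially surjective inclusions of full subcategories\<close>

text \<open>The inverse functor chooses for every object \<open>y\<close> of \<open>D\<close> an isomorphism \<open>\<phi> y\<close> from an object
  of the subcategory, and conjugates morphisms by these isomorphisms.\<close>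

lemma equivalence_if_full_subcategory:
  fixes C :: "('o, 'm) cat" and D :: "('p, 'm) cat"
  assumes D: "category D"
    and ob: "\<And>x. x \<in> ob C \<Longrightarrow> Fo x \<in> ob D"
    and hom: "\<And>x y. x \<in> ob C \<Longrightarrow> y \<in> ob C \<Longrightarrow> hom C x y = hom D (Fo x) (Fo y)"
    and idn: "\<And>x. x \<in> ob C \<Longrightarrow> idn C x = idn D (Fo x)"
    and cmp: "\<And>x y z f g. x \<in> ob C \<Longrightarrow> y \<in> ob C \<Longrightarrow> z \<in> ob C \<Longrightarrow> f \<in> hom C x y \<Longrightarrow>
        g \<in> hom C y z \<Longrightarrow> cmp C x y z g f = cmp D (Fo x) (Fo y) (Fo z) g f"
    and Fm: "\<And>x y f. x \<in> ob C \<Longrightarrow> y \<in> ob C \<Longrightarrow> f \<in> hom C x y \<Longrightarrow> Fm x y f = f"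
    and ess: "\<And>y. y \<in> ob D \<Longrightarrow> \<exists>x\<in>ob C. \<exists>f. is_iso D (Fo x) y f"
  shows "equivalence_of_categories C D Fo Fm"
proof -
  have idD: "idn D x \<in> hom D x x" if "x \<in> ob D" for x
    using D that by (simp add: category_def)
  have cmpD: "cmp D x y z g f \<in> hom D x z"
    if "x \<in> ob D" "y \<in> ob D" "z \<in> ob D" "f \<in> hom D x y" "g \<in> hom D y z" for x y z f g
    using D that by (simp add: category_def)
  have unitD: "cmp D x x y f (idn D x) = f" "cmp D x y y (idn D y) f = f"
    if "x \<in> ob D" "y \<in> ob D" "f \<in> hom D x y" for x y f
    using D that by (simp_all add: category_def)
  have assocD: "cmp D w x z (cmp D x y z h g) f = cmp D w y z h (cmp D w x y g f)"
    if "w \<in> ob D" "x \<in> ob D" "y \<in> ob D" "z \<in> ob D" "f \<in> hom D w x" "g \<in> hom D x y" "h \<in> hom D y z"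
    for w x y z f g h
    using D that unfolding category_def by blast
  have C: "category C"
    unfolding category_def
    by (intro conjI ballI) (simp_all add: hom idn cmp ob idD cmpD unitD assocD)
  have F: "is_functor C D Fo Fm"
    unfolding is_functor_def
    by (intro conjI ballI)
      (simp_all add: ob Fm cmp idn hom[symmetric],
       simp_all add: Fm hom idn ob idD cmpD)
  have "\<forall>y\<in>ob D. \<exists>x f g. x \<in> ob C \<and> f \<in> hom D (Fo x) y \<and> g \<in> hom D y (Fo x) \<and>
      cmp D (Fo x) y (Fo x) g f = idn D (Fo x) \<and> cmp D y (Fo x) y f g = idn D y"
    using ess unfolding is_iso_def by meson
  then obtain Go \<phi> \<psi> where G: "\<And>y. y \<in> ob D \<Longrightarrow> Go y \<in> ob C"
    and \<phi>: "\<And>y. y \<in> ob D \<Longrightarrow> \<phi> y \<in> hom D (Fo (Go y)) y"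
    and \<psi>: "\<And>y. y \<in> ob D \<Longrightarrow> \<psi> y \<in> hom D y (Fo (Go y))"
    and \<psi>\<phi>: "\<And>y. y \<in> ob D \<Longrightarrow> cmp D (Fo (Go y)) y (Fo (Go y)) (\<psi> y) (\<phi> y) = idn D (Fo (Go y))"
    and \<phi>\<psi>: "\<And>y. y \<in> ob D \<Longrightarrow> cmp D y (Fo (Go y)) y (\<phi> y) (\<psi> y) = idn D y"
    by metis
  define Gm where "Gm x y g = cmp D (Fo (Go x)) y (Fo (Go y)) (\<psi> y) (cmp D (Fo (Go x)) x y g (\<phi> x))"
    for x y g
  note FG = ob[OF G]
  have Gm: "Gm x y g \<in> hom D (Fo (Go x)) (Fo (Go y))"
    if "x \<in> ob D" "y \<in> ob D" "g \<in> hom D x y" for x y g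
    unfolding Gm_def using that by (intro cmpD FG \<phi> \<psi>)
  have \<phi>Gm: "cmp D (Fo (Go x)) (Fo (Go y)) y (\<phi> y) (Gm x y g) = cmp D (Fo (Go x)) x y g (\<phi> x)"
    if "x \<in> ob D" "y \<in> ob D" "g \<in> hom D x y" for x y g
    unfolding Gm_def using that
    by (subst assocD[symmetric]) (auto intro!: cmpD unitD simp: FG \<phi> \<psi> \<phi>\<psi>)
  have Gm\<psi>: "cmp D x (Fo (Go x)) (Fo (Go y)) (Gm x y g) (\<psi> x) = cmp D x y (Fo (Go y)) (\<psi> y) g"
    if "x \<in> ob D" "y \<in> ob D" "g \<in> hom D x y" for x y g
  proof -
    have "cmp D x (Fo (Go x)) (Fo (Go y)) (Gm x y g) (\<psi> x)
        = cmp D x y (Fo (Go y)) (\<psi> y) (cmp D x (Fo (Go x)) y (cmp D (Fo (Go x)) x y g (\<phi> x)) (\<psi> x))"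
      unfolding Gm_def using that by (intro assocD FG cmpD \<phi> \<psi>)
    also have "cmp D x (Fo (Go x)) y (cmp D (Fo (Go x)) x y g (\<phi> x)) (\<psi> x) = g"
      using that by (subst assocD) (auto simp: FG \<phi> \<psi> \<phi>\<psi> unitD)
    finally show ?thesis .
  qed
  have "is_functor D C Go Gm"
    unfolding is_functor_def
  proof (intro conjI ballI)
    fix x assume x: "x \<in> ob D"
    show "Go x \<in> ob C" using G x .
    show "Gm x x (idn D x) = idn C (Go x)"
      unfolding Gm_def using x by (simp add: unitD FG \<phi> \<psi>\<phi> idn G)
  next
    fix x y f assume "x \<in> ob D" "y \<in> ob D" "f \<in> hom D x y"
    then show "Gm x y f \<in> hom C (Go x) (Go y)" by (simp add: hom G Gm)
  next
    fix x y z f g assume *: "x \<in> ob D" "y \<in> ob D" "z \<in> ob D" "f \<in> hom D x y" "g \<in> hom D y z"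
    let ?x = "Fo (Go x)" and ?y = "Fo (Go y)" and ?z = "Fo (Go z)"
    have "cmp C (Go x) (Go y) (Go z) (Gm y z g) (Gm x y f) = cmp D ?x ?y ?z (Gm y z g) (Gm x y f)"
      using * by (intro cmp) (auto simp: hom G Gm)
    also have "\<dots> = cmp D ?x z ?z (\<psi> z) (cmp D ?x ?y z (cmp D ?y y z g (\<phi> y)) (Gm x y f))"
      unfolding Gm_def[of y z g] using * by (intro assocD FG cmpD \<phi> \<psi> Gm)
    also have "cmp D ?x ?y z (cmp D ?y y z g (\<phi> y)) (Gm x y f) = cmp D ?x y z g (cmp D ?x x y f (\<phi> x))"
      using * by (subst assocD) (auto intro!: Gm simp: FG \<phi> \<phi>Gm)
    also have "\<dots> = cmp D ?x x z (cmp D x y z g f) (\<phi> x)"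
      using * by (intro assocD[symmetric] FG \<phi>)
    finally show "Gm x z (cmp D x y z g f) = cmp C (Go x) (Go y) (Go z) (Gm y z g) (Gm x y f)"
      by (simp add: Gm_def)
  qed
  moreover have "naturally_isomorphic C C (\<lambda>x. x) (\<lambda>x y f. f)
      (\<lambda>x. Go (Fo x)) (\<lambda>x y f. Gm (Fo x) (Fo y) (Fm x y f))"
    unfolding naturally_isomorphic_def
  proof (intro exI[of _ "\<lambda>x. \<psi> (Fo x)"] conjI ballI)
    fix x assume x: "x \<in> ob C"
    have "cmp C x (Go (Fo x)) x (\<phi> (Fo x)) (\<psi> (Fo x)) = idn C x"
      "cmp C (Go (Fo x)) x (Go (Fo x)) (\<psi> (Fo x)) (\<phi> (Fo x)) = idn C (Go (Fo x))"
      using x by (simp_all add: cmp hom G ob \<phi> \<psi> \<phi>\<psi> \<psi>\<phi> idn)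
    then show "is_iso C x (Go (Fo x)) (\<psi> (Fo x))"
      unfolding is_iso_def using x by (auto simp: hom G ob \<phi> \<psi> intro!: bexI[of _ "\<phi> (Fo x)"])
  next
    fix x y f assume "x \<in> ob C" "y \<in> ob C" "f \<in> hom C x y"
    then show "cmp C x y (Go (Fo y)) (\<psi> (Fo y)) f
        = cmp C x (Go (Fo x)) (Go (Fo y)) (Gm (Fo x) (Fo y) (Fm x y f)) (\<psi> (Fo x))"
      by (simp add: Fm cmp hom G ob \<psi> Gm Gm\<psi>)
  qed
  moreover have "naturally_isomorphic D D
      (\<lambda>x. Fo (Go x)) (\<lambda>x y f. Fm (Go x) (Go y) (Gm x y f)) (\<lambda>x. x) (\<lambda>x y f. f)"
    unfolding naturally_isomorphic_def
  proof (intro exI[of _ \<phi>] conjI ballI)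
    fix x assume "x \<in> ob D"
    then show "is_iso D (Fo (Go x)) x (\<phi> x)"
      unfolding is_iso_def by (auto simp: \<phi> \<psi> \<phi>\<psi> \<psi>\<phi> intro!: bexI[of _ "\<psi> x"])
  next
    fix x y f assume "x \<in> ob D" "y \<in> ob D" "f \<in> hom D x y"
    then show "cmp D (Fo (Go x)) (Fo (Go y)) y (\<phi> y) (Fm (Go x) (Go y) (Gm x y f))
        = cmp D (Fo (Go x)) x y f (\<phi> x)"
      by (simp add: Fm hom G Gm \<phi>Gm)
  qed
  ultimately show ?thesis
    unfolding equivalence_of_categories_def using C D F by blast
qed

section \<open>Formal direct sums in a linear category given by generators and relations\<close>

text \<open>The linear category underlying \<open>sum_cat\<close>. Its morphisms are spanned by \<open>gens\<close>, but the
  relations live in the span of the larger sets \<open>G\<close> (in the traces: generators of all degrees), in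
  which arbitrarily chosen representatives of cosets are to be found.\<close>

locale presented_category =
  fixes X :: "'x set" and gens G :: "'x \<Rightarrow> 'x \<Rightarrow> 'g set"
    and rels :: "'x \<Rightarrow> 'x \<Rightarrow> ('g \<Rightarrow>\<^sub>0 complex) set"
    and one :: "'x \<Rightarrow> 'g" and mult :: "'g \<Rightarrow> 'g \<Rightarrow> 'g"
  assumes gens_G: "x \<in> X \<Longrightarrow> y \<in> X \<Longrightarrow> gens x y \<subseteq> G x y"
    and subspace_rels: "free_vs.subspace (rels x y)"
    and rels_G: "x \<in> X \<Longrightarrow> y \<in> X \<Longrightarrow> rels x y \<subseteq> free_vs.span (basis ` G x y)"
    and one_gens: "x \<in> X \<Longrightarrow> one x \<in> gens x x"
    and mult_gens: "x \<in> X \<Longrightarrow> y \<in> X \<Longrightarrow> z \<in> X \<Longrightarrow> g \<in> gens y z \<Longrightarrow> f \<in> gens x y \<Longrightarrow>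
      mult g f \<in> gens x z"
    and mult_G: "x \<in> X \<Longrightarrow> y \<in> X \<Longrightarrow> z \<in> X \<Longrightarrow> g \<in> G y z \<Longrightarrow> f \<in> G x y \<Longrightarrow> mult g f \<in> G x z"
    and mult_assoc: "w \<in> X \<Longrightarrow> x \<in> X \<Longrightarrow> y \<in> X \<Longrightarrow> z \<in> X \<Longrightarrow>
      h \<in> G y z \<Longrightarrow> g \<in> G x y \<Longrightarrow> f \<in> G w x \<Longrightarrow> mult (mult h g) f = mult h (mult g f)"
    and mult_one: "x \<in> X \<Longrightarrow> y \<in> X \<Longrightarrow> f \<in> G x y \<Longrightarrow> mult f (one x) = f"
    and one_mult: "x \<in> X \<Longrightarrow> y \<in> X \<Longrightarrow> f \<in> G x y \<Longrightarrow> mult (one y) f = f"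
    and rels_left: "x \<in> X \<Longrightarrow> y \<in> X \<Longrightarrow> z \<in> X \<Longrightarrow> g \<in> G y z \<Longrightarrow> r \<in> rels x y \<Longrightarrow>
      bilin_ext mult (basis g) r \<in> rels x z"
    and rels_right: "x \<in> X \<Longrightarrow> y \<in> X \<Longrightarrow> z \<in> X \<Longrightarrow> r \<in> rels y z \<Longrightarrow> f \<in> G x y \<Longrightarrow>
      bilin_ext mult r (basis f) \<in> rels x z"
begin

abbreviation mul (infixl "\<star>" 70) where "mul \<equiv> bilin_ext mult"
abbreviation SG where "SG x y \<equiv> free_vs.span (basis ` G x y)"
abbreviation Sg where "Sg x y \<equiv> free_vs.span (basis ` gens x y)"
abbreviation unit where "unit x \<equiv> (basis (one x) :: 'g \<Rightarrow>\<^sub>0 complex)"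

lemma Sg_SG: "x \<in> X \<Longrightarrow> y \<in> X \<Longrightarrow> a \<in> Sg x y \<Longrightarrow> a \<in> SG x y"
  using free_vs.span_mono[OF image_mono[OF gens_G]] by blast

lemma rels_SG: "x \<in> X \<Longrightarrow> y \<in> X \<Longrightarrow> a \<in> rels x y \<Longrightarrow> a \<in> SG x y"
  using rels_G by blast

lemma unit_Sg: "x \<in> X \<Longrightarrow> unit x \<in> Sg x x"
  by (simp add: free_vs.span_base one_gens)

lemma prod_Sg:
  "x \<in> X \<Longrightarrow> y \<in> X \<Longrightarrow> z \<in> X \<Longrightarrow> b \<in> Sg y z \<Longrightarrow> a \<in> Sg x y \<Longrightarrow> b \<star> a \<in> Sg x z"
  by (rule bilin_into_subspace) (auto intro!: free_vs.span_base mult_gens)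

lemma prod_SG:
  "x \<in> X \<Longrightarrow> y \<in> X \<Longrightarrow> z \<in> X \<Longrightarrow> b \<in> SG y z \<Longrightarrow> a \<in> SG x y \<Longrightarrow> b \<star> a \<in> SG x z"
  by (rule bilin_into_subspace) (auto intro!: free_vs.span_base mult_G)

lemma prod_rels_left:
  "x \<in> X \<Longrightarrow> y \<in> X \<Longrightarrow> z \<in> X \<Longrightarrow> b \<in> SG y z \<Longrightarrow> r \<in> rels x y \<Longrightarrow> b \<star> r \<in> rels x z"
  by (rule lin_into_span[OF lin_bilin_left subspace_rels]) (auto intro: rels_left)

lemma prod_rels_right:
  "x \<in> X \<Longrightarrow> y \<in> X \<Longrightarrow> z \<in> X \<Longrightarrow> r \<in> rels y z \<Longrightarrow> a \<in> SG x y \<Longrightarrow> r \<star> a \<in> rels x z"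
  by (rule lin_into_span[OF lin_bilin_right subspace_rels]) (auto intro: rels_right)

lemma prod_assoc:
  assumes X: "w \<in> X" "x \<in> X" "y \<in> X" "z \<in> X" and "c \<in> SG y z" "b \<in> SG x y" "a \<in> SG w x"
  shows "c \<star> b \<star> a = c \<star> (b \<star> a)"
proof (rule lin_eq_on_span[OF _ _ assms(5)])
  show "lin (\<lambda>c. c \<star> b \<star> a)" "lin (\<lambda>c. c \<star> (b \<star> a))"
    by (intro lin_comp[OF lin_bilin_left lin_bilin_left] lin_bilin_left)+
  fix h assume "h \<in> basis ` G y z"
  then obtain h' where h: "h = basis h'" "h' \<in> G y z" by blast
  show "h \<star> b \<star> a = h \<star> (b \<star> a)"
  proof (rule lin_eq_on_span[OF _ _ assms(6)])
    show "lin (\<lambda>b. h \<star> b \<star> a)" "lin (\<lambda>b. h \<star> (b \<star> a))"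
      by (intro lin_comp[OF lin_bilin_left lin_bilin_right] lin_comp[OF lin_bilin_right lin_bilin_left])+
    fix g assume "g \<in> basis ` G x y"
    then obtain g' where g: "g = basis g'" "g' \<in> G x y" by blast
    show "h \<star> g \<star> a = h \<star> (g \<star> a)"
    proof (rule lin_eq_on_span[OF _ _ assms(7)])
      show "lin (\<lambda>a. h \<star> g \<star> a)" "lin (\<lambda>a. h \<star> (g \<star> a))"
        by (intro lin_bilin_right lin_comp[OF lin_bilin_right lin_bilin_right])+
    qed (use X g h in \<open>auto simp: mult_assoc\<close>)
  qed
qed

lemma prod_unit: "x \<in> X \<Longrightarrow> y \<in> X \<Longrightarrow> a \<in> SG x y \<Longrightarrow> a \<star> unit x = a"
  by (rule lin_eq_on_span[OF lin_bilin_left lin_ident]) (auto simp: mult_one)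

lemma unit_prod: "x \<in> X \<Longrightarrow> y \<in> X \<Longrightarrow> a \<in> SG x y \<Longrightarrow> unit y \<star> a = a"
  by (rule lin_eq_on_span[OF lin_bilin_right lin_ident]) (auto simp: one_mult)

lemma prod_cong:
  assumes X: "x \<in> X" "y \<in> X" "z \<in> X" and "b \<in> SG y z" "b - b' \<in> rels y z" "a' \<in> SG x y" "a - a' \<in> rels x y"
  shows "b \<star> a - b' \<star> a' \<in> rels x z"
proof -
  have "b \<star> (a - a') + (b - b') \<star> a' \<in> rels x z"
    using assms by (intro free_vs.subspace_add[OF subspace_rels] prod_rels_left prod_rels_right)
  then show ?thesis by (simp add: bilin_simps)
qed

lemma rep_SG:
  assumes "x \<in> X" "y \<in> X" "a \<in> SG x y"
  shows "rep (coset (rels x y) a) \<in> SG x y"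
  using free_vs.span_add[OF rels_SG[OF assms(1,2) rep_coset[OF subspace_rels, of _ _ a]] assms(3)] by simp

abbreviation SC where "SC \<equiv> sum_cat X gens rels one mult"

text \<open>The morphism with representatives \<open>A i j\<close>.\<close>

definition matc where
  "matc xs ys A = mat (length ys) (length xs) (\<lambda>i j. coset (rels (xs ! j) (ys ! i)) (A i j))"

lemma matc_eqI:
  assumes "\<And>i j. i < length ys \<Longrightarrow> j < length xs \<Longrightarrow> A i j - B i j \<in> rels (xs ! j) (ys ! i)"
  shows "matc xs ys A = matc xs ys B"
  unfolding matc_def using assms by (intro mat_cong) (simp add: coset_eq_iff subspace_rels)

lemma ob_SC: "ob SC = lists X" by (simp add: sum_cat_def)

lemma idn_SC: "idn SC xs = matc xs xs (\<lambda>i j. if i = j then unit (xs ! i) else 0)"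
  by (simp add: sum_cat_def matc_def)

lemma hom_SC: "hom SC xs ys =
    {matc xs ys A | A. \<forall>i<length ys. \<forall>j<length xs. A i j \<in> Sg (xs ! j) (ys ! i)}"
proof -
  have "\<exists>A. mat (length ys) (length xs) M = matc xs ys A \<and>
      (\<forall>i<length ys. \<forall>j<length xs. A i j \<in> Sg (xs ! j) (ys ! i))"
    if "\<forall>i<length ys. \<forall>j<length xs. M i j \<in> coset (rels (xs ! j) (ys ! i)) ` Sg (xs ! j) (ys ! i)" for M
  proof -
    from that have "\<forall>i j. \<exists>a. i < length ys \<longrightarrow> j < length xs \<longrightarrow>
        M i j = coset (rels (xs ! j) (ys ! i)) a \<and> a \<in> Sg (xs ! j) (ys ! i)" by blast
    then obtain A where "\<forall>i j. i < length ys \<longrightarrow> j < length xs \<longrightarrow>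
        M i j = coset (rels (xs ! j) (ys ! i)) (A i j) \<and> A i j \<in> Sg (xs ! j) (ys ! i)" by metis
    then show ?thesis by (intro exI[of _ A]) (auto simp: matc_def intro!: mat_cong)
  qed
  note 1 = this
  have 2: "\<exists>M. matc xs ys A = mat (length ys) (length xs) M \<and>
      (\<forall>i<length ys. \<forall>j<length xs. M i j \<in> coset (rels (xs ! j) (ys ! i)) ` Sg (xs ! j) (ys ! i))"
    if "\<forall>i<length ys. \<forall>j<length xs. A i j \<in> Sg (xs ! j) (ys ! i)" for A
    unfolding matc_def using that by blast
  show ?thesis
    unfolding sum_cat_def cat.simps
  proof (intro set_eqI iffI)
    fix f assume "f \<in> {mat (length ys) (length xs) M | M. \<forall>i<length ys. \<forall>j<length xs.
        M i j \<in> coset (rels (xs ! j) (ys ! i)) ` Sg (xs ! j) (ys ! i)}"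
    then show "f \<in> {matc xs ys A | A. \<forall>i<length ys. \<forall>j<length xs. A i j \<in> Sg (xs ! j) (ys ! i)}"
      using 1 by blast
  next
    fix f assume "f \<in> {matc xs ys A | A. \<forall>i<length ys. \<forall>j<length xs. A i j \<in> Sg (xs ! j) (ys ! i)}"
    then show "f \<in> {mat (length ys) (length xs) M | M. \<forall>i<length ys. \<forall>j<length xs.
        M i j \<in> coset (rels (xs ! j) (ys ! i)) ` Sg (xs ! j) (ys ! i)}"
      using 2 by blast
  qed
qed

lemma homI: "(\<And>i j. i < length ys \<Longrightarrow> j < length xs \<Longrightarrow> A i j \<in> Sg (xs ! j) (ys ! i)) \<Longrightarrow>
    matc xs ys A \<in> hom SC xs ys"
  unfolding hom_SC by blast

lemma cmp_SC:
  assumes X: "xs \<in> lists X" "ys \<in> lists X" "zs \<in> lists X"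
    and B: "\<And>i j. i < length zs \<Longrightarrow> j < length ys \<Longrightarrow> B i j \<in> SG (ys ! j) (zs ! i)"
    and A: "\<And>i j. i < length ys \<Longrightarrow> j < length xs \<Longrightarrow> A i j \<in> SG (xs ! j) (ys ! i)"
  shows "cmp SC xs ys zs (matc ys zs B) (matc xs ys A)
    = matc xs zs (\<lambda>i k. \<Sum>j<length ys. B i j \<star> A j k)"
proof -
  have "cmp SC xs ys zs (matc ys zs B) (matc xs ys A)
    = matc xs zs (\<lambda>i k. \<Sum>j<length ys. rep (matc ys zs B i j) \<star> rep (matc xs ys A j k))"
    by (simp add: sum_cat_def matc_def)
  also have "\<dots> = matc xs zs (\<lambda>i k. \<Sum>j<length ys. B i j \<star> A j k)"
  proof (rule matc_eqI)
    fix i k assume ik: "i < length zs" "k < length xs"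
    have "rep (matc ys zs B i j) \<star> rep (matc xs ys A j k) - B i j \<star> A j k \<in> rels (xs ! k) (zs ! i)"
      if j: "j < length ys" for j
    proof -
      have in_X: "xs ! k \<in> X" "ys ! j \<in> X" "zs ! i \<in> X" using X ik j by auto
      have b: "rep (matc ys zs B i j) - B i j \<in> rels (ys ! j) (zs ! i)"
        and a: "rep (matc xs ys A j k) - A j k \<in> rels (xs ! k) (ys ! j)"
        using ik j by (simp_all add: matc_def rep_coset subspace_rels)
      have "rep (matc ys zs B i j) \<in> SG (ys ! j) (zs ! i)"
        using free_vs.span_add[OF rels_SG[OF _ _ b] B[OF ik(1) j]] in_X by simp
      then show ?thesis using in_X a b A[OF j ik(2)] by (intro prod_cong) auto
    qed
    then have "(\<Sum>j<length ys. rep (matc ys zs B i j) \<star> rep (matc xs ys A j k) - B i j \<star> A j k)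
        \<in> rels (xs ! k) (zs ! i)"
      by (intro free_vs.subspace_sum subspace_rels) simp
    then show "(\<Sum>j<length ys. rep (matc ys zs B i j) \<star> rep (matc xs ys A j k))
        - (\<Sum>j<length ys. B i j \<star> A j k) \<in> rels (xs ! k) (zs ! i)"
      by (simp add: sum_subtractf)
  qed
  finally show ?thesis .
qed

lemma nth_X: "xs \<in> lists X \<Longrightarrow> i < length xs \<Longrightarrow> xs ! i \<in> X"
  by auto

theorem category_SC: "category SC"
  unfolding category_def ob_SC
proof (intro conjI ballI)
  fix xs assume xs: "xs \<in> lists X"
  show "idn SC xs \<in> hom SC xs xs"
    unfolding idn_SC hom_SC using xs by (fastforce simp: unit_Sg free_vs.span_zero)
next
  fix xs ys zs f g
  assume X: "xs \<in> lists X" "ys \<in> lists X" "zs \<in> lists X" and "f \<in> hom SC xs ys" "g \<in> hom SC ys zs"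
  then obtain A B where f: "f = matc xs ys A" and g: "g = matc ys zs B"
    and A: "\<And>i j. i < length ys \<Longrightarrow> j < length xs \<Longrightarrow> A i j \<in> Sg (xs ! j) (ys ! i)"
    and B: "\<And>i j. i < length zs \<Longrightarrow> j < length ys \<Longrightarrow> B i j \<in> Sg (ys ! j) (zs ! i)"
    unfolding hom_SC by blast
  have "cmp SC xs ys zs g f = matc xs zs (\<lambda>i k. \<Sum>j<length ys. B i j \<star> A j k)"
    unfolding f g using X A B by (intro cmp_SC Sg_SG nth_X) auto
  moreover have "(\<Sum>j<length ys. B i j \<star> A j k) \<in> Sg (xs ! k) (zs ! i)"
    if "i < length zs" "k < length xs" for i k
    using X A B that by (intro free_vs.span_sum prod_Sg) auto
  ultimately show "cmp SC xs ys zs g f \<in> hom SC xs zs" unfolding hom_SC by blast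
next
  fix xs ys f
  assume X: "xs \<in> lists X" "ys \<in> lists X" and "f \<in> hom SC xs ys"
  then obtain A where f: "f = matc xs ys A"
    and A: "\<And>i j. i < length ys \<Longrightarrow> j < length xs \<Longrightarrow> A i j \<in> SG (xs ! j) (ys ! i)"
    unfolding hom_SC using Sg_SG nth_X by fastforce
  have u: "(if i = j then unit (zs ! i) else 0) \<in> SG (zs ! j) (zs ! i)"
    if "zs \<in> lists X" "i < length zs" "j < length zs" for zs i j
    using that Sg_SG[OF _ _ unit_Sg, of "zs ! j"] by (auto simp: free_vs.span_zero)
  have "cmp SC xs xs ys f (idn SC xs)
      = matc xs ys (\<lambda>i k. \<Sum>j<length xs. A i j \<star> (if j = k then unit (xs ! j) else 0))"
    unfolding f idn_SC using X A u by (intro cmp_SC) auto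
  also have "\<dots> = matc xs ys A"
  proof (rule matc_eqI)
    fix i k assume *: "i < length ys" "k < length xs"
    have "(\<Sum>j<length xs. A i j \<star> (if j = k then unit (xs ! j) else 0)) = A i k \<star> unit (xs ! k)"
      by (subst sum_single[OF *(2)]) (auto simp: bilin_simps)
    also have "\<dots> = A i k" using X * A by (intro prod_unit) auto
    finally show "(\<Sum>j<length xs. A i j \<star> (if j = k then unit (xs ! j) else 0)) - A i k
        \<in> rels (xs ! k) (ys ! i)"
      by (simp add: free_vs.subspace_0 subspace_rels)
  qed
  finally show "cmp SC xs xs ys f (idn SC xs) = f" by (simp add: f)
  have "cmp SC xs ys ys (idn SC ys) f
      = matc xs ys (\<lambda>i k. \<Sum>j<length ys. (if i = j then unit (ys ! i) else 0) \<star> A j k)"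
    unfolding f idn_SC using X A u by (intro cmp_SC) auto
  also have "\<dots> = matc xs ys A"
  proof (rule matc_eqI)
    fix i k assume *: "i < length ys" "k < length xs"
    have "(\<Sum>j<length ys. (if i = j then unit (ys ! i) else 0) \<star> A j k) = unit (ys ! i) \<star> A i k"
      by (subst sum_single[OF *(1)]) (auto simp: bilin_simps)
    also have "\<dots> = A i k" using X * A by (intro unit_prod) auto
    finally show "(\<Sum>j<length ys. (if i = j then unit (ys ! i) else 0) \<star> A j k) - A i k
        \<in> rels (xs ! k) (ys ! i)"
      by (simp add: free_vs.subspace_0 subspace_rels)
  qed
  finally show "cmp SC xs ys ys (idn SC ys) f = f" by (simp add: f)
next
  fix ws xs ys zs f g h
  assume X: "ws \<in> lists X" "xs \<in> lists X" "ys \<in> lists X" "zs \<in> lists X"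
    and "f \<in> hom SC ws xs" "g \<in> hom SC xs ys" "h \<in> hom SC ys zs"
  then obtain A B D where fgh: "f = matc ws xs A" "g = matc xs ys B" "h = matc ys zs D"
    and A: "\<And>i j. i < length xs \<Longrightarrow> j < length ws \<Longrightarrow> A i j \<in> Sg (ws ! j) (xs ! i)"
    and B: "\<And>i j. i < length ys \<Longrightarrow> j < length xs \<Longrightarrow> B i j \<in> Sg (xs ! j) (ys ! i)"
    and D: "\<And>i j. i < length zs \<Longrightarrow> j < length ys \<Longrightarrow> D i j \<in> Sg (ys ! j) (zs ! i)"
    unfolding hom_SC by blast
  note in_SG = Sg_SG[OF _ _ A] Sg_SG[OF _ _ B] Sg_SG[OF _ _ D]
  have "cmp SC ws xs zs (cmp SC xs ys zs h g) f
      = cmp SC ws xs zs (matc xs zs (\<lambda>i k. \<Sum>j<length ys. D i j \<star> B j k)) f"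
    unfolding fgh by (subst cmp_SC) (use X in \<open>auto intro: in_SG\<close>)
  also have "\<dots> = matc ws zs (\<lambda>i l. \<Sum>k<length xs. (\<Sum>j<length ys. D i j \<star> B j k) \<star> A k l)"
    unfolding fgh using X
    by (intro cmp_SC free_vs.span_sum) (auto intro!: prod_SG[OF _ _ _ in_SG(3,2)] in_SG)
  also have "\<dots> = matc ws zs (\<lambda>i l. \<Sum>j<length ys. D i j \<star> (\<Sum>k<length xs. B j k \<star> A k l))"
  proof -
    have "(\<Sum>k<length xs. (\<Sum>j<length ys. D i j \<star> B j k) \<star> A k l)
        = (\<Sum>j<length ys. D i j \<star> (\<Sum>k<length xs. B j k \<star> A k l))"
      if "i < length zs" "l < length ws" for i l
    proof -
      have "(\<Sum>k<length xs. (\<Sum>j<length ys. D i j \<star> B j k) \<star> A k l)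
          = (\<Sum>k<length xs. \<Sum>j<length ys. D i j \<star> (B j k \<star> A k l))"
        using X that
        by (intro sum.cong refl, subst bilin_sum, intro sum.cong refl prod_assoc)
          (auto intro!: in_SG)
      also have "\<dots> = (\<Sum>j<length ys. \<Sum>k<length xs. D i j \<star> (B j k \<star> A k l))"
        by (rule sum.swap)
      finally show ?thesis by (simp add: bilin_sum)
    qed
    then show ?thesis by (intro matc_eqI) (simp add: free_vs.subspace_0 subspace_rels)
  qed
  also have "\<dots> = cmp SC ws ys zs h (matc ws ys (\<lambda>j l. \<Sum>k<length xs. B j k \<star> A k l))"
    unfolding fgh using X
    by (intro cmp_SC[symmetric] free_vs.span_sum) (auto intro!: prod_SG[OF _ _ _ in_SG(2,1)] in_SG)
  also have "matc ws ys (\<lambda>j l. \<Sum>k<length xs. B j k \<star> A k l) = cmp SC ws xs ys g f"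
    unfolding fgh by (subst cmp_SC) (use X in \<open>auto intro: in_SG\<close>)
  finally show "cmp SC ws xs zs (cmp SC xs ys zs h g) f = cmp SC ws ys zs h (cmp SC ws xs ys g f)" .
qed

text \<open>\<open>x\<close> is the direct sum of the objects \<open>y i\<close> (\<open>i \<in> I\<close>), with projections \<open>P i\<close> and inclusions
  \<open>Q i\<close>.\<close>

definition is_sum_of where
  "is_sum_of x I y P Q \<longleftrightarrow> finite I \<and> x \<in> X \<and>
     (\<forall>i\<in>I. y i \<in> X \<and> P i \<in> Sg x (y i) \<and> Q i \<in> Sg (y i) x) \<and>
     (\<forall>i\<in>I. \<forall>j\<in>I. P i \<star> Q j - (if i = j then unit (y i) else 0) \<in> rels (y j) (y i)) \<and>
     (\<Sum>i\<in>I. Q i \<star> P i) - unit x \<in> rels x x"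

lemma is_sum_of_orthogonal:
  "is_sum_of x I y P Q \<Longrightarrow> i \<in> I \<Longrightarrow> j \<in> I \<Longrightarrow>
    P i \<star> Q j - (if i = j then unit (y i) else 0) \<in> rels (y j) (y i)"
  unfolding is_sum_of_def by blast

text \<open>\<open>x\<close> is isomorphic to a finite direct sum of objects in \<open>B\<close>.\<close>

definition splits where
  "splits B x \<longleftrightarrow> (\<exists>(n::nat) y P Q. is_sum_of x {..<n} y P Q \<and> y ` {..<n} \<subseteq> B)"

lemma splitsI:
  assumes "is_sum_of x I y P Q" "y ` I \<subseteq> B"
  shows "splits B x"
proof -
  have "finite I" using assms by (simp add: is_sum_of_def)
  then obtain e where e: "bij_betw e {..<card I} I"
    using ex_bij_betw_nat_finite[of I] by (auto simp: atLeast0LessThan)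
  then have eI: "e i \<in> I" "e i = e j \<longleftrightarrow> i = j" if "i < card I" "j < card I" for i j
    using that by (auto simp: bij_betw_def inj_on_def)
  have "(\<Sum>i<card I. Q (e i) \<star> P (e i)) = (\<Sum>i\<in>I. Q i \<star> P i)"
    by (rule sum.reindex_bij_betw[OF e])
  moreover have PQ: "P (e i) \<star> Q (e j) - (if i = j then unit (y (e i)) else 0) \<in> rels (y (e j)) (y (e i))"
    if ij: "i < card I" "j < card I" for i j
  proof -
    have "P (e i) \<star> Q (e j) - (if e i = e j then unit (y (e i)) else 0) \<in> rels (y (e j)) (y (e i))"
      using assms(1) eI(1)[OF ij] eI(1)[OF ij(2,1)] unfolding is_sum_of_def by blast
    then show ?thesis by (simp only: eI(2)[OF ij])
  qed
  ultimately have "is_sum_of x {..<card I} (y \<circ> e) (P \<circ> e) (Q \<circ> e)"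
    using assms(1) eI(1) unfolding is_sum_of_def comp_def by (intro conjI ballI PQ) auto
  moreover have "(y \<circ> e) ` {..<card I} \<subseteq> B" using assms(2) eI by auto
  ultimately show ?thesis unfolding splits_def by blast
qed

lemma splits_base: 
  assumes "x \<in> X" "x \<in> B"
  shows "splits B x"
proof (rule splitsI)
  show "is_sum_of x {()} (\<lambda>_. x) (\<lambda>_. unit x) (\<lambda>_. unit x)"
    using assms by (auto simp: is_sum_of_def unit_Sg one_mult one_gens subsetD[OF gens_G]
        free_vs.subspace_0 subspace_rels)
qed (use assms in auto)

lemma is_sum_of_trans:
  assumes x: "is_sum_of x I y P Q" and y: "\<And>i. i \<in> I \<Longrightarrow> is_sum_of (y i) (J i) (z i) (P' i) (Q' i)"
  shows "is_sum_of x (Sigma I J) (\<lambda>(i, k). z i k) (\<lambda>(i, k). P' i k \<star> P i) (\<lambda>(i, k). Q i \<star> Q' i k)"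
proof -
  have y': "finite (J i) \<and> y i \<in> X \<and>
     (\<forall>k\<in>J i. z i k \<in> X \<and> P' i k \<in> Sg (y i) (z i k) \<and> Q' i k \<in> Sg (z i k) (y i)) \<and>
     (\<forall>k\<in>J i. \<forall>l\<in>J i. P' i k \<star> Q' i l - (if k = l then unit (z i k) else 0) \<in> rels (z i l) (z i k)) \<and>
     (\<Sum>k\<in>J i. Q' i k \<star> P' i k) - unit (y i) \<in> rels (y i) (y i)" if "i \<in> I" for i
    using y[OF that] unfolding is_sum_of_def .
  have xX: "x \<in> X" and yX: "\<And>i. i \<in> I \<Longrightarrow> y i \<in> X"
    and I: "finite I"
    and P: "\<And>i. i \<in> I \<Longrightarrow> P i \<in> Sg x (y i)" and Q: "\<And>i. i \<in> I \<Longrightarrow> Q i \<in> Sg (y i) x"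
    and PQ: "\<And>i j. i \<in> I \<Longrightarrow> j \<in> I \<Longrightarrow> P i \<star> Q j - (if i = j then unit (y i) else 0) \<in> rels (y j) (y i)"
    and QP: "(\<Sum>i\<in>I. Q i \<star> P i) - unit x \<in> rels x x"
    using x[unfolded is_sum_of_def] by blast+
  have zX: "\<And>i k. i \<in> I \<Longrightarrow> k \<in> J i \<Longrightarrow> z i k \<in> X"
    and J: "\<And>i. i \<in> I \<Longrightarrow> finite (J i)"
    and P': "\<And>i k. i \<in> I \<Longrightarrow> k \<in> J i \<Longrightarrow> P' i k \<in> Sg (y i) (z i k)"
    and Q': "\<And>i k. i \<in> I \<Longrightarrow> k \<in> J i \<Longrightarrow> Q' i k \<in> Sg (z i k) (y i)"
    and PQ': "\<And>i k l. i \<in> I \<Longrightarrow> k \<in> J i \<Longrightarrow> l \<in> J i \<Longrightarrow>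
      P' i k \<star> Q' i l - (if k = l then unit (z i k) else 0) \<in> rels (z i l) (z i k)"
    and QP': "\<And>i. i \<in> I \<Longrightarrow> (\<Sum>k\<in>J i. Q' i k \<star> P' i k) - unit (y i) \<in> rels (y i) (y i)"
    using y' by blast+
  note SG = Sg_SG[OF xX yX P] Sg_SG[OF yX xX Q] Sg_SG[OF yX zX P'] Sg_SG[OF zX yX Q']
  show ?thesis
    unfolding is_sum_of_def
  proof (intro conjI ballI)
    show "finite (Sigma I J)" using I J by simp
    show "x \<in> X" by fact
  next
    fix t assume t: "t \<in> Sigma I J"
    then obtain i k where [simp]: "t = (i, k)" and ik: "i \<in> I" "k \<in> J i" by auto
    show "(case t of (i, k) \<Rightarrow> z i k) \<in> X" using zX ik by simp
    show "(case t of (i, k) \<Rightarrow> P' i k \<star> P i) \<in> Sg x (case t of (i, k) \<Rightarrow> z i k)"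
      using prod_Sg[OF xX yX zX P' P] ik by simp
    show "(case t of (i, k) \<Rightarrow> Q i \<star> Q' i k) \<in> Sg (case t of (i, k) \<Rightarrow> z i k) x"
      using prod_Sg[OF zX yX xX Q Q'] ik by simp
  next
    fix s t assume "s \<in> Sigma I J" "t \<in> Sigma I J"
    then obtain i k j l where st: "s = (i, k)" "t = (j, l)"
      and ik: "i \<in> I" "k \<in> J i" and jl: "j \<in> I" "l \<in> J j" by auto
    have "P' i k \<star> P i \<star> (Q j \<star> Q' j l) = P' i k \<star> (P i \<star> (Q j \<star> Q' j l))"
      using ik jl SG by (intro prod_assoc[of "z j l" x "y i" "z i k"] prod_SG[of _ "y j"] zX yX xX) auto
    also have "P i \<star> (Q j \<star> Q' j l) = P i \<star> Q j \<star> Q' j l"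
      using ik jl SG by (intro prod_assoc[symmetric, of "z j l" "y j" x "y i"] zX yX xX) auto
    finally have *: "P' i k \<star> P i \<star> (Q j \<star> Q' j l) = P' i k \<star> (P i \<star> Q j \<star> Q' j l)" .
    have step: "P' i k \<star> (P i \<star> Q j \<star> Q' j l)
        - P' i k \<star> ((if i = j then unit (y i) else 0) \<star> Q' j l) \<in> rels (z j l) (z i k)"
    proof -
      have "P' i k \<star> ((P i \<star> Q j - (if i = j then unit (y i) else 0)) \<star> Q' j l) \<in> rels (z j l) (z i k)"
        by (rule prod_rels_left[of _ "y i"], (use ik jl SG yX zX in auto)[4],
            rule prod_rels_right[of _ "y j"], use ik jl SG yX zX PQ in auto)
      then show ?thesis by (simp add: bilin_simps)
    qed
    have "P' i k \<star> ((if i = j then unit (y i) else 0) \<star> Q' j l) - (if s = t then unit (z i k) else 0)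
        \<in> rels (z j l) (z i k)"
    proof (cases "i = j")
      case True
      then have "P' i k \<star> ((if i = j then unit (y i) else 0) \<star> Q' j l) = P' i k \<star> Q' i l"
        using unit_prod[OF zX yX SG(4)] jl by simp
      then show ?thesis using PQ'[of i k l] True ik jl st by auto
    next
      case False
      then show ?thesis using st by (simp add: bilin_simps free_vs.subspace_0 subspace_rels)
    qed
    from free_vs.subspace_add[OF subspace_rels step this]
    have "P' i k \<star> P i \<star> (Q j \<star> Q' j l) - (if s = t then unit (z i k) else 0) \<in> rels (z j l) (z i k)"
      by (simp add: *)
    then show "(case s of (i, k) \<Rightarrow> P' i k \<star> P i) \<star> (case t of (i, k) \<Rightarrow> Q i \<star> Q' i k)
        - (if s = t then unit (case s of (i, k) \<Rightarrow> z i k) else 0)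
        \<in> rels (case t of (i, k) \<Rightarrow> z i k) (case s of (i, k) \<Rightarrow> z i k)"
      unfolding st prod.case .
  next
    have "(\<Sum>t\<in>Sigma I J. (case t of (i, k) \<Rightarrow> Q i \<star> Q' i k) \<star> (case t of (i, k) \<Rightarrow> P' i k \<star> P i))
        = (\<Sum>i\<in>I. \<Sum>k\<in>J i. Q i \<star> Q' i k \<star> (P' i k \<star> P i))"
      using I J by (simp add: sum.Sigma split_def)
    also have "\<dots> = (\<Sum>i\<in>I. \<Sum>k\<in>J i. Q i \<star> (Q' i k \<star> P' i k \<star> P i))"
    proof (intro sum.cong refl)
      fix i k assume ik: "i \<in> I" "k \<in> J i"
      have "Q i \<star> Q' i k \<star> (P' i k \<star> P i) = Q i \<star> (Q' i k \<star> (P' i k \<star> P i))"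
        using ik SG by (intro prod_assoc[of x "z i k" "y i" x] prod_SG[of _ "y i"] zX yX xX) auto
      also have "Q' i k \<star> (P' i k \<star> P i) = Q' i k \<star> P' i k \<star> P i"
        using ik SG by (intro prod_assoc[symmetric, of x "y i" "z i k" "y i"] zX yX xX) auto
      finally show "Q i \<star> Q' i k \<star> (P' i k \<star> P i) = Q i \<star> (Q' i k \<star> P' i k \<star> P i)" .
    qed
    also have "\<dots> = (\<Sum>i\<in>I. Q i \<star> ((\<Sum>k\<in>J i. Q' i k \<star> P' i k) \<star> P i))"
      by (simp add: bilin_sum)
    finally have 1: "(\<Sum>t\<in>Sigma I J. (case t of (i, k) \<Rightarrow> Q i \<star> Q' i k) \<star> (case t of (i, k) \<Rightarrow> P' i k \<star> P i))
        = \<dots>" .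
    have "(\<Sum>i\<in>I. Q i \<star> ((\<Sum>k\<in>J i. Q' i k \<star> P' i k) \<star> P i) - Q i \<star> P i) \<in> rels x x"
    proof (intro free_vs.subspace_sum subspace_rels)
      fix i assume i: "i \<in> I"
      have "Q i \<star> (((\<Sum>k\<in>J i. Q' i k \<star> P' i k) - unit (y i)) \<star> P i) \<in> rels x x"
        using i SG QP' yX xX by (intro prod_rels_left[of x "y i" x] prod_rels_right[of x "y i" "y i"]) auto
      then show "Q i \<star> ((\<Sum>k\<in>J i. Q' i k \<star> P' i k) \<star> P i) - Q i \<star> P i \<in> rels x x"
        using unit_prod[OF xX yX SG(1)] i by (simp add: bilin_simps)
    qed
    from free_vs.subspace_add[OF subspace_rels this QP]
    show "(\<Sum>t\<in>Sigma I J. (case t of (i, k) \<Rightarrow> Q i \<star> Q' i k) \<star> (case t of (i, k) \<Rightarrow> P' i k \<star> P i))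
        - unit x \<in> rels x x"
      unfolding 1 by (simp add: sum_subtractf)
  qed
qed

lemma splits_trans:
  assumes x: "is_sum_of x I y P Q" and y: "\<And>i. i \<in> I \<Longrightarrow> splits B (y i)"
  shows "splits B x"
proof -
  have "\<forall>i. \<exists>n z P' Q'. i \<in> I \<longrightarrow> is_sum_of (y i) {..<n::nat} z P' Q' \<and> z ` {..<n} \<subseteq> B"
    using y unfolding splits_def by blast
  then obtain n z P' Q' where
    *: "\<And>i. i \<in> I \<Longrightarrow> is_sum_of (y i) {..<n i::nat} (z i) (P' i) (Q' i)"
    and zB: "\<And>i. i \<in> I \<Longrightarrow> z i ` {..<n i} \<subseteq> B" by metis
  show ?thesis
    by (rule splitsI[OF is_sum_of_trans[OF x *]]) (use zB in auto)
qed

text \<open>A list all of whose members split is isomorphic to the list of all the summands.\<close>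

theorem iso_if_splits:
  assumes xs: "xs \<in> lists X" and split: "\<And>x. x \<in> set xs \<Longrightarrow> splits B x"
  shows "\<exists>ys\<in>lists (B \<inter> X). \<exists>f. is_iso SC ys xs f"
proof -
  let ?n = "length xs"
  have "\<forall>i. \<exists>r y P Q. i < ?n \<longrightarrow> is_sum_of (xs ! i) {..<r::nat} y P Q \<and> y ` {..<r} \<subseteq> B"
    using split unfolding splits_def by (meson nth_mem)
  then obtain r y P Q where
    sum: "\<And>i. i < ?n \<Longrightarrow> is_sum_of (xs ! i) {..<r i::nat} (y i) (P i) (Q i)"
    and yB: "\<And>i. i < ?n \<Longrightarrow> y i ` {..<r i} \<subseteq> B" by metis
  let ?I = "Sigma {..<?n} (\<lambda>i. {..<r i})"
  let ?N = "card ?I"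
  have fin: "finite ?I" by simp
  obtain e where e: "bij_betw e {..<?N} ?I"
    using ex_bij_betw_nat_finite[OF fin] by (auto simp: atLeast0LessThan)
  define e1 e2 where "e1 t = fst (e t)" and "e2 t = snd (e t)" for t
  have eI: "e1 t < ?n" "e2 t < r (e1 t)" if "t < ?N" for t
  proof -
    have "e t \<in> ?I" using e that by (auto simp: bij_betw_def)
    then show "e1 t < ?n" "e2 t < r (e1 t)" by (auto simp: e1_def e2_def)
  qed
  have e_inj: "s = t" if "s < ?N" "t < ?N" "e1 s = e1 t" "e2 s = e2 t" for s t
    using e that by (auto simp: bij_betw_def inj_on_def e1_def e2_def prod_eq_iff)
  define ys where "ys = map (\<lambda>t. y (e1 t) (e2 t)) [0..<?N]"
  have len: "length ys = ?N" by (simp add: ys_def)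
  have ys_nth: "ys ! t = y (e1 t) (e2 t)" if "t < ?N" for t using that by (simp add: ys_def)
  have y: "y (e1 t) (e2 t) \<in> X" "P (e1 t) (e2 t) \<in> Sg (xs ! e1 t) (y (e1 t) (e2 t))"
    "Q (e1 t) (e2 t) \<in> Sg (y (e1 t) (e2 t)) (xs ! e1 t)" if "t < ?N" for t
    using sum[OF eI(1)[OF that]] eI[OF that] by (auto simp: is_sum_of_def)
  have ysX: "ys \<in> lists (B \<inter> X)"
    using y(1) eI yB by (fastforce simp: ys_def)
  then have ysX': "ys \<in> lists X" by auto
  define A where "A t j = (if e1 t = j then P (e1 t) (e2 t) else 0)" for t j
  define A' where "A' j t = (if e1 t = j then Q (e1 t) (e2 t) else 0)" for t j
  have A: "A t j \<in> Sg (xs ! j) (ys ! t)" and A': "A' j t \<in> Sg (ys ! t) (xs ! j)" if "t < ?N" for t j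
    using y[OF that] that by (auto simp: A_def A'_def ys_nth free_vs.span_zero)
  note SG = Sg_SG[OF _ _ A] Sg_SG[OF _ _ A']
  have "cmp SC xs ys xs (matc ys xs A') (matc xs ys A)
      = matc xs xs (\<lambda>i k. \<Sum>t<?N. A' i t \<star> A t k)"
    unfolding len[symmetric] using xs ysX' by (intro cmp_SC SG) (auto simp: len)
  also have "\<dots> = matc xs xs (\<lambda>i j. if i = j then unit (xs ! i) else 0)"
  proof (rule matc_eqI)
    fix i k assume ik: "i < ?n" "k < ?n"
    have "(\<Sum>t<?N. A' i t \<star> A t k)
        = (\<Sum>t<?N. (\<lambda>(j, l). if j = i \<and> j = k then Q j l \<star> P j l else 0) (e t))"
      by (intro sum.cong refl) (auto simp: A_def A'_def e1_def e2_def bilin_simps split_def)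
    also have "\<dots> = (\<Sum>(j, l)\<in>?I. if j = i \<and> j = k then Q j l \<star> P j l else 0)"
      by (rule sum.reindex_bij_betw[OF e])
    also have "\<dots> = (\<Sum>j<?n. \<Sum>l<r j. if j = i \<and> j = k then Q j l \<star> P j l else 0)"
      by (simp add: sum.Sigma)
    also have "\<dots> = (\<Sum>l<r i. if i = k then Q i l \<star> P i l else 0)"
      by (subst sum_single[OF ik(1)]) auto
    finally show "(\<Sum>t<?N. A' i t \<star> A t k) - (if i = k then unit (xs ! i) else 0)
        \<in> rels (xs ! k) (xs ! i)"
      using sum[OF ik(1)] by (auto simp: is_sum_of_def free_vs.subspace_0 subspace_rels)
  qed
  finally have 1: "cmp SC xs ys xs (matc ys xs A') (matc xs ys A) = idn SC xs" by (simp add: idn_SC)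
  have "cmp SC ys xs ys (matc xs ys A) (matc ys xs A')
      = matc ys ys (\<lambda>s t. \<Sum>i<?n. A s i \<star> A' i t)"
    using xs ysX' by (intro cmp_SC SG) (auto simp: len)
  also have "\<dots> = matc ys ys (\<lambda>i j. if i = j then unit (ys ! i) else 0)"
  proof (rule matc_eqI)
    fix s t assume st: "s < length ys" "t < length ys"
    note st' = st[unfolded len]
    have "(\<Sum>i<?n. A s i \<star> A' i t) = A s (e1 s) \<star> A' (e1 s) t"
      by (rule sum_single[OF eI(1)[OF st'(1)]]) (auto simp: A_def bilin_simps)
    also have "\<dots> = (if e1 s = e1 t then P (e1 s) (e2 s) \<star> Q (e1 s) (e2 t) else 0)"
      by (auto simp: A_def A'_def bilin_simps)
    also have "\<dots> - (if s = t then unit (ys ! s) else 0) \<in> rels (ys ! t) (ys ! s)"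
    proof (cases "e1 s = e1 t")
      case True
      then have "P (e1 s) (e2 s) \<star> Q (e1 s) (e2 t)
          - (if e2 s = e2 t then unit (y (e1 s) (e2 s)) else 0)
          \<in> rels (y (e1 s) (e2 t)) (y (e1 s) (e2 s))"
        using eI[OF st'(1)] eI[OF st'(2)] by (intro is_sum_of_orthogonal[OF sum]) auto
      then show ?thesis using True e_inj[OF st'] st' by (auto simp: ys_nth split: if_splits)
    qed (auto simp: free_vs.subspace_0 subspace_rels)
    finally show "(\<Sum>i<?n. A s i \<star> A' i t) - (if s = t then unit (ys ! s) else 0)
        \<in> rels (ys ! t) (ys ! s)" .
  qed
  finally have 2: "cmp SC ys xs ys (matc xs ys A) (matc ys xs A') = idn SC ys" by (simp add: idn_SC)
  have "matc xs ys A \<in> hom SC xs ys" "matc ys xs A' \<in> hom SC ys xs"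
    using A A' len by (auto intro!: homI)
  with 1 2 ysX show ?thesis unfolding is_iso_def by blast
qed

end

section \<open>Horizontal and vertical traces of a strict linear 2-category\<close>

text \<open>\<open>\<sigma>\<close> is a 2-morphism \<open>p \<rightarrow> q\<close> between 1-morphisms \<open>c \<rightarrow> d\<close>.\<close>

definition arr :: "('o, 'f, 's) graded_2cat \<Rightarrow> 'o \<Rightarrow> 'o \<Rightarrow> 'f \<Rightarrow> 'f \<Rightarrow> 's \<Rightarrow> bool" where
  "arr C c d p q \<sigma> \<longleftrightarrow> p \<in> cells1 C c d \<and> q \<in> cells1 C c d \<and> \<sigma> \<in> cells2 C p q"

text \<open>The linear combination \<open>a \<sigma> + b \<sigma>'\<close>.\<close>

definition lc :: "('o, 'f, 's) graded_2cat \<Rightarrow> complex \<Rightarrow> 's \<Rightarrow> complex \<Rightarrow> 's \<Rightarrow> 's" where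
  "lc C a \<sigma> b \<sigma>' = add2 C (scale2 C a \<sigma>) (scale2 C b \<sigma>')"

text \<open>The laws of a strict graded linear 2-category that make its traces categories. Linearity is
  stated in terms of the combinations \<open>lc\<close>, the only ones that occur in the relations of the traces.
  For simplicity the composition of 1-morphisms is taken to be associative also where the sources and
  targets do not match.\<close>

locale linear_2cat =
  fixes C :: "('o, 'f, 's) graded_2cat"
  assumes id1_cell: "c \<in> obj C \<Longrightarrow> id1 C c \<in> cells1 C c c"
    and cells1_obj: "p \<in> cells1 C c d \<Longrightarrow> c \<in> obj C \<and> d \<in> obj C"
    and comp1_cell: "r \<in> cells1 C d e \<Longrightarrow> p \<in> cells1 C c d \<Longrightarrow> comp1 C r p \<in> cells1 C c e"
    and comp1_assoc: "comp1 C (comp1 C s r) p = comp1 C s (comp1 C r p)"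
    and id1_comp1: "p \<in> cells1 C c d \<Longrightarrow> comp1 C (id1 C d) p = p"
    and comp1_id1: "p \<in> cells1 C c d \<Longrightarrow> comp1 C p (id1 C c) = p"
    and id2_arr: "p \<in> cells1 C c d \<Longrightarrow> arr C c d p p (id2 C p)"
    and vcomp_arr: "arr C c d q r \<sigma> \<Longrightarrow> arr C c d p q \<tau> \<Longrightarrow> arr C c d p r (vcomp C \<sigma> \<tau>)"
    and hcomp_arr: "arr C d e r s \<rho> \<Longrightarrow> arr C c d p q \<tau> \<Longrightarrow>
      arr C c e (comp1 C r p) (comp1 C s q) (hcomp C \<rho> \<tau>)"
    and lc_arr: "arr C c d p q \<sigma> \<Longrightarrow> arr C c d p q \<tau> \<Longrightarrow> arr C c d p q (lc C x \<sigma> y \<tau>)"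
    and vcomp_assoc: "arr C c d r s \<omega> \<Longrightarrow> arr C c d q r \<sigma> \<Longrightarrow> arr C c d p q \<tau> \<Longrightarrow>
      vcomp C (vcomp C \<omega> \<sigma>) \<tau> = vcomp C \<omega> (vcomp C \<sigma> \<tau>)"
    and id2_vcomp: "arr C c d p q \<sigma> \<Longrightarrow> vcomp C (id2 C q) \<sigma> = \<sigma>"
    and vcomp_id2: "arr C c d p q \<sigma> \<Longrightarrow> vcomp C \<sigma> (id2 C p) = \<sigma>"
    and hcomp_assoc: "arr C e b s t \<omega> \<Longrightarrow> arr C d e r u \<sigma> \<Longrightarrow> arr C c d p q \<tau> \<Longrightarrow>
      hcomp C (hcomp C \<omega> \<sigma>) \<tau> = hcomp C \<omega> (hcomp C \<sigma> \<tau>)"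
    and id1_hcomp: "arr C c d p q \<sigma> \<Longrightarrow> hcomp C (id2 C (id1 C d)) \<sigma> = \<sigma>"
    and hcomp_id1: "arr C c d p q \<sigma> \<Longrightarrow> hcomp C \<sigma> (id2 C (id1 C c)) = \<sigma>"
    and interchange: "arr C d e s t \<rho>' \<Longrightarrow> arr C d e r s \<rho> \<Longrightarrow> arr C c d q u \<tau>' \<Longrightarrow> arr C c d p q \<tau> \<Longrightarrow>
      hcomp C (vcomp C \<rho>' \<rho>) (vcomp C \<tau>' \<tau>) = vcomp C (hcomp C \<rho>' \<tau>') (hcomp C \<rho> \<tau>)"
    and hcomp_id2: "r \<in> cells1 C d e \<Longrightarrow> p \<in> cells1 C c d \<Longrightarrow>
      hcomp C (id2 C r) (id2 C p) = id2 C (comp1 C r p)"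
    and vcomp_lc_left: "arr C c d q r \<sigma> \<Longrightarrow> arr C c d q r \<sigma>' \<Longrightarrow> arr C c d p q \<tau> \<Longrightarrow>
      vcomp C (lc C x \<sigma> y \<sigma>') \<tau> = lc C x (vcomp C \<sigma> \<tau>) y (vcomp C \<sigma>' \<tau>)"
    and vcomp_lc_right: "arr C c d q r \<tau> \<Longrightarrow> arr C c d p q \<sigma> \<Longrightarrow> arr C c d p q \<sigma>' \<Longrightarrow>
      vcomp C \<tau> (lc C x \<sigma> y \<sigma>') = lc C x (vcomp C \<tau> \<sigma>) y (vcomp C \<tau> \<sigma>')"
    and hcomp_lc_left: "arr C d e r s \<sigma> \<Longrightarrow> arr C d e r s \<sigma>' \<Longrightarrow> arr C c d p q \<tau> \<Longrightarrow>
      hcomp C (lc C x \<sigma> y \<sigma>') \<tau> = lc C x (hcomp C \<sigma> \<tau>) y (hcomp C \<sigma>' \<tau>)"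
    and hcomp_lc_right: "arr C d e r s \<tau> \<Longrightarrow> arr C c d p q \<sigma> \<Longrightarrow> arr C c d p q \<sigma>' \<Longrightarrow>
      hcomp C \<tau> (lc C x \<sigma> y \<sigma>') = lc C x (hcomp C \<tau> \<sigma>) y (hcomp C \<tau> \<sigma>')"
    and id2_homog: "p \<in> cells1 C c d \<Longrightarrow> id2 C p \<in> homog C 0"
    and vcomp_homog: "arr C c d q r \<sigma> \<Longrightarrow> arr C c d p q \<tau> \<Longrightarrow> \<sigma> \<in> homog C m \<Longrightarrow> \<tau> \<in> homog C n \<Longrightarrow>
      vcomp C \<sigma> \<tau> \<in> homog C (m + n)"
    and hcomp_homog: "arr C d e r s \<rho> \<Longrightarrow> arr C c d p q \<tau> \<Longrightarrow> \<rho> \<in> homog C m \<Longrightarrow> \<tau> \<in> homog C n \<Longrightarrow>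
      hcomp C \<rho> \<tau> \<in> homog C (m + n)"
begin

abbreviation comp1' (infixr "\<odot>" 75) where "comp1' \<equiv> comp1 C"
abbreviation hcomp' (infixr "\<ast>" 75) where "hcomp' \<equiv> hcomp C"
abbreviation vcomp' (infixr "\<cdot>" 70) where "vcomp' \<equiv> vcomp C"
abbreviation id2' ("\<iota>") where "id2' \<equiv> id2 C"

lemma arrD: "arr C c d p q \<sigma> \<Longrightarrow> p \<in> cells1 C c d" "arr C c d p q \<sigma> \<Longrightarrow> q \<in> cells1 C c d"
  by (simp_all add: arr_def)

lemma whisker_left:
  assumes "s \<in> cells1 C d e" "arr C c d q r \<sigma>" "arr C c d p q \<tau>"
  shows "\<iota> s \<ast> (\<sigma> \<cdot> \<tau>) = (\<iota> s \<ast> \<sigma>) \<cdot> (\<iota> s \<ast> \<tau>)"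
  using interchange[OF id2_arr[OF assms(1)] id2_arr[OF assms(1)] assms(2,3)]
  by (simp add: vcomp_id2[OF id2_arr[OF assms(1)]])

lemma whisker_right:
  assumes "arr C d e q r \<sigma>" "arr C d e p q \<tau>" "s \<in> cells1 C c d"
  shows "(\<sigma> \<cdot> \<tau>) \<ast> \<iota> s = (\<sigma> \<ast> \<iota> s) \<cdot> (\<tau> \<ast> \<iota> s)"
  using interchange[OF assms(1,2) id2_arr[OF assms(3)] id2_arr[OF assms(3)]]
  by (simp add: vcomp_id2[OF id2_arr[OF assms(3)]])

text \<open>The two ways to compose 2-morphisms placed side by side one after the other.\<close>

lemma hcomp_left_first:
  assumes "arr C d e r s \<rho>" "arr C c d p q \<tau>"
  shows "(\<iota> s \<ast> \<tau>) \<cdot> (\<rho> \<ast> \<iota> p) = \<rho> \<ast> \<tau>"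
  using interchange[OF id2_arr[OF arrD(2)[OF assms(1)]] assms(1) assms(2) id2_arr[OF arrD(1)[OF assms(2)]]]
  by (simp add: id2_vcomp[OF assms(1)] vcomp_id2[OF assms(2)])

lemma hcomp_right_first:
  assumes "arr C d e r s \<rho>" "arr C c d p q \<tau>"
  shows "(\<rho> \<ast> \<iota> q) \<cdot> (\<iota> r \<ast> \<tau>) = \<rho> \<ast> \<tau>"
  using interchange[OF assms(1) id2_arr[OF arrD(1)[OF assms(1)]] id2_arr[OF arrD(2)[OF assms(2)]] assms(2)]
  by (simp add: id2_vcomp[OF assms(2)] vcomp_id2[OF assms(1)])

text \<open>The data from which the horizontal trace is built; \<open>hG\<close> consists of the generators of all degrees.\<close>

definition hX where "hX = {(k :: int, c, f). c \<in> obj C \<and> f \<in> cells1 C c c}"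
definition hG :: "int \<times> 'o \<times> 'f \<Rightarrow> int \<times> 'o \<times> 'f \<Rightarrow> ('f \<times> 's) set" where
  "hG = (\<lambda>(k, c, f) (l, d, g). {(p, \<sigma>). p \<in> cells1 C c d \<and> \<sigma> \<in> cells2 C (p \<odot> f) (g \<odot> p)})"
definition hone where "hone = (\<lambda>(k :: int, c, f). (id1 C c, \<iota> f))"
definition hmult where "hmult = (\<lambda>(r, \<rho>) (p, \<sigma>). (r \<odot> p, (\<rho> \<ast> \<iota> p) \<cdot> (\<iota> r \<ast> \<sigma>)))"

lemma hTr_eq: "hTr C = sum_cat hX (hTr_gens C) (hTr_rels C) hone hmult"
  by (simp add: hTr_def hX_def hone_def hmult_def)

lemma hG_iff: "f \<in> cells1 C c c \<Longrightarrow> g \<in> cells1 C d d \<Longrightarrow>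
    (p, \<sigma>) \<in> hG (k, c, f) (l, d, g) \<longleftrightarrow> p \<in> cells1 C c d \<and> arr C c d (p \<odot> f) (g \<odot> p) \<sigma>"
  by (auto simp: hG_def arr_def comp1_cell)

lemma hTr_gens_iff: "f \<in> cells1 C c c \<Longrightarrow> g \<in> cells1 C d d \<Longrightarrow>
    (p, \<sigma>) \<in> hTr_gens C (k, c, f) (l, d, g) \<longleftrightarrow>
    p \<in> cells1 C c d \<and> arr C c d (p \<odot> f) (g \<odot> p) \<sigma> \<and> \<sigma> \<in> homog C (l - k)"
  by (auto simp: hTr_gens_def arr_def comp1_cell)

lemma hmult_arr:
  assumes "f \<in> cells1 C c c" "g \<in> cells1 C d d" "h \<in> cells1 C e e"
    and "p \<in> cells1 C c d" "arr C c d (p \<odot> f) (g \<odot> p) \<sigma>"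
    and "r \<in> cells1 C d e" "arr C d e (r \<odot> g) (h \<odot> r) \<rho>"
  shows "arr C c e (r \<odot> g \<odot> p) (h \<odot> r \<odot> p) (\<rho> \<ast> \<iota> p)"
    and "arr C c e (r \<odot> p \<odot> f) (r \<odot> g \<odot> p) (\<iota> r \<ast> \<sigma>)"
    and "arr C c e (r \<odot> p \<odot> f) (h \<odot> r \<odot> p) ((\<rho> \<ast> \<iota> p) \<cdot> (\<iota> r \<ast> \<sigma>))"
proof -
  show 1: "arr C c e (r \<odot> g \<odot> p) (h \<odot> r \<odot> p) (\<rho> \<ast> \<iota> p)"
    using hcomp_arr[OF assms(7) id2_arr[OF assms(4)]] by (simp add: comp1_assoc)
  show 2: "arr C c e (r \<odot> p \<odot> f) (r \<odot> g \<odot> p) (\<iota> r \<ast> \<sigma>)"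
    by (rule hcomp_arr[OF id2_arr[OF assms(6)] assms(5)])
  show "arr C c e (r \<odot> p \<odot> f) (h \<odot> r \<odot> p) ((\<rho> \<ast> \<iota> p) \<cdot> (\<iota> r \<ast> \<sigma>))"
    by (rule vcomp_arr[OF 1 2])
qed

lemma hmult_assoc:
  assumes f: "f \<in> cells1 C c c" "g \<in> cells1 C d d" "h \<in> cells1 C e e" "k \<in> cells1 C b b"
    and p: "p \<in> cells1 C c d" and \<sigma>: "arr C c d (p \<odot> f) (g \<odot> p) \<sigma>"
    and r: "r \<in> cells1 C d e" and \<rho>: "arr C d e (r \<odot> g) (h \<odot> r) \<rho>"
    and s: "s \<in> cells1 C e b" and \<mu>: "arr C e b (s \<odot> h) (k \<odot> s) \<mu>"
  shows "hmult (hmult (s, \<mu>) (r, \<rho>)) (p, \<sigma>) = hmult (s, \<mu>) (hmult (r, \<rho>) (p, \<sigma>))"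
proof -
  note a1 = hmult_arr[OF f(1-3) p \<sigma> r \<rho>]
  note a2 = hmult_arr[OF f(2-4) r \<rho> s \<mu>]
  note i = id2_arr[OF p] id2_arr[OF r] id2_arr[OF s]
  have 1: "((\<mu> \<ast> \<iota> r) \<cdot> (\<iota> s \<ast> \<rho>)) \<ast> \<iota> p = (\<mu> \<ast> \<iota> (r \<odot> p)) \<cdot> (\<iota> s \<ast> \<rho> \<ast> \<iota> p)"
    by (simp add: whisker_right[OF a2(1,2) p] hcomp_assoc[OF \<mu> i(2,1)] hcomp_assoc[OF i(3) \<rho> i(1)]
        hcomp_id2[OF r p])
  have 2: "\<iota> (s \<odot> r) \<ast> \<sigma> = \<iota> s \<ast> \<iota> r \<ast> \<sigma>"
    using hcomp_assoc[OF i(3,2) \<sigma>] by (simp add: hcomp_id2[OF s r])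
  have 3: "\<iota> s \<ast> ((\<rho> \<ast> \<iota> p) \<cdot> (\<iota> r \<ast> \<sigma>)) = (\<iota> s \<ast> \<rho> \<ast> \<iota> p) \<cdot> (\<iota> s \<ast> \<iota> r \<ast> \<sigma>)"
    by (rule whisker_left[OF s a1(1,2)])
  have 4: "arr C c b (s \<odot> h \<odot> r \<odot> p) (k \<odot> s \<odot> r \<odot> p) (\<mu> \<ast> \<iota> (r \<odot> p))"
    using hcomp_arr[OF \<mu> id2_arr[OF comp1_cell[OF r p]]] by (simp add: comp1_assoc)
  have 5: "arr C c b (s \<odot> r \<odot> g \<odot> p) (s \<odot> h \<odot> r \<odot> p) (\<iota> s \<ast> \<rho> \<ast> \<iota> p)"
    by (rule hcomp_arr[OF i(3) a1(1)])
  have 6: "arr C c b (s \<odot> r \<odot> p \<odot> f) (s \<odot> r \<odot> g \<odot> p) (\<iota> s \<ast> \<iota> r \<ast> \<sigma>)"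
    by (rule hcomp_arr[OF i(3) a1(2)])
  show ?thesis
    by (simp add: hmult_def comp1_assoc 1 2 3 vcomp_assoc[OF 4 5 6])
qed

text \<open>The two kinds of relations of the horizontal trace.\<close>

definition hlin where
  "hlin x y = (case (x, y) of ((k :: int, c, f), (l :: int, d, g)) \<Rightarrow>
     linearity_rels C (cells1 C c d) (\<lambda>p. cells2 C (p \<odot> f) (g \<odot> p)))"
definition htrace where
  "htrace x y = (case (x, y) of ((k :: int, c, f), (l :: int, d, g)) \<Rightarrow>
      {basis (p, \<sigma> \<cdot> (\<tau> \<ast> \<iota> f)) - basis (p', (\<iota> g \<ast> \<tau>) \<cdot> \<sigma>) | p p' \<sigma> \<tau>.
         p \<in> cells1 C c d \<and> p' \<in> cells1 C c d \<and> \<tau> \<in> cells2 C p p' \<and>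
         \<sigma> \<in> cells2 C (p' \<odot> f) (g \<odot> p)})"

lemma hTr_rels_eq: "hTr_rels C x y = free_vs.span (hlin x y \<union> htrace x y)"
  by (cases x; cases y) (simp add: hTr_rels_def hlin_def htrace_def)

lemma hlinI:
  assumes "f \<in> cells1 C c c" "g \<in> cells1 C d d" "p \<in> cells1 C c d"
    "arr C c d (p \<odot> f) (g \<odot> p) \<sigma>" "arr C c d (p \<odot> f) (g \<odot> p) \<sigma>'"
  shows "basis (p, lc C a \<sigma> b \<sigma>') - scl a (basis (p, \<sigma>)) - scl b (basis (p, \<sigma>'))
    \<in> hlin (k, c, f) (l, d, g)"
  using assms unfolding hlin_def linearity_rels_def lc_def arr_def prod.case by blast

lemma hlinE:
  assumes "r \<in> hlin (k, c, f) (l, d, g)" "f \<in> cells1 C c c" "g \<in> cells1 C d d"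
  obtains p \<sigma> \<sigma>' a b where "r = basis (p, lc C a \<sigma> b \<sigma>') - scl a (basis (p, \<sigma>)) - scl b (basis (p, \<sigma>'))"
    "p \<in> cells1 C c d" "arr C c d (p \<odot> f) (g \<odot> p) \<sigma>" "arr C c d (p \<odot> f) (g \<odot> p) \<sigma>'"
  using assms comp1_cell unfolding hlin_def linearity_rels_def lc_def arr_def by auto

lemma htraceI:
  assumes "f \<in> cells1 C c c" "g \<in> cells1 C d d"
    "arr C c d p p' \<tau>" "arr C c d (p' \<odot> f) (g \<odot> p) \<sigma>"
  shows "basis (p, \<sigma> \<cdot> (\<tau> \<ast> \<iota> f)) - basis (p', (\<iota> g \<ast> \<tau>) \<cdot> \<sigma>) \<in> htrace (k, c, f) (l, d, g)"
  using assms unfolding htrace_def arr_def by blast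

lemma htraceE:
  assumes "r \<in> htrace (k, c, f) (l, d, g)" "f \<in> cells1 C c c" "g \<in> cells1 C d d"
  obtains p p' \<sigma> \<tau> where "r = basis (p, \<sigma> \<cdot> (\<tau> \<ast> \<iota> f)) - basis (p', (\<iota> g \<ast> \<tau>) \<cdot> \<sigma>)"
    "arr C c d p p' \<tau>" "arr C c d (p' \<odot> f) (g \<odot> p) \<sigma>"
  using assms comp1_cell unfolding htrace_def arr_def by auto

lemma hTr_relsI: "r \<in> hlin x y \<Longrightarrow> r \<in> hTr_rels C x y" "r \<in> htrace x y \<Longrightarrow> r \<in> hTr_rels C x y"
  by (auto simp: hTr_rels_eq intro: free_vs.span_base)

lemma subspace_hTr_rels: "free_vs.subspace (hTr_rels C x y)"
  by (simp add: hTr_rels_eq free_vs.subspace_span)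

lemma hTr_rels_hG:
  assumes f: "f \<in> cells1 C c c" and g: "g \<in> cells1 C d d"
  shows "hTr_rels C (k, c, f) (l, d, g) \<subseteq> free_vs.span (basis ` hG (k, c, f) (l, d, g))"
  unfolding hTr_rels_eq
proof (rule free_vs.span_minimal[OF _ free_vs.subspace_span], rule subsetI, elim UnE)
  fix r assume "r \<in> hlin (k, c, f) (l, d, g)"
  then show "r \<in> free_vs.span (basis ` hG (k, c, f) (l, d, g))"
    by (rule hlinE[OF _ f g], simp only:)
      (intro free_vs.span_diff free_vs.span_scale free_vs.span_base imageI, simp_all add: hG_iff f g lc_arr)
next
  fix r assume "r \<in> htrace (k, c, f) (l, d, g)"
  then show "r \<in> free_vs.span (basis ` hG (k, c, f) (l, d, g))"
  proof (rule htraceE[OF _ f g])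
    fix p p' \<sigma> \<tau> assume r: "r = basis (p, \<sigma> \<cdot> (\<tau> \<ast> \<iota> f)) - basis (p', (\<iota> g \<ast> \<tau>) \<cdot> \<sigma>)"
      and \<tau>: "arr C c d p p' \<tau>" and \<sigma>: "arr C c d (p' \<odot> f) (g \<odot> p) \<sigma>"
    show "r \<in> free_vs.span (basis ` hG (k, c, f) (l, d, g))"
      unfolding r
      by (intro free_vs.span_diff free_vs.span_base imageI)
        (auto simp: hG_iff f g arrD[OF \<tau>]
          intro: vcomp_arr[OF \<sigma> hcomp_arr[OF \<tau> id2_arr[OF f]]] vcomp_arr[OF hcomp_arr[OF id2_arr[OF g] \<tau>] \<sigma>])
  qed
qed

text \<open>The relations are preserved by composition with \<open>(s, \<mu>)\<close>: a linearity relation goes to one, and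
  the trace relation for \<open>\<tau>\<close> goes to the one for \<open>s \<tau>\<close>, since \<open>\<mu>\<close> and \<open>\<tau>\<close> interchange.\<close>

lemma hmult_rels_left:
  assumes f: "f \<in> cells1 C c c" and g: "g \<in> cells1 C d d" and h: "h \<in> cells1 C e e"
    and s: "s \<in> cells1 C d e" and \<mu>: "arr C d e (s \<odot> g) (h \<odot> s) \<mu>"
    and r: "r \<in> hTr_rels C (k, c, f) (l, d, g)"
  shows "bilin_ext hmult (basis (s, \<mu>)) r \<in> hTr_rels C (k, c, f) (n, e, h)"
proof (rule lin_into_span[OF lin_bilin_right subspace_hTr_rels r[unfolded hTr_rels_eq]])
  fix r assume "r \<in> hlin (k, c, f) (l, d, g) \<union> htrace (k, c, f) (l, d, g)"
  then show "bilin_ext hmult (basis (s, \<mu>)) r \<in> hTr_rels C (k, c, f) (n, e, h)"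
  proof
    assume "r \<in> hlin (k, c, f) (l, d, g)"
    then show ?thesis
    proof (rule hlinE[OF _ f g])
      fix p \<sigma> \<sigma>' a b
      assume r: "r = basis (p, lc C a \<sigma> b \<sigma>') - scl a (basis (p, \<sigma>)) - scl b (basis (p, \<sigma>'))"
        and p: "p \<in> cells1 C c d" and \<sigma>: "arr C c d (p \<odot> f) (g \<odot> p) \<sigma>"
        and \<sigma>': "arr C c d (p \<odot> f) (g \<odot> p) \<sigma>'"
      note a = hmult_arr[OF f g h p \<sigma> s \<mu>] and a' = hmult_arr[OF f g h p \<sigma>' s \<mu>]
      have "(\<mu> \<ast> \<iota> p) \<cdot> (\<iota> s \<ast> lc C a \<sigma> b \<sigma>')
          = lc C a ((\<mu> \<ast> \<iota> p) \<cdot> (\<iota> s \<ast> \<sigma>)) b ((\<mu> \<ast> \<iota> p) \<cdot> (\<iota> s \<ast> \<sigma>'))"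
        by (simp add: hcomp_lc_right[OF id2_arr[OF s] \<sigma> \<sigma>'] vcomp_lc_right[OF a(1,2) a'(2)])
      then have "bilin_ext hmult (basis (s, \<mu>)) r \<in> hlin (k, c, f) (n, e, h)"
        using hlinI[OF f h comp1_cell[OF s p], unfolded comp1_assoc, OF a(3) a'(3)]
        by (simp add: r bilin_simps hmult_def)
      then show ?thesis by (rule hTr_relsI)
    qed
  next
    assume "r \<in> htrace (k, c, f) (l, d, g)"
    then show ?thesis
    proof (rule htraceE[OF _ f g])
      fix p p' \<sigma> \<tau> assume r: "r = basis (p, \<sigma> \<cdot> (\<tau> \<ast> \<iota> f)) - basis (p', (\<iota> g \<ast> \<tau>) \<cdot> \<sigma>)"
        and \<tau>: "arr C c d p p' \<tau>" and \<sigma>: "arr C c d (p' \<odot> f) (g \<odot> p) \<sigma>"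
      note p = arrD[OF \<tau>]
      let ?\<tau> = "\<iota> s \<ast> \<tau>" and ?\<sigma> = "(\<mu> \<ast> \<iota> p) \<cdot> (\<iota> s \<ast> \<sigma>)"
      have \<tau>f: "arr C c d (p \<odot> f) (p' \<odot> f) (\<tau> \<ast> \<iota> f)" by (rule hcomp_arr[OF \<tau> id2_arr[OF f]])
      have g\<tau>: "arr C c d (g \<odot> p) (g \<odot> p') (\<iota> g \<ast> \<tau>)" by (rule hcomp_arr[OF id2_arr[OF g] \<tau>])
      have s\<sigma>: "arr C c e (s \<odot> p' \<odot> f) (s \<odot> g \<odot> p) (\<iota> s \<ast> \<sigma>)"
        by (rule hcomp_arr[OF id2_arr[OF s] \<sigma>])
      have \<mu>p: "arr C c e (s \<odot> g \<odot> p) (h \<odot> s \<odot> p) (\<mu> \<ast> \<iota> p)"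
        using hcomp_arr[OF \<mu> id2_arr[OF p(1)]] by (simp add: comp1_assoc)
      have \<mu>p': "arr C c e (s \<odot> g \<odot> p') (h \<odot> s \<odot> p') (\<mu> \<ast> \<iota> p')"
        using hcomp_arr[OF \<mu> id2_arr[OF p(2)]] by (simp add: comp1_assoc)
      have sg\<tau>: "arr C c e (s \<odot> g \<odot> p) (s \<odot> g \<odot> p') (\<iota> s \<ast> \<iota> g \<ast> \<tau>)"
        by (rule hcomp_arr[OF id2_arr[OF s] g\<tau>])
      have hs\<tau>: "arr C c e (h \<odot> s \<odot> p) (h \<odot> s \<odot> p') (\<iota> h \<ast> \<iota> s \<ast> \<tau>)"
        by (rule hcomp_arr[OF id2_arr[OF h] hcomp_arr[OF id2_arr[OF s] \<tau>]])
      have "(\<mu> \<ast> \<iota> p) \<cdot> (\<iota> s \<ast> (\<sigma> \<cdot> (\<tau> \<ast> \<iota> f))) = ?\<sigma> \<cdot> (?\<tau> \<ast> \<iota> f)"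
        using vcomp_assoc[OF \<mu>p s\<sigma> hcomp_arr[OF id2_arr[OF s] \<tau>f]]
        by (simp add: whisker_left[OF s \<sigma> \<tau>f] hcomp_assoc[OF id2_arr[OF s] \<tau> id2_arr[OF f]])
      moreover have "(\<mu> \<ast> \<iota> p') \<cdot> (\<iota> s \<ast> ((\<iota> g \<ast> \<tau>) \<cdot> \<sigma>)) = (\<iota> h \<ast> ?\<tau>) \<cdot> ?\<sigma>"
      proof -
        have "(\<mu> \<ast> \<iota> p') \<cdot> (\<iota> s \<ast> ((\<iota> g \<ast> \<tau>) \<cdot> \<sigma>)) = ((\<mu> \<ast> \<iota> p') \<cdot> (\<iota> s \<ast> \<iota> g \<ast> \<tau>)) \<cdot> (\<iota> s \<ast> \<sigma>)"
          by (simp add: whisker_left[OF s g\<tau> \<sigma>] vcomp_assoc[OF \<mu>p' sg\<tau> s\<sigma>])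
        also have "(\<mu> \<ast> \<iota> p') \<cdot> (\<iota> s \<ast> \<iota> g \<ast> \<tau>) = (\<mu> \<ast> \<iota> p') \<cdot> (\<iota> (s \<odot> g) \<ast> \<tau>)"
          by (simp add: hcomp_assoc[OF id2_arr[OF s] id2_arr[OF g] \<tau>, symmetric] hcomp_id2[OF s g])
        also have "\<dots> = (\<iota> (h \<odot> s) \<ast> \<tau>) \<cdot> (\<mu> \<ast> \<iota> p)"
          by (simp add: hcomp_right_first[OF \<mu> \<tau>] hcomp_left_first[OF \<mu> \<tau>])
        also have "\<dots> = (\<iota> h \<ast> \<iota> s \<ast> \<tau>) \<cdot> (\<mu> \<ast> \<iota> p)"
          by (simp add: hcomp_assoc[OF id2_arr[OF h] id2_arr[OF s] \<tau>, symmetric] hcomp_id2[OF h s])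
        finally show ?thesis by (simp add: vcomp_assoc[OF hs\<tau> \<mu>p s\<sigma>])
      qed
      moreover have "arr C c e (s \<odot> p) (s \<odot> p') ?\<tau>" by (rule hcomp_arr[OF id2_arr[OF s] \<tau>])
      moreover have "arr C c e ((s \<odot> p') \<odot> f) (h \<odot> s \<odot> p) ?\<sigma>"
        using vcomp_arr[OF \<mu>p s\<sigma>] by (simp add: comp1_assoc)
      ultimately have "bilin_ext hmult (basis (s, \<mu>)) r \<in> htrace (k, c, f) (n, e, h)"
        using htraceI[OF f h, of "s \<odot> p" "s \<odot> p'" ?\<tau> ?\<sigma>]
        by (simp add: r bilin_simps hmult_def)
      then show ?thesis by (rule hTr_relsI)
    qed
  qed
qed

lemma hmult_rels_right:
  assumes f: "f \<in> cells1 C c c" and g: "g \<in> cells1 C d d" and h: "h \<in> cells1 C e e"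
    and s: "s \<in> cells1 C c d" and \<mu>: "arr C c d (s \<odot> f) (g \<odot> s) \<mu>"
    and r: "r \<in> hTr_rels C (l, d, g) (n, e, h)"
  shows "bilin_ext hmult r (basis (s, \<mu>)) \<in> hTr_rels C (k, c, f) (n, e, h)"
proof (rule lin_into_span[OF lin_bilin_left subspace_hTr_rels r[unfolded hTr_rels_eq]])
  fix r assume "r \<in> hlin (l, d, g) (n, e, h) \<union> htrace (l, d, g) (n, e, h)"
  then show "bilin_ext hmult r (basis (s, \<mu>)) \<in> hTr_rels C (k, c, f) (n, e, h)"
  proof
    assume "r \<in> hlin (l, d, g) (n, e, h)"
    then show ?thesis
    proof (rule hlinE[OF _ g h])
      fix p \<sigma> \<sigma>' a b
      assume r: "r = basis (p, lc C a \<sigma> b \<sigma>') - scl a (basis (p, \<sigma>)) - scl b (basis (p, \<sigma>'))"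
        and p: "p \<in> cells1 C d e" and \<sigma>: "arr C d e (p \<odot> g) (h \<odot> p) \<sigma>"
        and \<sigma>': "arr C d e (p \<odot> g) (h \<odot> p) \<sigma>'"
      note a = hmult_arr[OF f g h s \<mu> p \<sigma>] and a' = hmult_arr[OF f g h s \<mu> p \<sigma>']
      have "(lc C a \<sigma> b \<sigma>' \<ast> \<iota> s) \<cdot> (\<iota> p \<ast> \<mu>)
          = lc C a ((\<sigma> \<ast> \<iota> s) \<cdot> (\<iota> p \<ast> \<mu>)) b ((\<sigma>' \<ast> \<iota> s) \<cdot> (\<iota> p \<ast> \<mu>))"
        by (simp add: hcomp_lc_left[OF \<sigma> \<sigma>' id2_arr[OF s]] vcomp_lc_left[OF a(1) a'(1) a(2)])
      then have "bilin_ext hmult r (basis (s, \<mu>)) \<in> hlin (k, c, f) (n, e, h)"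
        using hlinI[OF f h comp1_cell[OF p s], unfolded comp1_assoc, OF a(3) a'(3)]
        by (simp add: r bilin_simps hmult_def)
      then show ?thesis by (rule hTr_relsI)
    qed
  next
    assume "r \<in> htrace (l, d, g) (n, e, h)"
    then show ?thesis
    proof (rule htraceE[OF _ g h])
      fix p p' \<sigma> \<tau> assume r: "r = basis (p, \<sigma> \<cdot> (\<tau> \<ast> \<iota> g)) - basis (p', (\<iota> h \<ast> \<tau>) \<cdot> \<sigma>)"
        and \<tau>: "arr C d e p p' \<tau>" and \<sigma>: "arr C d e (p' \<odot> g) (h \<odot> p) \<sigma>"
      note p = arrD[OF \<tau>]
      let ?\<tau> = "\<tau> \<ast> \<iota> s" and ?\<sigma> = "(\<sigma> \<ast> \<iota> s) \<cdot> (\<iota> p' \<ast> \<mu>)"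
      have \<tau>g: "arr C d e (p \<odot> g) (p' \<odot> g) (\<tau> \<ast> \<iota> g)" by (rule hcomp_arr[OF \<tau> id2_arr[OF g]])
      have h\<tau>: "arr C d e (h \<odot> p) (h \<odot> p') (\<iota> h \<ast> \<tau>)" by (rule hcomp_arr[OF id2_arr[OF h] \<tau>])
      have \<sigma>s: "arr C c e (p' \<odot> g \<odot> s) (h \<odot> p \<odot> s) (\<sigma> \<ast> \<iota> s)"
        using hcomp_arr[OF \<sigma> id2_arr[OF s]] by (simp add: comp1_assoc)
      have p\<mu>: "arr C c e (p \<odot> s \<odot> f) (p \<odot> g \<odot> s) (\<iota> p \<ast> \<mu>)"
        by (rule hcomp_arr[OF id2_arr[OF p(1)] \<mu>])
      have p\<mu>': "arr C c e (p' \<odot> s \<odot> f) (p' \<odot> g \<odot> s) (\<iota> p' \<ast> \<mu>)"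
        by (rule hcomp_arr[OF id2_arr[OF p(2)] \<mu>])
      have \<tau>gs: "arr C c e (p \<odot> g \<odot> s) (p' \<odot> g \<odot> s) ((\<tau> \<ast> \<iota> g) \<ast> \<iota> s)"
        using hcomp_arr[OF \<tau>g id2_arr[OF s]] by (simp add: comp1_assoc)
      have \<tau>sf: "arr C c e (p \<odot> s \<odot> f) (p' \<odot> s \<odot> f) ((\<tau> \<ast> \<iota> s) \<ast> \<iota> f)"
        using hcomp_arr[OF hcomp_arr[OF \<tau> id2_arr[OF s]] id2_arr[OF f]] by (simp add: comp1_assoc)
      have h\<tau>s: "arr C c e (h \<odot> p \<odot> s) (h \<odot> p' \<odot> s) (\<iota> h \<ast> \<tau> \<ast> \<iota> s)"
        by (rule hcomp_arr[OF id2_arr[OF h] hcomp_arr[OF \<tau> id2_arr[OF s]]])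
      have "((\<sigma> \<cdot> (\<tau> \<ast> \<iota> g)) \<ast> \<iota> s) \<cdot> (\<iota> p \<ast> \<mu>) = ?\<sigma> \<cdot> (?\<tau> \<ast> \<iota> f)"
      proof -
        have "((\<sigma> \<cdot> (\<tau> \<ast> \<iota> g)) \<ast> \<iota> s) \<cdot> (\<iota> p \<ast> \<mu>) = (\<sigma> \<ast> \<iota> s) \<cdot> (((\<tau> \<ast> \<iota> g) \<ast> \<iota> s) \<cdot> (\<iota> p \<ast> \<mu>))"
          by (simp add: whisker_right[OF \<sigma> \<tau>g s] vcomp_assoc[OF \<sigma>s \<tau>gs p\<mu>])
        also have "((\<tau> \<ast> \<iota> g) \<ast> \<iota> s) \<cdot> (\<iota> p \<ast> \<mu>) = (\<tau> \<ast> \<iota> (g \<odot> s)) \<cdot> (\<iota> p \<ast> \<mu>)"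
          by (simp add: hcomp_assoc[OF \<tau> id2_arr[OF g] id2_arr[OF s]] hcomp_id2[OF g s])
        also have "\<dots> = (\<iota> p' \<ast> \<mu>) \<cdot> (\<tau> \<ast> \<iota> (s \<odot> f))"
          by (simp add: hcomp_right_first[OF \<tau> \<mu>] hcomp_left_first[OF \<tau> \<mu>])
        also have "\<dots> = (\<iota> p' \<ast> \<mu>) \<cdot> ((\<tau> \<ast> \<iota> s) \<ast> \<iota> f)"
          by (simp add: hcomp_assoc[OF \<tau> id2_arr[OF s] id2_arr[OF f]] hcomp_id2[OF s f])
        finally show ?thesis by (simp add: vcomp_assoc[OF \<sigma>s p\<mu>' \<tau>sf])
      qed
      moreover have "(((\<iota> h \<ast> \<tau>) \<cdot> \<sigma>) \<ast> \<iota> s) \<cdot> (\<iota> p' \<ast> \<mu>) = (\<iota> h \<ast> ?\<tau>) \<cdot> ?\<sigma>"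
        using vcomp_assoc[OF h\<tau>s \<sigma>s p\<mu>']
        by (simp add: whisker_right[OF h\<tau> \<sigma> s] hcomp_assoc[OF id2_arr[OF h] \<tau> id2_arr[OF s]])
      moreover have "arr C c e (p \<odot> s) (p' \<odot> s) ?\<tau>" by (rule hcomp_arr[OF \<tau> id2_arr[OF s]])
      moreover have "arr C c e ((p' \<odot> s) \<odot> f) (h \<odot> p \<odot> s) ?\<sigma>"
        using vcomp_arr[OF \<sigma>s p\<mu>'] by (simp add: comp1_assoc)
      ultimately have "bilin_ext hmult r (basis (s, \<mu>)) \<in> htrace (k, c, f) (n, e, h)"
        using htraceI[OF f h, of "p \<odot> s" "p' \<odot> s" ?\<tau> ?\<sigma>]
        by (simp add: r bilin_simps hmult_def)
      then show ?thesis by (rule hTr_relsI)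
    qed
  qed
qed

sublocale H: presented_category hX "hTr_gens C" hG "hTr_rels C" hone hmult
proof
  fix x y z w :: "int \<times> 'o \<times> 'f" and g f h :: "'f \<times> 's" and r
  obtain k c f0 where x: "x = (k, c, f0)" by (cases x)
  obtain l d g0 where y: "y = (l, d, g0)" by (cases y)
  obtain n e h0 where z: "z = (n, e, h0)" by (cases z)
  obtain n' b j0 where w: "w = (n', b, j0)" by (cases w)
  obtain p \<sigma> where f: "f = (p, \<sigma>)" by (cases f)
  obtain q \<rho> where g: "g = (q, \<rho>)" by (cases g)
  obtain s \<mu> where h: "h = (s, \<mu>)" by (cases h)
  {
    assume "x \<in> hX"
    then have f0: "c \<in> obj C" "f0 \<in> cells1 C c c" by (auto simp: x hX_def)
    then show "hone x \<in> hTr_gens C x x"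
      by (auto simp: x hone_def hTr_gens_iff id1_cell comp1_id1 id1_comp1 id2_arr id2_homog)
    assume "y \<in> hX"
    then have g0: "d \<in> obj C" "g0 \<in> cells1 C d d" by (auto simp: y hX_def)
    show "hTr_gens C x y \<subseteq> hG x y"
      using f0 g0 by (auto simp: x y hTr_gens_iff hG_iff)
    show "hTr_rels C x y \<subseteq> free_vs.span (basis ` hG x y)"
      unfolding x y by (rule hTr_rels_hG[OF f0(2) g0(2)])
    show "hmult f (hone x) = f" if "f \<in> hG x y"
    proof -
      have p: "p \<in> cells1 C c d" and \<sigma>: "arr C c d (p \<odot> f0) (g0 \<odot> p) \<sigma>"
        using that f0 g0 by (simp_all add: x y f hG_iff)
      show ?thesis
        using vcomp_id2[OF \<sigma>]
        by (simp add: x f hone_def hmult_def comp1_id1[OF p] hcomp_id1[OF \<sigma>] hcomp_id2[OF p f0(2)])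
    qed
    show "hmult (hone y) f = f" if "f \<in> hG x y"
    proof -
      have p: "p \<in> cells1 C c d" and \<sigma>: "arr C c d (p \<odot> f0) (g0 \<odot> p) \<sigma>"
        using that f0 g0 by (simp_all add: x y f hG_iff)
      show ?thesis
        using id2_vcomp[OF \<sigma>]
        by (simp add: y f hone_def hmult_def id1_comp1[OF p] id1_hcomp[OF \<sigma>] hcomp_id2[OF g0(2) p])
    qed
    assume "z \<in> hX"
    then have h0: "e \<in> obj C" "h0 \<in> cells1 C e e" by (auto simp: z hX_def)
    show "hmult g f \<in> hG x z" if "g \<in> hG y z" "f \<in> hG x y"
      using that f0 g0 h0
      by (auto simp: x y z f g hG_iff hmult_def comp1_cell comp1_assoc intro: hmult_arr)
    show "hmult g f \<in> hTr_gens C x z" if "g \<in> hTr_gens C y z" "f \<in> hTr_gens C x y"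
    proof -
      have p: "p \<in> cells1 C c d" and \<sigma>: "arr C c d (p \<odot> f0) (g0 \<odot> p) \<sigma>" "\<sigma> \<in> homog C (l - k)"
        and q: "q \<in> cells1 C d e" and \<rho>: "arr C d e (q \<odot> g0) (h0 \<odot> q) \<rho>" "\<rho> \<in> homog C (n - l)"
        using that f0 g0 h0 by (auto simp: x y z f g hTr_gens_iff)
      note a = hmult_arr[OF f0(2) g0(2) h0(2) p \<sigma>(1) q \<rho>(1)]
      have "(\<rho> \<ast> \<iota> p) \<cdot> (\<iota> q \<ast> \<sigma>) \<in> homog C (((n - l) + 0) + (0 + (l - k)))"
        by (intro vcomp_homog[OF a(1,2)] hcomp_homog[OF \<rho>(1) id2_arr[OF p]]
            hcomp_homog[OF id2_arr[OF q] \<sigma>(1)] id2_homog[OF p] id2_homog[OF q] \<rho> \<sigma>)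
      then show ?thesis
        using a(3) f0 h0 comp1_cell[OF q p]
        by (simp add: x z f g hTr_gens_iff hmult_def comp1_assoc)
    qed
    show "bilin_ext hmult (basis g) r \<in> hTr_rels C x z" if "g \<in> hG y z" "r \<in> hTr_rels C x y"
      using that f0 g0 h0 unfolding x y z g
      by (intro hmult_rels_left[where l = l and g = g0 and d = d]) (auto simp: hG_iff)
    show "bilin_ext hmult r (basis f) \<in> hTr_rels C x z" if "r \<in> hTr_rels C y z" "f \<in> hG x y"
      using that f0 g0 h0 unfolding x y z f
      by (intro hmult_rels_right[where l = l and g = g0 and d = d]) (auto simp: hG_iff)
    assume "w \<in> hX"
    then have j0: "b \<in> obj C" "j0 \<in> cells1 C b b" by (auto simp: w hX_def)
    show "hmult (hmult h g) f = hmult h (hmult g f)"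
      if "h \<in> hG y z" "g \<in> hG x y" "f \<in> hG w x"
      using that j0 f0 g0 h0 unfolding f g h
      by (intro hmult_assoc[where c = b and d = c and e = d and b = e and f = j0 and g = f0
            and h = g0 and k = h0]) (auto simp: w x y z hG_iff)
  }
qed (rule subspace_hTr_rels)

lemma id1_hX: "c \<in> obj C \<Longrightarrow> (k, c, id1 C c) \<in> hX"
  by (simp add: hX_def id1_cell)

text \<open>Since the unit laws are strict, the spaces of morphisms of the vertical trace and those between
  identity 1-morphisms in the horizontal trace have the same generators and relations.\<close>

lemma vTr_gens_eq:
  assumes "c \<in> obj C" "d \<in> obj C"
  shows "vTr_gens C (k, c) (l, d) = hTr_gens C (k, c, id1 C c) (l, d, id1 C d)"
  by (auto simp: vTr_gens_def hTr_gens_def comp1_id1 id1_comp1)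

lemma vTr_rels_eq:
  assumes c: "c \<in> obj C" and d: "d \<in> obj C"
  shows "vTr_rels C (k, c) (l, d) = hTr_rels C (k, c, id1 C c) (l, d, id1 C d)"
proof -
  have "hlin (k, c, id1 C c) (l, d, id1 C d) = linearity_rels C (cells1 C c d) (\<lambda>p. cells2 C p p)"
    unfolding hlin_def linearity_rels_def prod.case
    by (rule Collect_cong, intro ex_cong1) (auto simp: comp1_id1 id1_comp1)
  moreover have "htrace (k, c, id1 C c) (l, d, id1 C d)
      = {basis (p', vcomp C f g) - basis (p, vcomp C g f) | p p' f g.
         p \<in> cells1 C c d \<and> p' \<in> cells1 C c d \<and> f \<in> cells2 C p p' \<and> g \<in> cells2 C p' p}" (is "?L = ?R")
  proof (intro set_eqI iffI)
    fix r assume "r \<in> ?L"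
    then show "r \<in> ?R"
    proof (rule htraceE[OF _ id1_cell[OF c] id1_cell[OF d]])
      fix p p' \<sigma> \<tau> assume r: "r = basis (p, \<sigma> \<cdot> (\<tau> \<ast> \<iota> (id1 C c))) - basis (p', (\<iota> (id1 C d) \<ast> \<tau>) \<cdot> \<sigma>)"
        and \<tau>: "arr C c d p p' \<tau>" and \<sigma>: "arr C c d (p' \<odot> id1 C c) (id1 C d \<odot> p) \<sigma>"
      have "r = basis (p, \<sigma> \<cdot> \<tau>) - basis (p', \<tau> \<cdot> \<sigma>)"
        by (simp add: r hcomp_id1[OF \<tau>] id1_hcomp[OF \<tau>])
      moreover have "arr C c d p' p \<sigma>"
        using \<sigma> by (simp add: comp1_id1[OF arrD(2)[OF \<tau>]] id1_comp1[OF arrD(1)[OF \<tau>]])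
      ultimately show "r \<in> ?R" using \<tau> unfolding arr_def by blast
    qed
  next
    fix r assume "r \<in> ?R"
    then obtain p p' f g where r: "r = basis (p', f \<cdot> g) - basis (p, g \<cdot> f)"
      and f: "arr C c d p p' f" and g: "arr C c d p' p g"
      unfolding arr_def by blast
    have "arr C c d (p \<odot> id1 C c) (id1 C d \<odot> p') f"
      using f by (simp add: comp1_id1[OF arrD(1)[OF f]] id1_comp1[OF arrD(2)[OF f]])
    from htraceI[OF id1_cell[OF c] id1_cell[OF d] g this]
    show "r \<in> ?L" by (simp add: r hcomp_id1[OF g] id1_hcomp[OF g])
  qed
  ultimately show ?thesis
    unfolding vTr_rels_def hTr_rels_eq by simp
qed

lemma vmult_eq:
  assumes "arr C d e r r \<rho>" "arr C c d p p \<sigma>"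
  shows "(r \<odot> p, \<rho> \<ast> \<sigma>) = hmult (r, \<rho>) (p, \<sigma>)"
  by (simp add: hmult_def hcomp_right_first[OF assms])

text \<open>The inclusion is the inclusion of a full subcategory, so only essential surjectivity is at
  stake.\<close>

theorem equivalence_if_splits:
  assumes splits: "\<And>x. x \<in> hX \<Longrightarrow> H.splits {(k, c, id1 C c) | k c. c \<in> obj C} x"
  shows "equivalence_of_categories (vTr C) (hTr C) (incl_ob C) (incl_mor C)"
proof -
  let ?B = "{(k :: int, c, id1 C c) | k c. c \<in> obj C}"
  define ic where "ic = (\<lambda>(k :: int, c). (k, c, id1 C c))"
  define vone where "vone = (\<lambda>(k :: int, c). (id1 C c, \<iota> (id1 C c)))"
  define vmult where "vmult = (\<lambda>(r, \<rho>) (p, \<sigma>). (r \<odot> p, \<rho> \<ast> \<sigma>))"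
  have v: "vTr C = sum_cat (UNIV \<times> obj C) (vTr_gens C) (vTr_rels C) vone vmult"
    by (simp add: vTr_def vone_def vmult_def)
  have incl: "incl_ob C xs = map ic xs" for xs
    by (simp add: incl_ob_def ic_def)
  have ic_hX: "ic x \<in> hX" if "x \<in> UNIV \<times> obj C" for x
    using that by (auto simp: ic_def id1_hX)
  have gens: "vTr_gens C x y = hTr_gens C (ic x) (ic y)"
    and rels: "vTr_rels C x y = hTr_rels C (ic x) (ic y)"
    if "x \<in> UNIV \<times> obj C" "y \<in> UNIV \<times> obj C" for x y
    using that vTr_gens_eq vTr_rels_eq by (auto simp: ic_def)
  have one: "vone x = hone (ic x)" for x
    by (simp add: vone_def hone_def ic_def split: prod.split)
  have mult: "vmult g f = hmult g f"
    if "x \<in> UNIV \<times> obj C" "y \<in> UNIV \<times> obj C" "z \<in> UNIV \<times> obj C" "g \<in> hG (ic y) (ic z)" "f \<in> hG (ic x) (ic y)"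
    for x y z g f
  proof -
    obtain k c l d n e where xyz: "x = (k, c)" "y = (l, d)" "z = (n, e)"
      by (cases x; cases y; cases z)
    obtain p \<sigma> r \<rho> where fg: "f = (p, \<sigma>)" "g = (r, \<rho>)" by (cases f; cases g)
    have p: "p \<in> cells1 C c d" and r: "r \<in> cells1 C d e"
      using that by (auto simp: xyz fg ic_def hG_def)
    have "arr C c d p p \<sigma>" "arr C d e r r \<rho>"
      using that by (auto simp: xyz fg ic_def hG_iff id1_cell comp1_id1 id1_comp1)
    then show ?thesis using vmult_eq by (simp add: vmult_def fg)
  qed
  have nth: "xs ! i \<in> UNIV \<times> obj C" if "xs \<in> lists (UNIV \<times> obj C)" "i < length xs" for xs i
    using that by auto
  have ob_v: "ob (vTr C) = lists (UNIV \<times> obj C)" by (simp add: v sum_cat_def)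
  have hom: "hom (vTr C) xs ys = hom (hTr C) (map ic xs) (map ic ys)"
    if "xs \<in> lists (UNIV \<times> obj C)" "ys \<in> lists (UNIV \<times> obj C)" for xs ys
  proof -
    have "(\<forall>i<length ys. \<forall>j<length xs. M i j \<in> coset (vTr_rels C (xs ! j) (ys ! i)) `
        free_vs.span (basis ` vTr_gens C (xs ! j) (ys ! i)))
      \<longleftrightarrow> (\<forall>i<length ys. \<forall>j<length xs. M i j \<in> coset (hTr_rels C (ic (xs ! j)) (ic (ys ! i))) `
        free_vs.span (basis ` hTr_gens C (ic (xs ! j)) (ic (ys ! i))))" for M
      by (simp add: gens[OF nth[OF that(1)] nth[OF that(2)]] rels[OF nth[OF that(1)] nth[OF that(2)]])
    then show ?thesis unfolding v hTr_eq sum_cat_def by (simp cong: conj_cong)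
  qed
  show ?thesis
  proof (rule equivalence_if_full_subcategory)
    show "category (hTr C)" unfolding hTr_eq by (rule H.category_SC)
  next
    fix xs assume "xs \<in> ob (vTr C)"
    then show "incl_ob C xs \<in> ob (hTr C)"
      unfolding ob_v incl hTr_eq H.ob_SC using ic_hX by fastforce
  next
    fix xs ys assume "xs \<in> ob (vTr C)" "ys \<in> ob (vTr C)"
    then show "hom (vTr C) xs ys = hom (hTr C) (incl_ob C xs) (incl_ob C ys)"
      unfolding ob_v incl by (rule hom)
  next
    fix xs assume "xs \<in> ob (vTr C)"
    then have xs: "xs \<in> lists (UNIV \<times> obj C)" by (simp add: ob_v)
    show "idn (vTr C) xs = idn (hTr C) (incl_ob C xs)"
      unfolding v hTr_eq incl sum_cat_def cat.simps length_map
      by (rule mat_cong) (simp add: rels nth[OF xs] one)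
  next
    fix xs ys zs M N
    assume "xs \<in> ob (vTr C)" "ys \<in> ob (vTr C)" "zs \<in> ob (vTr C)"
      and M: "M \<in> hom (vTr C) xs ys" and N: "N \<in> hom (vTr C) ys zs"
    then have l: "xs \<in> lists (UNIV \<times> obj C)" "ys \<in> lists (UNIV \<times> obj C)" "zs \<in> lists (UNIV \<times> obj C)"
      by (simp_all add: ob_v)
    have rep: "rep (M i j) \<in> H.SG (ic (xs ! j)) (ic (ys ! i))"
      if "M \<in> hom (vTr C) xs ys" "xs \<in> lists (UNIV \<times> obj C)" "ys \<in> lists (UNIV \<times> obj C)"
        "i < length ys" "j < length xs" for xs ys M i j
    proof -
      note xy = ic_hX[OF nth[OF that(2,5)]] ic_hX[OF nth[OF that(3,4)]]
      have "M \<in> hom H.SC (map ic xs) (map ic ys)" using that hom by (simp add: hTr_eq)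
      then obtain A where "M = H.matc (map ic xs) (map ic ys) A"
        and A: "\<forall>i<length ys. \<forall>j<length xs. A i j \<in> H.Sg (map ic xs ! j) (map ic ys ! i)"
        unfolding H.hom_SC by auto
      moreover have "A i j \<in> H.Sg (ic (xs ! j)) (ic (ys ! i))"
        using A[rule_format, OF that(4,5)] that(4,5) by simp
      ultimately show ?thesis
        using that(4,5) H.rep_SG[OF xy H.Sg_SG[OF xy]] by (simp add: H.matc_def)
    qed
    show "cmp (vTr C) xs ys zs N M = cmp (hTr C) (incl_ob C xs) (incl_ob C ys) (incl_ob C zs) N M"
      unfolding v hTr_eq incl sum_cat_def cat.simps length_map
    proof (rule mat_cong)
      fix i k assume ik: "i < length zs" "k < length xs"
      have "bilin_ext vmult (rep (N i j)) (rep (M j k)) = bilin_ext hmult (rep (N i j)) (rep (M j k))"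
        if "j < length ys" for j
        using rep[OF N l(2,3) ik(1) that] rep[OF M l(1,2) that ik(2)]
        by (rule bilin_eq_on_span)
          (rule mult[OF nth[OF l(1) ik(2)] nth[OF l(2) that] nth[OF l(3) ik(1)]])
      then show "coset (vTr_rels C (xs ! k) (zs ! i))
          (\<Sum>j<length ys. bilin_ext vmult (rep (N i j)) (rep (M j k)))
        = coset (hTr_rels C (map ic xs ! k) (map ic zs ! i))
          (\<Sum>j<length ys. bilin_ext hmult (rep (N i j)) (rep (M j k)))"
        using ik by (simp add: rels[OF nth[OF l(1)] nth[OF l(3)]])
    qed
  next
    fix xs ys M
    assume "xs \<in> ob (vTr C)" "ys \<in> ob (vTr C)" and M: "M \<in> hom (vTr C) xs ys"
    then have "M \<in> hom H.SC (map ic xs) (map ic ys)" using hom by (simp add: hTr_eq ob_v)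
    then obtain A where A: "M = H.matc (map ic xs) (map ic ys) A" unfolding H.hom_SC by auto
    show "incl_mor C xs ys M = M"
      unfolding incl_mor_def A H.matc_def incl length_map
      by (rule mat_cong) (simp add: coset_rep subspace_hTr_rels)
  next
    fix ys assume "ys \<in> ob (hTr C)"
    then have ys: "ys \<in> lists hX" by (simp add: hTr_eq H.ob_SC)
    obtain zs f where zs: "zs \<in> lists (?B \<inter> hX)" and f: "is_iso H.SC zs ys f"
      using H.iso_if_splits[OF ys, of ?B] splits ys by blast
    define xs where "xs = map (\<lambda>(k, c, f). (k, c)) zs"
    have "xs \<in> lists (UNIV \<times> obj C)" using zs by (auto simp: xs_def)
    moreover have "map ic xs = zs"
      using zs by (auto simp: xs_def ic_def intro!: map_idI)
    ultimately show "\<exists>x\<in>ob (vTr C). \<exists>f. is_iso (hTr C) (incl_ob C x) ys f"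
      using f by (auto simp: ob_v incl hTr_eq)
  qed
qed

section \<open>Isomorphisms in the horizontal trace\<close>

lemma hTr_rels_shift: "hTr_rels C (k, c, f) (l, d, g) = hTr_rels C (k', c, f) (l', d, g)"
  by (simp add: hTr_rels_def)

lemma hmult_id1:
  assumes "arr C c c g h \<rho>" "arr C c c f g \<sigma>"
  shows "hmult (id1 C c, \<rho>) (id1 C c, \<sigma>) = (id1 C c, \<rho> \<cdot> \<sigma>)"
proof -
  have "c \<in> obj C" using cells1_obj arrD(1)[OF assms(1)] by blast
  then show ?thesis
    by (simp add: hmult_def hcomp_id1[OF assms(1)] id1_hcomp[OF assms(2)] id1_comp1[OF id1_cell])
qed

text \<open>A decomposition of an endo-1-morphism in the 2-category gives one in the horizontal trace.
  That the composites \<open>P i \<cdot> Q j\<close> for \<open>i \<noteq> j\<close> vanish and that the \<open>Q i \<cdot> P i\<close> add up to the identity is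
  only required up to the relations of the trace.\<close>

lemma hTr_decomposition:
  assumes I: "finite I" and f: "f \<in> cells1 C c c"
    and P: "\<And>i. i \<in> I \<Longrightarrow> arr C c c f (g i) (P i)" "\<And>i. i \<in> I \<Longrightarrow> P i \<in> homog C (\<delta> i)"
    and Q: "\<And>i. i \<in> I \<Longrightarrow> arr C c c (g i) f (Q i)" "\<And>i. i \<in> I \<Longrightarrow> Q i \<in> homog C (- \<delta> i)"
    and PQ: "\<And>i. i \<in> I \<Longrightarrow> P i \<cdot> Q i = \<iota> (g i)"
    and PQ0: "\<And>i j. i \<in> I \<Longrightarrow> j \<in> I \<Longrightarrow> i \<noteq> j \<Longrightarrow>
      basis (id1 C c, P i \<cdot> Q j) \<in> hTr_rels C (0, c, g j) (0, c, g i)"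
    and QP: "(\<Sum>i\<in>I. basis (id1 C c, Q i \<cdot> P i)) - basis (id1 C c, \<iota> f)
      \<in> hTr_rels C (0, c, f) (0, c, f)"
  shows "H.is_sum_of (k, c, f) I (\<lambda>i. (k + \<delta> i, c, g i)) (\<lambda>i. basis (id1 C c, P i)) (\<lambda>i. basis (id1 C c, Q i))"
proof -
  have c: "c \<in> obj C" using cells1_obj[OF f] by blast
  have g: "g i \<in> cells1 C c c" if "i \<in> I" for i using arrD(2)[OF P(1)[OF that]] .
  show ?thesis
    unfolding H.is_sum_of_def
  proof (intro conjI ballI)
    fix i assume i: "i \<in> I"
    show "(k + \<delta> i, c, g i) \<in> hX" using c g[OF i] by (simp add: hX_def)
    show "basis (id1 C c, P i) \<in> H.Sg (k, c, f) (k + \<delta> i, c, g i)"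
      using P[OF i] by (intro free_vs.span_base imageI)
        (simp add: hTr_gens_iff f g[OF i] id1_cell[OF c] id1_comp1[OF f] comp1_id1[OF g[OF i]])
    show "basis (id1 C c, Q i) \<in> H.Sg (k + \<delta> i, c, g i) (k, c, f)"
      using Q[OF i] by (intro free_vs.span_base imageI)
        (simp add: hTr_gens_iff f g[OF i] id1_cell[OF c] id1_comp1[OF g[OF i]] comp1_id1[OF f])
  next
    fix i j assume ij: "i \<in> I" "j \<in> I"
    show "bilin_ext hmult (basis (id1 C c, P i)) (basis (id1 C c, Q j))
        - (if i = j then basis (hone (k + \<delta> i, c, g i)) else 0)
        \<in> hTr_rels C (k + \<delta> j, c, g j) (k + \<delta> i, c, g i)"
    proof (cases "i = j")
      case True
      then show ?thesis
        using ij by (simp add: hmult_id1[OF P(1) Q(1)] PQ hone_def free_vs.subspace_0 subspace_hTr_rels)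
    next
      case False
      then show ?thesis
        using PQ0[OF ij] hTr_rels_shift[of "k + \<delta> j" c "g j" "k + \<delta> i" c "g i" 0 0] ij
        by (simp add: hmult_id1[OF P(1) Q(1)])
    qed
  next
    have "(\<Sum>i\<in>I. bilin_ext hmult (basis (id1 C c, Q i)) (basis (id1 C c, P i)))
        = (\<Sum>i\<in>I. basis (id1 C c, Q i \<cdot> P i))"
      by (intro sum.cong refl) (simp add: hmult_id1[OF Q(1) P(1)])
    then show "(\<Sum>i\<in>I. bilin_ext hmult (basis (id1 C c, Q i)) (basis (id1 C c, P i)))
        - basis (hone (k, c, f)) \<in> hTr_rels C (k, c, f) (k, c, f)"
      using QP hTr_rels_shift[of k c f k c f 0 0] by (simp add: hone_def)
  qed (use I f c in \<open>auto simp: hX_def\<close>)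
qed

text \<open>If \<open>F : c \<rightarrow> d\<close> has a left adjoint \<open>E\<close>, then \<open>F w\<close> and \<open>w F\<close> are isomorphic in the horizontal
  trace for all \<open>w : d \<rightarrow> c\<close>. The isomorphism \<open>w F \<rightarrow> F w\<close> is the class of \<open>(F, id)\<close>, its inverse the
  class of \<open>E\<close> with \<open>E F w \<rightarrow> w \<rightarrow> w F E\<close>. The composites are the classes of 2-morphisms that factor
  through counit and unit; moving these factors around the annulus turns them into zigzags.\<close>

lemma hTr_rotate:
  assumes F: "F \<in> cells1 C c d" and E: "E \<in> cells1 C d c" and w: "w \<in> cells1 C d c"
    and \<eta>: "arr C d d (id1 C d) (F \<odot> E) \<eta>" and \<kappa>: "arr C c c (E \<odot> F) (id1 C c) \<kappa>"
    and zigzag: "(\<iota> F \<ast> \<kappa>) \<cdot> (\<eta> \<ast> \<iota> F) = \<iota> F"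
    and deg: "\<eta> \<in> homog C n" "\<kappa> \<in> homog C (- n)"
  shows "\<exists>P Q. H.is_sum_of (k, d, F \<odot> w) {()} (\<lambda>_. (k, c, w \<odot> F)) P Q"
proof -
  have c: "c \<in> obj C" and d: "d \<in> obj C" using cells1_obj[OF F] by auto
  note [simp] = comp1_assoc
  have wF: "w \<odot> F \<in> cells1 C c c" and Fw: "F \<odot> w \<in> cells1 C d d" and FwF: "F \<odot> w \<odot> F \<in> cells1 C c d"
    and EF: "E \<odot> F \<in> cells1 C c c" and FE: "F \<odot> E \<in> cells1 C d d"
    using F E w by (auto intro: comp1_cell)
  note i = id2_arr[OF F] id2_arr[OF E] id2_arr[OF w]
  define \<rho> where "\<rho> = (\<iota> w \<ast> \<eta>) \<cdot> (\<kappa> \<ast> \<iota> w)"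
  have w\<eta>: "arr C d c w (w \<odot> F \<odot> E) (\<iota> w \<ast> \<eta>)"
    using hcomp_arr[OF i(3) \<eta>] by (simp add: comp1_id1[OF w])
  have \<kappa>w: "arr C d c (E \<odot> F \<odot> w) w (\<kappa> \<ast> \<iota> w)"
    using hcomp_arr[OF \<kappa> i(3)] by (simp add: id1_comp1[OF w])
  have \<rho>: "arr C d c (E \<odot> F \<odot> w) (w \<odot> F \<odot> E) \<rho>"
    unfolding \<rho>_def by (rule vcomp_arr[OF w\<eta> \<kappa>w])
  have "\<rho> \<in> homog C ((0 + n) + (- n + 0))"
    unfolding \<rho>_def
    by (rule vcomp_homog[OF w\<eta> \<kappa>w hcomp_homog[OF i(3) \<eta> id2_homog[OF w] deg(1)]
          hcomp_homog[OF \<kappa> i(3) deg(2) id2_homog[OF w]]])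
  then have \<rho>0: "\<rho> \<in> homog C 0" by simp
  have zig_w: "((\<iota> F \<ast> \<kappa>) \<ast> \<iota> w) \<cdot> ((\<eta> \<ast> \<iota> F) \<ast> \<iota> w) = \<iota> (F \<odot> w)"
    and w_zig: "(\<iota> w \<ast> \<iota> F \<ast> \<kappa>) \<cdot> (\<iota> w \<ast> \<eta> \<ast> \<iota> F) = \<iota> (w \<odot> F)"
  proof -
    have a: "arr C c d (F \<odot> E \<odot> F) F (\<iota> F \<ast> \<kappa>)" "arr C c d F (F \<odot> E \<odot> F) (\<eta> \<ast> \<iota> F)"
      using hcomp_arr[OF i(1) \<kappa>] hcomp_arr[OF \<eta> i(1)] by (simp_all add: comp1_id1[OF F] id1_comp1[OF F])
    show "((\<iota> F \<ast> \<kappa>) \<ast> \<iota> w) \<cdot> ((\<eta> \<ast> \<iota> F) \<ast> \<iota> w) = \<iota> (F \<odot> w)"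
      using whisker_right[OF a w] by (simp add: zigzag hcomp_id2[OF F w])
    show "(\<iota> w \<ast> \<iota> F \<ast> \<kappa>) \<cdot> (\<iota> w \<ast> \<eta> \<ast> \<iota> F) = \<iota> (w \<odot> F)"
      using whisker_left[OF w a] by (simp add: zigzag hcomp_id2[OF w F])
  qed
  have "bilin_ext hmult (basis (E, \<rho>)) (basis (F, \<iota> (F \<odot> w \<odot> F))) - basis (hone (k, c, w \<odot> F))
      \<in> hTr_rels C (k, c, w \<odot> F) (k, c, w \<odot> F)"
  proof -
    have \<rho>F: "arr C c c (E \<odot> F \<odot> w \<odot> F) (w \<odot> F \<odot> E \<odot> F) (\<rho> \<ast> \<iota> F)"
      using hcomp_arr[OF \<rho> i(1)] by simp
    have "hmult (E, \<rho>) (F, \<iota> (F \<odot> w \<odot> F)) = (E \<odot> F, \<rho> \<ast> \<iota> F)"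
      using vcomp_id2[OF \<rho>F] by (simp add: hmult_def hcomp_id2[OF E FwF])
    also have "\<rho> \<ast> \<iota> F = (\<iota> w \<ast> \<eta> \<ast> \<iota> F) \<cdot> (\<kappa> \<ast> \<iota> (w \<odot> F))"
      by (simp add: \<rho>_def whisker_right[OF w\<eta> \<kappa>w F] hcomp_assoc[OF i(3) \<eta> i(1)]
          hcomp_assoc[OF \<kappa> i(3,1)] hcomp_id2[OF w F])
    finally have 1: "hmult (E, \<rho>) (F, \<iota> (F \<odot> w \<odot> F)) = (E \<odot> F, (\<iota> w \<ast> \<eta> \<ast> \<iota> F) \<cdot> (\<kappa> \<ast> \<iota> (w \<odot> F)))" .
    have 2: "hone (k, c, w \<odot> F) = (id1 C c, (\<iota> (w \<odot> F) \<ast> \<kappa>) \<cdot> (\<iota> w \<ast> \<eta> \<ast> \<iota> F))"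
      using w_zig hcomp_assoc[OF i(3,1) \<kappa>] by (simp add: hone_def hcomp_id2[OF w F])
    have "arr C c c (id1 C c \<odot> (w \<odot> F)) ((w \<odot> F) \<odot> E \<odot> F) (\<iota> w \<ast> \<eta> \<ast> \<iota> F)"
      using hcomp_arr[OF i(3) hcomp_arr[OF \<eta> i(1)]] id1_comp1[OF wF] by (simp add: id1_comp1[OF F])
    from htraceI[OF wF wF \<kappa> this, of k k] show ?thesis
      unfolding bilin_ext_basis 1 2 by (rule hTr_relsI)
  qed
  moreover have "bilin_ext hmult (basis (F, \<iota> (F \<odot> w \<odot> F))) (basis (E, \<rho>)) - basis (hone (k, d, F \<odot> w))
      \<in> hTr_rels C (k, d, F \<odot> w) (k, d, F \<odot> w)"
  proof -
    have F\<rho>: "arr C d d (F \<odot> E \<odot> F \<odot> w) (F \<odot> w \<odot> F \<odot> E) (\<iota> F \<ast> \<rho>)"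
      using hcomp_arr[OF i(1) \<rho>] by simp
    have "hmult (F, \<iota> (F \<odot> w \<odot> F)) (E, \<rho>) = (F \<odot> E, \<iota> F \<ast> \<rho>)"
      using id2_vcomp[OF F\<rho>] hcomp_id2[OF FwF E] by (simp add: hmult_def)
    also have "\<iota> F \<ast> \<rho> = (\<iota> (F \<odot> w) \<ast> \<eta>) \<cdot> (\<iota> F \<ast> \<kappa> \<ast> \<iota> w)"
      using hcomp_assoc[OF i(1,3) \<eta>] by (simp add: \<rho>_def whisker_left[OF F w\<eta> \<kappa>w] hcomp_id2[OF F w])
    finally have 1: "hmult (F, \<iota> (F \<odot> w \<odot> F)) (E, \<rho>) = (F \<odot> E, (\<iota> (F \<odot> w) \<ast> \<eta>) \<cdot> (\<iota> F \<ast> \<kappa> \<ast> \<iota> w))" .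
    have 2: "hone (k, d, F \<odot> w) = (id1 C d, (\<iota> F \<ast> \<kappa> \<ast> \<iota> w) \<cdot> (\<eta> \<ast> \<iota> (F \<odot> w)))"
      using zig_w hcomp_assoc[OF i(1) \<kappa> i(3)] hcomp_assoc[OF \<eta> i(1,3)]
      by (simp add: hone_def hcomp_id2[OF F w])
    have "arr C d d ((F \<odot> E) \<odot> (F \<odot> w)) ((F \<odot> w) \<odot> id1 C d) (\<iota> F \<ast> \<kappa> \<ast> \<iota> w)"
      using hcomp_arr[OF i(1) hcomp_arr[OF \<kappa> i(3)]] by (simp add: id1_comp1[OF w] comp1_id1[OF w])
    from htraceI[OF Fw Fw \<eta> this, of k k]
    have "basis (hone (k, d, F \<odot> w)) - bilin_ext hmult (basis (F, \<iota> (F \<odot> w \<odot> F))) (basis (E, \<rho>))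
        \<in> hTr_rels C (k, d, F \<odot> w) (k, d, F \<odot> w)"
      unfolding bilin_ext_basis 1 2 by (rule hTr_relsI)
    from free_vs.subspace_neg[OF subspace_hTr_rels this] show ?thesis by simp
  qed
  moreover have "basis (E, \<rho>) \<in> H.Sg (k, d, F \<odot> w) (k, c, w \<odot> F)"
    using \<rho> \<rho>0 by (intro free_vs.span_base imageI) (simp add: hTr_gens_iff Fw wF E)
  moreover have "basis (F, \<iota> (F \<odot> w \<odot> F)) \<in> H.Sg (k, c, w \<odot> F) (k, d, F \<odot> w)"
    using id2_arr[OF FwF] id2_homog[OF FwF]
    by (intro free_vs.span_base imageI) (simp add: hTr_gens_iff Fw wF F)
  ultimately have "H.is_sum_of (k, d, F \<odot> w) {()} (\<lambda>_. (k, c, w \<odot> F))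
      (\<lambda>_. basis (E, \<rho>)) (\<lambda>_. basis (F, \<iota> (F \<odot> w \<odot> F)))"
    unfolding H.is_sum_of_def using c d wF Fw by (simp add: hX_def)
  then show ?thesis by blast
qed

end

section \<open>Diagrams modulo the relations\<close>

lemma length_add_root [simp]: "length (add_root s i a) = length a"
  by (simp add: add_root_def)

lemma nth_add_root:
  "1 \<le> i \<Longrightarrow> k < length a \<Longrightarrow>
    add_root s i a ! k = a ! k + (if k = i - 1 then s else 0) - (if k = i then s else 0)"
  by (auto simp: add_root_def nth_list_update)

lemma add_root_commute:
  assumes "1 \<le> i" "1 \<le> j"
  shows "add_root s i (add_root t j a) = add_root t j (add_root s i a)"
  using assms
  by (intro nth_equalityI) (simp_all add: nth_add_root)

lemma add_root_inverse:
  assumes "1 \<le> i" "t = - s"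
  shows "add_root s i (add_root t i a) = a"
  using assms by (intro nth_equalityI) (simp_all add: nth_add_root)

lemma wt_append: "wt (u @ v) a = wt u (wt v a)"
proof (induction u)
  case (Cons x u) then show ?case by (cases x) simp_all
qed simp

lemma length_wt [simp]: "length (wt w a) = length a"
proof (induction w)
  case (Cons x u) then show ?case by (cases x) simp_all
qed simp

lemma wt_weights [simp]: "wt w a \<in> weights m \<longleftrightarrow> a \<in> weights m"
  by (simp add: weights_def)

lemma words_append [simp]: "u @ v \<in> words m \<longleftrightarrow> u \<in> words m \<and> v \<in> words m"
  by (auto simp: words_def)

lemma words_Cons: "x # v \<in> words m \<longleftrightarrow> node x \<in> {1..<m} \<and> v \<in> words m"
  by (auto simp: words_def)

lemma words_Nil [simp]: "[] \<in> words m"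
  by (simp add: words_def)

lemma gen_ok_words: "gen_ok m a g \<Longrightarrow> gsrc g \<in> words m" "gen_ok m a g \<Longrightarrow> gtgt g \<in> words m"
  by (cases g; simp add: words_def)+

lemma wt_gen: "gen_ok m b g \<Longrightarrow> wt (gtgt g) a = wt (gsrc g) a"
  by (cases g) (auto simp: words_Cons add_root_inverse add_root_commute)

lemma is_diagram_words: "is_diagram m a u v D \<Longrightarrow> u \<in> words m \<and> v \<in> words m"
  by (induction m a u v D rule: is_diagram.induct) (auto dest: gen_ok_words)

lemma is_diagram_wt: "is_diagram m a u v D \<Longrightarrow> wt v a = wt u a"
proof (induction m a u v D rule: is_diagram.induct)
  case (2 m a u v l g r D)
  then have "wt (l @ gsrc g @ r) a = wt u a" and "gen_ok m (wt r a) g" and v: "v = l @ gtgt g @ r"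
    by simp_all
  then show ?case by (simp add: v wt_append wt_gen[of m "wt r a"])
qed simp

lemma is_diagram_append:
  "is_diagram m a u w Q \<Longrightarrow> is_diagram m a w v P \<Longrightarrow> is_diagram m a u v (P @ Q)"
  by (induction m a w v P rule: is_diagram.induct) (auto dest: is_diagram_words)

text \<open>The whiskering of a diagram by words on both sides.\<close>

definition whd :: "word \<Rightarrow> word \<Rightarrow> diagram \<Rightarrow> diagram" where
  "whd l r = map (\<lambda>(l', g, r'). (l @ l', g, r' @ r))"

lemma whd_simps [simp]: "whd l r [] = []" "whd l r ((l', g, r') # D) = (l @ l', g, r' @ r) # whd l r D"
  "whd l r (P @ Q) = whd l r P @ whd l r Q"
  by (simp_all add: whd_def)

lemma whd_whd: "whd l r (whd l' r' D) = whd (l @ l') (r' @ r) D"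
  by (induction D) (auto simp: whd_def)

lemma whd_Nil [simp]: "whd [] [] D = D"
  by (induction D) (auto simp: whd_def)

lemma is_diagram_whd:
  "is_diagram m (wt r a) u v D \<Longrightarrow> l \<in> words m \<Longrightarrow> r \<in> words m \<Longrightarrow>
    is_diagram m a (l @ u @ r) (l @ v @ r) (whd l r D)"
  by (induction m "wt r a" u v D rule: is_diagram.induct) (auto simp: wt_append)

lemma deg_append: "deg a (P @ Q) = deg a P + deg a Q"
  by (simp add: deg_def)

lemma deg_whd: "deg a (whd l r D) = deg (wt r a) D"
  by (induction D) (auto simp: deg_def wt_append)

lemma whisker_basis [simp]: "whisker l r (basis D) = basis (whd l r D)"
  by (simp add: whisker_def whd_def)

lemma lin_whisker: "lin (whisker l r)"
  unfolding whisker_def by (rule lin_lin_ext)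

lemma whisker_whisker: "whisker l r (whisker l' r' x) = whisker (l @ l') (r' @ r) x"
  by (rule lin_eqI[OF lin_comp[OF lin_whisker lin_whisker] lin_whisker]) (simp add: whd_whd)

lemma whisker_Nil: "whisker [] [] x = x"
  by (rule lin_eqI[OF lin_whisker lin_ident]) simp

lemma vmul_assoc: "vmul (vmul x y) z = vmul x (vmul y z)"
proof (rule lin_eqI[OF lin_comp[OF lin_bilin_left lin_bilin_left] lin_bilin_left])
  fix P show "vmul (vmul (basis P) y) z = vmul (basis P) (vmul y z)"
  proof (rule lin_eqI[OF lin_comp[OF lin_bilin_left lin_bilin_right] lin_comp[OF lin_bilin_right lin_bilin_left]])
    fix Q show "vmul (vmul (basis P) (basis Q)) z = vmul (basis P) (vmul (basis Q) z)"
      by (rule lin_eqI[OF lin_bilin_right lin_comp[OF lin_bilin_right lin_bilin_right]]) simp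
  qed
qed

lemma vmul_Nil [simp]: "vmul (basis []) x = x" "vmul x (basis []) = x"
  by (rule lin_eqI[OF lin_bilin_right lin_ident], simp)
    (rule lin_eqI[OF lin_bilin_left lin_ident], simp)

lemma whisker_vmul: "whisker l r (vmul x y) = vmul (whisker l r x) (whisker l r y)"
proof (rule lin_eqI[OF lin_comp[OF lin_whisker lin_bilin_left] lin_comp[OF lin_bilin_left lin_whisker]])
  fix P show "whisker l r (vmul (basis P) y) = vmul (whisker l r (basis P)) (whisker l r y)"
    by (rule lin_eqI[OF lin_comp[OF lin_whisker lin_bilin_right] lin_comp[OF lin_bilin_right lin_whisker]])
      simp
qed

lemma lin_hmul_left: "lin (\<lambda>x. hmul u v' x y)"
  unfolding hmul_def by (rule lin_comp[OF lin_bilin_left lin_whisker])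

lemma lin_hmul_right: "lin (hmul u v' x)"
  unfolding hmul_def by (rule lin_comp[OF lin_bilin_right lin_whisker])

lemma hmul_assoc: "hmul (u @ v) w' (hmul u v' x y) z = hmul u (v' @ w') x (hmul v w' y z)"
  by (simp add: hmul_def whisker_vmul whisker_whisker vmul_assoc)

text \<open>The linear combinations of diagrams \<open>u \<rightarrow> v\<close> starting at \<open>a\<close>, and the homogeneous ones of degree
  \<open>n\<close>.\<close>

abbreviation Hsp :: "nat \<Rightarrow> weight \<Rightarrow> word \<Rightarrow> word \<Rightarrow> lindiag set" where
  "Hsp m a u v \<equiv> free_vs.span (basis ` diagrams m a u v)"

abbreviation Hdeg :: "nat \<Rightarrow> int \<Rightarrow> weight \<Rightarrow> word \<Rightarrow> word \<Rightarrow> lindiag set" where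
  "Hdeg m n a u v \<equiv> free_vs.span (basis ` diagrams_of_deg m a n u v)"

lemma diagrams_iff [simp]: "D \<in> diagrams m a u v \<longleftrightarrow> is_diagram m a u v D"
  by (simp add: diagrams_def)

lemma diagrams_of_deg_iff [simp]:
  "D \<in> diagrams_of_deg m a n u v \<longleftrightarrow> is_diagram m a u v D \<and> deg a D = n"
  by (simp add: diagrams_of_deg_def)

lemma Hsp_basis: "is_diagram m a u v D \<Longrightarrow> basis D \<in> Hsp m a u v"
  by (simp add: free_vs.span_base)

lemma Hdeg_basis: "is_diagram m a u v D \<Longrightarrow> deg a D = n \<Longrightarrow> basis D \<in> Hdeg m n a u v"
  by (simp add: free_vs.span_base)

lemma Hdeg_Hsp: "x \<in> Hdeg m n a u v \<Longrightarrow> x \<in> Hsp m a u v"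
  using free_vs.span_mono[of "basis ` diagrams_of_deg m a n u v" "basis ` diagrams m a u v"]
  by (auto simp: image_subset_iff)

lemma vmul_Hsp: "y \<in> Hsp m a v w \<Longrightarrow> x \<in> Hsp m a u v \<Longrightarrow> vmul y x \<in> Hsp m a u w"
  by (rule bilin_into_subspace[OF free_vs.subspace_span])
    (auto intro!: Hsp_basis intro: is_diagram_append)

lemma vmul_Hdeg:
  "y \<in> Hdeg m n a v w \<Longrightarrow> x \<in> Hdeg m n' a u v \<Longrightarrow> vmul y x \<in> Hdeg m (n + n') a u w"
  by (rule bilin_into_subspace[OF free_vs.subspace_span])
    (auto intro!: Hdeg_basis simp: deg_append intro: is_diagram_append)

lemma whisker_Hsp:
  assumes "x \<in> Hsp m (wt r a) u v" "l \<in> words m" "r \<in> words m"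
  shows "whisker l r x \<in> Hsp m a (l @ u @ r) (l @ v @ r)"
  by (rule lin_into_span[OF lin_whisker free_vs.subspace_span assms(1)])
    (use assms(2,3) in \<open>auto intro!: Hsp_basis is_diagram_whd\<close>)

lemma whisker_Hdeg:
  assumes "x \<in> Hdeg m n (wt r a) u v" "l \<in> words m" "r \<in> words m"
  shows "whisker l r x \<in> Hdeg m n a (l @ u @ r) (l @ v @ r)"
  by (rule lin_into_span[OF lin_whisker free_vs.subspace_span assms(1)])
    (use assms(2,3) in \<open>auto intro!: Hdeg_basis is_diagram_whd simp: deg_whd\<close>)

lemma hmul_Hsp:
  assumes "x \<in> Hsp m b u u'" "y \<in> Hsp m a v v'" "wt v' a = b"
    "u \<in> words m" "v' \<in> words m"
  shows "hmul u v' x y \<in> Hsp m a (u @ v) (u' @ v')"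
proof -
  have "whisker [] v' x \<in> Hsp m a (u @ v') (u' @ v')" "whisker u [] y \<in> Hsp m a (u @ v) (u @ v')"
    using whisker_Hsp[of x m v' a u u' "[]"] whisker_Hsp[of y m "[]" a v v' u] assms by simp_all
  then show ?thesis unfolding hmul_def by (rule vmul_Hsp)
qed

lemma hmul_Hdeg:
  assumes "x \<in> Hdeg m n b u u'" "y \<in> Hdeg m n' a v v'" "wt v' a = b"
    "u \<in> words m" "v' \<in> words m"
  shows "hmul u v' x y \<in> Hdeg m (n + n') a (u @ v) (u' @ v')"
proof -
  have "whisker [] v' x \<in> Hdeg m n a (u @ v') (u' @ v')" "whisker u [] y \<in> Hdeg m n' a (u @ v) (u @ v')"
    using whisker_Hdeg[of x m v' a n u u' "[]"] whisker_Hdeg[of y m "[]" a n' v v' u] assms by simp_all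
  then show ?thesis unfolding hmul_def by (rule vmul_Hdeg)
qed

lemma is_diagram_eta_dots:
  "i \<in> {1..<m} \<Longrightarrow> is_diagram m a [] [\<F> i, \<E> i] (eta_dots i k)"
  by (induction k) (auto simp: eta_dots_def words_Cons)

lemma is_diagram_dots:
  "i \<in> {1..<m} \<Longrightarrow> is_diagram m a [\<E> i, \<F> i] [\<E> i, \<F> i] (replicate k ([], Dot i, [\<F> i]))"
  by (induction k) (auto simp: words_Cons)

lemma is_diagram_kappa_dots:
  "i \<in> {1..<m} \<Longrightarrow> is_diagram m a [\<E> i, \<F> i] [] (kappa_dots i k)"
  by (simp add: kappa_dots_def is_diagram_dots words_Cons)

lemma is_diagram_sigma:
  "i \<in> {1..<m} \<Longrightarrow> j \<in> {1..<m} \<Longrightarrow> is_diagram m a [\<E> i, \<F> j] [\<F> j, \<E> i] (sigma i j)"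
  by (simp add: sigma_def words_Cons)

lemma is_diagram_snoc:
  "gsrc g = u \<Longrightarrow> is_diagram m a (gtgt g) v P \<Longrightarrow> gen_ok m a g \<Longrightarrow> is_diagram m a u v (P @ [([], g, [])])"
  by (rule is_diagram_append[of _ _ _ "gtgt g"]) (auto dest: gen_ok_words)

lemma relator_Hsp: "relator m a u v x \<Longrightarrow> x \<in> Hsp m a u v"
proof (induction rule: relator.induct)
  case (interchange a w h g)
  then show ?case
    by (intro free_vs.span_diff Hsp_basis)
      (auto simp: wt_append wt_gen[of m a h] dest: gen_ok_words)
qed (auto intro!: free_vs.span_diff free_vs.span_add free_vs.span_sum free_vs.span_scale free_vs.span_zero
    Hsp_basis is_diagram_snoc is_diagram_kappa_dots is_diagram_sigma is_diagram_eta_dots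
    simp: words_Cons)

section \<open>The ideal of relations and the interchange law\<close>

text \<open>The relations imposed before closing up under both compositions.\<close>

definition base_rel :: "nat \<Rightarrow> weight set \<Rightarrow> weight \<Rightarrow> word \<Rightarrow> word \<Rightarrow> lindiag \<Rightarrow> bool" where
  "base_rel m K a u v x \<longleftrightarrow> relator m a u v x \<or> a \<in> K \<and> u = [] \<and> v = [] \<and> x = basis []"

lemma base_rel_Hsp: "base_rel m K a u v x \<Longrightarrow> x \<in> Hsp m a u v"
  by (auto simp: base_rel_def relator_Hsp intro: Hsp_basis)

lemma subspace_ideal: "free_vs.subspace (ideal m K a u v)"
  by (simp add: ideal_def free_vs.subspace_span)

lemma ideal_eq: "ideal m K a u v = free_vs.span
     {vmul (basis P) (vmul (whisker l r x) (basis Q)) | P Q l r x u' v'.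
        l \<in> words m \<and> r \<in> words m \<and> base_rel m K (wt r a) u' v' x \<and>
        is_diagram m a u (l @ u' @ r) Q \<and> is_diagram m a (l @ v' @ r) v P}"
  by (simp add: ideal_def base_rel_def)

lemma ideal_gen:
  assumes "base_rel m K (wt r a) u' v' x" "l \<in> words m" "r \<in> words m"
    "is_diagram m a u (l @ u' @ r) Q" "is_diagram m a (l @ v' @ r) v P"
  shows "vmul (basis P) (vmul (whisker l r x) (basis Q)) \<in> ideal m K a u v"
  unfolding ideal_eq using assms by (intro free_vs.span_base) blast

lemma ideal_base:
  assumes "base_rel m K (wt r a) u v x" "l @ u @ r \<in> words m" "l @ v @ r \<in> words m"
  shows "whisker l r x \<in> ideal m K a (l @ u @ r) (l @ v @ r)"
  using ideal_gen[OF assms(1), of l "l @ u @ r" "[]" "l @ v @ r" "[]"] assms by simp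

text \<open>Linear maps that send the spanning set of an ideal into a subspace do so with the ideal.\<close>

lemma lin_ideal:
  assumes "lin f" "free_vs.subspace T" "y \<in> ideal m K a u v"
    and "\<And>P Q l r x u' v'. base_rel m K (wt r a) u' v' x \<Longrightarrow> l \<in> words m \<Longrightarrow> r \<in> words m \<Longrightarrow>
      is_diagram m a u (l @ u' @ r) Q \<Longrightarrow> is_diagram m a (l @ v' @ r) v P \<Longrightarrow>
      f (vmul (basis P) (vmul (whisker l r x) (basis Q))) \<in> T"
  shows "f y \<in> T"
  by (rule lin_into_span[OF assms(1,2) assms(3)[unfolded ideal_eq]]) (use assms(4) in blast)

lemma ideal_Hsp:
  assumes "y \<in> ideal m K a u v"
  shows "y \<in> Hsp m a u v"
  by (rule lin_ideal[OF lin_ident free_vs.subspace_span assms])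
    (rule vmul_Hsp[OF Hsp_basis vmul_Hsp[OF whisker_Hsp[OF base_rel_Hsp] Hsp_basis]])

lemma ideal_vmul_left:
  assumes "y \<in> Hsp m a v w" "x \<in> ideal m K a u v"
  shows "vmul y x \<in> ideal m K a u w"
proof (rule lin_into_span[OF lin_bilin_left subspace_ideal assms(1)])
  fix b assume "b \<in> basis ` diagrams m a v w"
  then obtain R where b: "b = basis R" and R: "is_diagram m a v w R" by auto
  show "vmul b x \<in> ideal m K a u w"
  proof (rule lin_ideal[OF lin_bilin_right subspace_ideal assms(2)])
    fix P Q l r x u' v'
    assume *: "base_rel m K (wt r a) u' v' x" "l \<in> words m" "r \<in> words m"
      "is_diagram m a u (l @ u' @ r) Q" "is_diagram m a (l @ v' @ r) v P"
    from ideal_gen[OF *(1-4) is_diagram_append[OF *(5) R]]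
    show "vmul b (vmul (basis P) (vmul (whisker l r x) (basis Q))) \<in> ideal m K a u w"
      by (simp add: b vmul_assoc[symmetric])
  qed
qed

lemma ideal_vmul_right:
  assumes "y \<in> ideal m K a v w" "x \<in> Hsp m a u v"
  shows "vmul y x \<in> ideal m K a u w"
proof (rule lin_into_span[OF lin_bilin_right subspace_ideal assms(2)])
  fix b assume "b \<in> basis ` diagrams m a u v"
  then obtain R where b: "b = basis R" and R: "is_diagram m a u v R" by auto
  show "vmul y b \<in> ideal m K a u w"
  proof (rule lin_ideal[OF lin_bilin_left subspace_ideal assms(1)])
    fix P Q l r x u' v'
    assume *: "base_rel m K (wt r a) u' v' x" "l \<in> words m" "r \<in> words m"
      "is_diagram m a v (l @ u' @ r) Q" "is_diagram m a (l @ v' @ r) w P"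
    from ideal_gen[OF *(1-3) is_diagram_append[OF R *(4)] *(5)]
    show "vmul (vmul (basis P) (vmul (whisker l r x) (basis Q))) b \<in> ideal m K a u w"
      by (simp add: b vmul_assoc)
  qed
qed

lemma ideal_whisker:
  assumes "y \<in> ideal m K (wt r a) u v" "l \<in> words m" "r \<in> words m"
  shows "whisker l r y \<in> ideal m K a (l @ u @ r) (l @ v @ r)"
proof (rule lin_ideal[OF lin_whisker subspace_ideal assms(1)])
  fix P Q l' r' x u' v'
  assume *: "base_rel m K (wt r' (wt r a)) u' v' x" "l' \<in> words m" "r' \<in> words m"
    "is_diagram m (wt r a) u (l' @ u' @ r') Q" "is_diagram m (wt r a) (l' @ v' @ r') v P"
  have "vmul (basis (whd l r P)) (vmul (whisker (l @ l') (r' @ r) x) (basis (whd l r Q)))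
      \<in> ideal m K a (l @ u @ r) (l @ v @ r)"
    using *(1-3) is_diagram_whd[OF *(4) assms(2,3)] is_diagram_whd[OF *(5) assms(2,3)] assms(2,3)
    by (intro ideal_gen) (auto simp: wt_append)
  then show "whisker l r (vmul (basis P) (vmul (whisker l' r' x) (basis Q)))
      \<in> ideal m K a (l @ u @ r) (l @ v @ r)"
    by (simp add: whisker_vmul whisker_whisker)
qed

lemma vmul_cong:
  assumes "y \<in> Hsp m a v w" "y - y' \<in> ideal m K a v w" "x' \<in> Hsp m a u v" "x - x' \<in> ideal m K a u v"
  shows "vmul y x - vmul y' x' \<in> ideal m K a u w"
proof -
  have "vmul y (x - x') + vmul (y - y') x' \<in> ideal m K a u w"
    by (intro free_vs.subspace_add[OF subspace_ideal] ideal_vmul_left[OF assms(1,4)]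
        ideal_vmul_right[OF assms(2,3)])
  then show ?thesis by (simp add: bilin_simps)
qed

lemma hmul_cong:
  assumes "x \<in> Hsp m b u u'" "x - x' \<in> ideal m K b u u'" "y' \<in> Hsp m a v v'" "y - y' \<in> ideal m K a v v'"
    and "wt v' a = b" "u \<in> words m" "v' \<in> words m"
  shows "hmul u v' x y - hmul u v' x' y' \<in> ideal m K a (u @ v) (u' @ v')"
  unfolding hmul_def
proof (rule vmul_cong)
  show "whisker [] v' x \<in> Hsp m a (u @ v') (u' @ v')"
    using whisker_Hsp[of x m v' a u u' "[]"] assms by simp
  show "whisker u [] y' \<in> Hsp m a (u @ v) (u @ v')"
    using whisker_Hsp[of y' m "[]" a v v' u] assms by simp
  show "whisker [] v' x - whisker [] v' x' \<in> ideal m K a (u @ v') (u' @ v')"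
    using ideal_whisker[of "x - x'" m K v' a u u' "[]"] assms by (simp add: lin_diff[OF lin_whisker])
  show "whisker u [] y - whisker u [] y' \<in> ideal m K a (u @ v) (u @ v')"
    using ideal_whisker[of "y - y'" m K "[]" a v v' u] assms by (simp add: lin_diff[OF lin_whisker])
qed

text \<open>The interchange law, first for two layers, then for a diagram and a layer, then for two
  diagrams and finally for linear combinations.\<close>

lemma interchange_layers:
  assumes a: "a \<in> weights m"
    and g: "is_diagram m (wt v a) u u' [(l, g, r)]" and h: "is_diagram m a v v' [(l', h, r')]"
  shows "basis (whd [] v' [(l, g, r)] @ whd u [] [(l', h, r')])
    - basis (whd u' [] [(l', h, r')] @ whd [] v [(l, g, r)]) \<in> ideal m K a (u @ v) (u' @ v')"
proof -
  have u: "u = l @ gsrc g @ r" "u' = l @ gtgt g @ r" and v: "v = l' @ gsrc h @ r'" "v' = l' @ gtgt h @ r'"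
    and g_ok: "gen_ok m (wt r (wt v a)) g" and h_ok: "gen_ok m (wt r' a) h"
    and W: "l \<in> words m" "r \<in> words m" "l' \<in> words m" "r' \<in> words m"
    using g h by auto
  let ?w = "r @ l'"
  have "relator m (wt r' a) (gsrc g @ ?w @ gsrc h) (gtgt g @ ?w @ gtgt h)
     (basis [([], g, ?w @ gtgt h), (gsrc g @ ?w, h, [])]
        - basis [(gtgt g @ ?w, h, []), ([], g, ?w @ gsrc h)])"
    using a g_ok h_ok W by (intro relator.interchange) (auto simp: wt_append v)
  then have "whisker l r' (basis [([], g, ?w @ gtgt h), (gsrc g @ ?w, h, [])]
        - basis [(gtgt g @ ?w, h, []), ([], g, ?w @ gsrc h)])
      \<in> ideal m K a (l @ (gsrc g @ ?w @ gsrc h) @ r') (l @ (gtgt g @ ?w @ gtgt h) @ r')"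
    using W gen_ok_words[OF g_ok] gen_ok_words[OF h_ok] by (intro ideal_base) (auto simp: base_rel_def)
  then show ?thesis by (simp add: lin_diff[OF lin_whisker] u v)
qed

lemma interchange_diagram_layer:
  assumes a: "a \<in> weights m"
    and h: "is_diagram m a v v' [L]"
  shows "is_diagram m (wt v a) u u' D \<Longrightarrow>
    basis (whd [] v' D @ whd u [] [L]) - basis (whd u' [] [L] @ whd [] v D) \<in> ideal m K a (u @ v) (u' @ v')"
proof (induction D arbitrary: u')
  case Nil
  then show ?case by (simp add: free_vs.subspace_0 subspace_ideal)
next
  case (Cons N D)
  obtain l g r where N: "N = (l, g, r)" by (cases N)
  let ?w = "l @ gsrc g @ r"
  have D: "is_diagram m (wt v a) u ?w D" and u': "u' = l @ gtgt g @ r" and g: "gen_ok m (wt r (wt v a)) g"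
    using Cons.prems by (simp_all add: N)
  have NN: "is_diagram m (wt v a) ?w u' [N]"
    using D u' g is_diagram_words[OF D] by (simp add: N)
  have W: "v \<in> words m" "v' \<in> words m" "u \<in> words m" "?w \<in> words m" "u' \<in> words m"
    using is_diagram_words[OF h] is_diagram_words[OF D] is_diagram_words[OF NN] by auto
  have "basis (whd [] v' [N]) \<in> Hsp m a (?w @ v') (u' @ v')"
    using is_diagram_whd[of m v' a ?w u' "[N]" "[]"] NN W is_diagram_wt[OF h]
    by (intro Hsp_basis) simp
  from ideal_vmul_left[OF this Cons.IH[OF D]]
  have 1: "basis (whd [] v' [N] @ whd [] v' D @ whd u [] [L]) - basis (whd [] v' [N] @ whd ?w [] [L] @ whd [] v D)
      \<in> ideal m K a (u @ v) (u' @ v')"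
    by (simp add: bilin_simps)
  obtain l' h' r' where L: "L = (l', h', r')" by (cases L)
  have "basis (whd [] v D) \<in> Hsp m a (u @ v) (?w @ v)"
    using is_diagram_whd[OF D, of "[]"] W by (intro Hsp_basis) simp
  from ideal_vmul_right[OF interchange_layers[OF a NN[unfolded N] h[unfolded L]] this]
  have 2: "basis ((whd [] v' [N] @ whd ?w [] [L]) @ whd [] v D) - basis ((whd u' [] [L] @ whd [] v [N]) @ whd [] v D)
      \<in> ideal m K a (u @ v) (u' @ v')"
    unfolding N L by (simp only: bilin_simps bilin_ext_basis)
  have "whd [] w (N # D) = whd [] w [N] @ whd [] w D" for w by (simp add: N)
  with free_vs.subspace_add[OF subspace_ideal 1 2] show ?case by simp
qed

lemma interchange_diagrams:
  assumes a: "a \<in> weights m" and D: "is_diagram m (wt v a) u u' D"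
  shows "is_diagram m a v v' D' \<Longrightarrow>
    basis (whd [] v' D @ whd u [] D') - basis (whd u' [] D' @ whd [] v D) \<in> ideal m K a (u @ v) (u' @ v')"
proof (induction D' arbitrary: v')
  case Nil
  then show ?case by (simp add: free_vs.subspace_0 subspace_ideal)
next
  case (Cons L D')
  obtain l h r where L: "L = (l, h, r)" by (cases L)
  let ?w = "l @ gsrc h @ r"
  have D': "is_diagram m a v ?w D'" and v': "v' = l @ gtgt h @ r" and h: "gen_ok m (wt r a) h"
    using Cons.prems by (simp_all add: L)
  have LL: "is_diagram m a ?w v' [L]"
    using D' v' h is_diagram_words[OF D'] by (simp add: L)
  have W: "v \<in> words m" "v' \<in> words m" "u \<in> words m" "?w \<in> words m" "u' \<in> words m"
    using is_diagram_words[OF D] is_diagram_words[OF D'] is_diagram_words[OF LL] by auto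
  have D2: "is_diagram m (wt ?w a) u u' D" using D is_diagram_wt[OF D'] by simp
  have "basis (whd u [] D') \<in> Hsp m a (u @ v) (u @ ?w)"
    using is_diagram_whd[of m "[]" a v ?w D' u] D' W by (intro Hsp_basis) simp
  from ideal_vmul_right[OF interchange_diagram_layer[OF a LL D2] this]
  have 1: "basis ((whd [] v' D @ whd u [] [L]) @ whd u [] D') - basis ((whd u' [] [L] @ whd [] ?w D) @ whd u [] D')
      \<in> ideal m K a (u @ v) (u' @ v')"
    by (simp only: bilin_simps bilin_ext_basis)
  have "basis (whd u' [] [L]) \<in> Hsp m a (u' @ ?w) (u' @ v')"
    using is_diagram_whd[of m "[]" a ?w v' "[L]" u'] LL W by (intro Hsp_basis) simp
  from ideal_vmul_left[OF this Cons.IH[OF D']]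
  have 2: "basis (whd u' [] [L] @ whd [] ?w D @ whd u [] D') - basis (whd u' [] [L] @ whd u' [] D' @ whd [] v D)
      \<in> ideal m K a (u @ v) (u' @ v')"
    by (simp only: bilin_simps bilin_ext_basis)
  have "whd w [] (L # D') = whd w [] [L] @ whd w [] D'" for w by (simp add: L)
  with free_vs.subspace_add[OF subspace_ideal 1 2[folded append_assoc]] show ?case by simp
qed

lemma interchange_lin:
  assumes a: "a \<in> weights m" and x: "x \<in> Hsp m (wt v a) u u'" and y: "y \<in> Hsp m a v v'"
  shows "vmul (whisker [] v' x) (whisker u [] y) - vmul (whisker u' [] y) (whisker [] v x)
    \<in> ideal m K a (u @ v) (u' @ v')"
proof (rule lin_into_span[OF _ subspace_ideal x])
  show "lin (\<lambda>x. vmul (whisker [] v' x) (whisker u [] y) - vmul (whisker u' [] y) (whisker [] v x))"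
    by (intro lin_minus lin_comp[OF lin_bilin_left lin_whisker] lin_comp[OF lin_bilin_right lin_whisker])
  fix b assume "b \<in> basis ` diagrams m (wt v a) u u'"
  then obtain D where b: "b = basis D" and D: "is_diagram m (wt v a) u u' D" by auto
  show "vmul (whisker [] v' b) (whisker u [] y) - vmul (whisker u' [] y) (whisker [] v b)
      \<in> ideal m K a (u @ v) (u' @ v')"
  proof (rule lin_into_span[OF _ subspace_ideal y])
    show "lin (\<lambda>y. vmul (whisker [] v' b) (whisker u [] y) - vmul (whisker u' [] y) (whisker [] v b))"
      by (intro lin_minus lin_comp[OF lin_bilin_left lin_whisker] lin_comp[OF lin_bilin_right lin_whisker])
  qed (use interchange_diagrams[OF a D] in \<open>auto simp: b\<close>)
qed

lemma hmul_interchange: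
  assumes a: "a \<in> weights m" and x: "x \<in> Hsp m b u u'" and x': "x' \<in> Hsp m b u' u''"
    and y: "y \<in> Hsp m a v v'" and y': "y' \<in> Hsp m a v' v''"
    and wt: "wt v' a = b" "wt v'' a = b"
    and W: "u \<in> words m" "u' \<in> words m" "v' \<in> words m" "v'' \<in> words m"
  shows "hmul u v'' (vmul x' x) (vmul y' y) - vmul (hmul u' v'' x' y') (hmul u v' x y)
    \<in> ideal m K a (u @ v) (u'' @ v'')"
proof -
  let ?A = "whisker [] v'' x'" and ?B = "whisker u [] y"
  have A: "?A \<in> Hsp m a (u' @ v'') (u'' @ v'')"
    using whisker_Hsp[of x' m v'' a u' u'' "[]"] x' wt W by simp
  have B: "?B \<in> Hsp m a (u @ v) (u @ v')"
    using whisker_Hsp[of y m "[]" a v v' u] y W by simp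
  have "vmul (whisker [] v'' x) (whisker u [] y') - vmul (whisker u' [] y') (whisker [] v' x)
      \<in> ideal m K a (u @ v') (u' @ v'')"
    using interchange_lin[OF a _ y', of x u u'] x wt by simp
  from ideal_vmul_left[OF A ideal_vmul_right[OF this B]]
  show ?thesis by (simp add: hmul_def whisker_vmul vmul_assoc bilin_simps)
qed

section \<open>The quotients of the Khovanov--Lauda 2-category are strict linear 2-categories\<close>

text \<open>The 2-morphism \<open>us \<rightarrow> vs\<close> between formal direct sums of words \<open>a \<rightarrow> b\<close> with matrix \<open>A\<close> of
  representatives.\<close>

definition cell :: "nat \<Rightarrow> weight set \<Rightarrow> weight \<Rightarrow> weight \<Rightarrow> word list \<Rightarrow> word list \<Rightarrow>
    (nat \<Rightarrow> nat \<Rightarrow> lindiag) \<Rightarrow> cell2" where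
  "cell m K a b us vs A = ((a, b, us), (a, b, vs),
     mat (length vs) (length us) (\<lambda>i j. coset (ideal m K a (us ! j) (vs ! i)) (A i j)))"

text \<open>All words in the list are 1-morphisms \<open>a \<rightarrow> b\<close>.\<close>

definition wds :: "nat \<Rightarrow> weight \<Rightarrow> weight \<Rightarrow> word list \<Rightarrow> bool" where
  "wds m a b us \<longleftrightarrow> a \<in> weights m \<and> b \<in> weights m \<and> (\<forall>w\<in>set us. w \<in> words m \<and> wt w a = b)"

text \<open>The entries of the matrix \<open>A\<close> are combinations of diagrams in \<open>S\<close>.\<close>

definition entries :: "(weight \<Rightarrow> word \<Rightarrow> word \<Rightarrow> diagram set) \<Rightarrow> weight \<Rightarrow> word list \<Rightarrow> word list \<Rightarrow>
    (nat \<Rightarrow> nat \<Rightarrow> lindiag) \<Rightarrow> bool" where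
  "entries S a us vs A \<longleftrightarrow> (\<forall>i<length vs. \<forall>j<length us.
     A i j \<in> free_vs.span (basis ` S a (us ! j) (vs ! i)))"

lemma cells1_iff: "(a', b', us) \<in> UQ_cells1 m a b \<longleftrightarrow> a' = a \<and> b' = b \<and> wds m a b us"
  by (auto simp: UQ_cells1_def wds_def)

lemma wds_nth: "wds m a b us \<Longrightarrow> i < length us \<Longrightarrow> us ! i \<in> words m \<and> wt (us ! i) a = b"
  by (simp add: wds_def)

lemma wds_weights: "wds m a b us \<Longrightarrow> a \<in> weights m \<and> b \<in> weights m"
  by (simp add: wds_def)

lemma entriesD: "entries S a us vs A \<Longrightarrow> i < length vs \<Longrightarrow> j < length us \<Longrightarrow>
    A i j \<in> free_vs.span (basis ` S a (us ! j) (vs ! i))"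
  by (simp add: entries_def)

lemma cell_eqI:
  assumes "\<And>i j. i < length vs \<Longrightarrow> j < length us \<Longrightarrow> A i j - B i j \<in> ideal m K a (us ! j) (vs ! i)"
  shows "cell m K a b us vs A = cell m K a b us vs B"
proof -
  have "mat (length vs) (length us) (\<lambda>i j. coset (ideal m K a (us ! j) (vs ! i)) (A i j))
      = mat (length vs) (length us) (\<lambda>i j. coset (ideal m K a (us ! j) (vs ! i)) (B i j))"
    using assms by (intro mat_cong) (simp add: coset_eq_iff subspace_ideal)
  then show ?thesis by (simp add: cell_def)
qed

lemma cell_cong:
  assumes "\<And>i j. i < length vs \<Longrightarrow> j < length us \<Longrightarrow> A i j = B i j"
  shows "cell m K a b us vs A = cell m K a b us vs B"
  using assms by (intro cell_eqI) (simp add: free_vs.subspace_0 subspace_ideal)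

lemma UQ_matrices_eq:
  "\<sigma> \<in> UQ_matrices m K S (a, b, us) (a', b', vs) \<longleftrightarrow> a' = a \<and> b' = b \<and> wds m a b us \<and> wds m a b vs \<and>
     (\<exists>A. \<sigma> = cell m K a b us vs A \<and> entries S a us vs A)" (is "?L \<longleftrightarrow> ?R")
proof
  assume ?L
  then obtain M where *: "\<sigma> = ((a, b, us), (a', b', vs), mat (length vs) (length us) M)"
    "a = a'" "b = b'" "wds m a b us" "wds m a b vs"
    and M: "\<forall>i<length vs. \<forall>j<length us.
      M i j \<in> coset (ideal m K a (us ! j) (vs ! i)) ` free_vs.span (basis ` S a (us ! j) (vs ! i))"
    unfolding UQ_matrices_def by (auto simp: cells1_iff)
  have "\<forall>i j. \<exists>x. i < length vs \<longrightarrow> j < length us \<longrightarrow> M i j = coset (ideal m K a (us ! j) (vs ! i)) x \<and>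
      x \<in> free_vs.span (basis ` S a (us ! j) (vs ! i))"
    using M by blast
  then obtain A where A: "\<And>i j. i < length vs \<Longrightarrow> j < length us \<Longrightarrow>
      M i j = coset (ideal m K a (us ! j) (vs ! i)) (A i j) \<and>
      A i j \<in> free_vs.span (basis ` S a (us ! j) (vs ! i))" by metis
  have "\<sigma> = cell m K a b us vs A" unfolding *(1) cell_def using A *(2,3) by (auto intro!: mat_cong)
  moreover have "entries S a us vs A" using A by (simp add: entries_def)
  ultimately show ?R using * by blast
next
  assume ?R
  then show ?L
    unfolding UQ_matrices_def cell_def entries_def by (auto simp: cells1_iff)
qed

lemma UQ_simps:
  "obj (UQ m K) = weights m" "cells1 (UQ m K) = UQ_cells1 m"
  "cells2 (UQ m K) = UQ_matrices m K (diagrams m)"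
  "homog (UQ m K) n = (\<Union>f g. UQ_matrices m K (\<lambda>a. diagrams_of_deg m a n) f g)"
  "id1 (UQ m K) a = (a, a, [[]])"
  by (simp_all add: UQ_def)

lemma arr_cell:
  "wds m a b us \<Longrightarrow> wds m a b vs \<Longrightarrow> entries (diagrams m) a us vs A \<Longrightarrow>
    arr (UQ m K) a b (a, b, us) (a, b, vs) (cell m K a b us vs A)"
  by (auto simp: arr_def UQ_simps cells1_iff UQ_matrices_eq)

lemma arr_UQE:
  assumes "arr (UQ m K) a b p q \<sigma>"
  obtains us vs A where "p = (a, b, us)" "q = (a, b, vs)" "wds m a b us" "wds m a b vs"
    "\<sigma> = cell m K a b us vs A" "entries (diagrams m) a us vs A"
proof -
  obtain a' b' us a'' b'' vs where pq: "p = (a', b', us)" "q = (a'', b'', vs)"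
    by (cases p; cases q)
  then show ?thesis using assms that by (auto simp: arr_def UQ_simps cells1_iff UQ_matrices_eq)
qed

lemma cell_homog:
  "wds m a b us \<Longrightarrow> wds m a b vs \<Longrightarrow> entries (\<lambda>a. diagrams_of_deg m a n) a us vs A \<Longrightarrow>
    cell m K a b us vs A \<in> homog (UQ m K) n"
  unfolding UQ_simps by (intro UN_I[of "(a, b, us)"] UN_I[of "(a, b, vs)"]) (auto simp: UQ_matrices_eq)

lemma homog_UQE:
  assumes "cell m K a b us vs A \<in> homog (UQ m K) n"
  obtains B where "cell m K a b us vs A = cell m K a b us vs B"
    "entries (\<lambda>a. diagrams_of_deg m a n) a us vs B"
proof -
  obtain p q where "cell m K a b us vs A \<in> UQ_matrices m K (\<lambda>a. diagrams_of_deg m a n) p q"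
    using assms by (auto simp: UQ_simps)
  moreover obtain a' b' us' a'' b'' vs' where "p = (a', b', us')" "q = (a'', b'', vs')"
    by (cases p; cases q)
  ultimately show ?thesis using that by (auto simp: UQ_matrices_eq) (auto simp: cell_def)
qed

lemma entries_deg: "entries (\<lambda>a. diagrams_of_deg m a n) a us vs A \<Longrightarrow> entries (diagrams m) a us vs A"
  unfolding entries_def using Hdeg_Hsp by blast

lemma id2_cell: "id2 (UQ m K) (a, b, us) = cell m K a b us us (\<lambda>i j. if i = j then basis [] else 0)"
  by (simp add: UQ_def cell_def)

text \<open>Representatives chosen from the entries of a cell may be replaced by the given ones.\<close>

lemma rep_cell:
  assumes "entries (diagrams m) a us vs A" "i < length vs" "j < length us"
  shows "rep (coset (ideal m K a (us ! j) (vs ! i)) (A i j)) \<in> Hsp m a (us ! j) (vs ! i)"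
    and "rep (coset (ideal m K a (us ! j) (vs ! i)) (A i j)) - A i j \<in> ideal m K a (us ! j) (vs ! i)"
proof -
  show *: "rep (coset (ideal m K a (us ! j) (vs ! i)) (A i j)) - A i j \<in> ideal m K a (us ! j) (vs ! i)"
    by (rule rep_coset[OF subspace_ideal])
  from free_vs.span_add[OF ideal_Hsp[OF this] entriesD[OF assms]]
  show "rep (coset (ideal m K a (us ! j) (vs ! i)) (A i j)) \<in> Hsp m a (us ! j) (vs ! i)" by simp
qed

lemma vcomp_cell:
  assumes B: "entries (diagrams m) a vs ws B" and A: "entries (diagrams m) a us vs A"
  shows "vcomp (UQ m K) (cell m K a b vs ws B) (cell m K a b us vs A)
    = cell m K a b us ws (\<lambda>i k. \<Sum>j<length vs. vmul (B i j) (A j k))"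
proof -
  have "vcomp (UQ m K) (cell m K a b vs ws B) (cell m K a b us vs A)
    = cell m K a b us ws (\<lambda>i k. \<Sum>j<length vs.
        vmul (rep (mat (length ws) (length vs) (\<lambda>i j. coset (ideal m K a (vs ! j) (ws ! i)) (B i j)) i j))
          (rep (mat (length vs) (length us) (\<lambda>i j. coset (ideal m K a (us ! j) (vs ! i)) (A i j)) j k)))"
    by (simp add: UQ_def cell_def)
  also have "\<dots> = cell m K a b us ws (\<lambda>i k. \<Sum>j<length vs. vmul (B i j) (A j k))"
    unfolding cell_def[of _ _ _ _ us ws]
    by (intro cell_eqI[unfolded cell_def], subst sum_subtractf[symmetric],
        intro free_vs.subspace_sum[OF subspace_ideal])
      (auto intro!: vmul_cong rep_cell[OF B] rep_cell[OF A] entriesD[OF A])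
  finally show ?thesis .
qed

lemma vcomp_entries:
  assumes "entries (diagrams m) a vs ws B" "entries (diagrams m) a us vs A"
  shows "entries (diagrams m) a us ws (\<lambda>i k. \<Sum>j<length vs. vmul (B i j) (A j k))"
  unfolding entries_def using assms
  by (intro allI impI free_vs.span_sum vmul_Hsp) (auto intro: entriesD)

lemma vcomp_entries_deg:
  assumes "entries (\<lambda>a. diagrams_of_deg m a n) a vs ws B" "entries (\<lambda>a. diagrams_of_deg m a n') a us vs A"
  shows "entries (\<lambda>a. diagrams_of_deg m a (n + n')) a us ws (\<lambda>i k. \<Sum>j<length vs. vmul (B i j) (A j k))"
  unfolding entries_def
  by (intro allI impI free_vs.span_sum vmul_Hdeg[OF entriesD[OF assms(1)] entriesD[OF assms(2)]]) auto

text \<open>The list of summands of a composite of formal direct sums.\<close>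

definition wprod :: "word list \<Rightarrow> word list \<Rightarrow> word list" where
  "wprod us vs = map (\<lambda>(u, v). u @ v) (List.product us vs)"

lemma length_wprod [simp]: "length (wprod us vs) = length us * length vs"
  by (simp add: wprod_def)

lemma nth_wprod:
  "i < length us * length vs \<Longrightarrow> wprod us vs ! i = us ! (i div length vs) @ vs ! (i mod length vs)"
  by (simp add: wprod_def List.product_nth)

text \<open>The Kronecker product of matrices of 2-morphisms, whose entries are horizontal composites.\<close>

definition kron :: "word list \<Rightarrow> word list \<Rightarrow> word list \<Rightarrow> (nat \<Rightarrow> nat \<Rightarrow> lindiag) \<Rightarrow> (nat \<Rightarrow> nat \<Rightarrow> lindiag) \<Rightarrow>
    nat \<Rightarrow> nat \<Rightarrow> lindiag" where
  "kron us vs vs' B A = (\<lambda>i j. hmul (us ! (j div length vs)) (vs' ! (i mod length vs'))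
     (B (i div length vs') (j div length vs)) (A (i mod length vs') (j mod length vs)))"

lemma wprod_assoc: "wprod (wprod us vs) ws = wprod us (wprod vs ws)"
proof -
  have "wprod us vs = concat (map (\<lambda>u. map ((@) u) vs) us)" for us vs
    by (induction us) (auto simp: wprod_def)
  moreover have "concat (map (\<lambda>u. map ((@) u) ws) (concat (map (\<lambda>u. map ((@) u) vs) us)))
      = concat (map (\<lambda>u. map ((@) u) (concat (map (\<lambda>u. map ((@) u) ws) vs))) us)"
  proof -
    have "(@) (u @ v) = (\<lambda>w. u @ v @ w)" for u v :: word by auto
    then show ?thesis by (induction us) (auto simp: map_concat comp_def)
  qed
  ultimately show ?thesis by simp
qed

lemma comp1_UQ: "comp1 (UQ m K) (b, c, us) (a, b', vs) = (a, c, wprod us vs)"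
  by (simp add: UQ_def wprod_def)

lemma wprod_wds:
  assumes "wds m b c us" "wds m a b vs"
  shows "wds m a c (wprod us vs)"
  using assms by (auto simp: wds_def wprod_def wt_append)

lemma hcomp_cell:
  assumes us: "wds m b c us" "wds m b c us'" and vs: "wds m a b vs" "wds m a b vs'"
    and B: "entries (diagrams m) b us us' B" and A: "entries (diagrams m) a vs vs' A"
  shows "hcomp (UQ m K) (cell m K b c us us' B) (cell m K a b vs vs' A)
    = cell m K a c (wprod us vs) (wprod us' vs') (kron us vs vs' B A)"
proof -
  let ?R = "\<lambda>us vs b A i j. rep (mat (length vs) (length us) (\<lambda>i j. coset (ideal m K b (us ! j) (vs ! i)) (A i j)) i j)"
  have "hcomp (UQ m K) (cell m K b c us us' B) (cell m K a b vs vs' A)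
    = cell m K a c (wprod us vs) (wprod us' vs') (kron us vs vs' (?R us us' b B) (?R vs vs' a A))"
    unfolding UQ_def cell_def kron_def
    by (auto simp: Let_def wprod_def List.product_nth intro!: mat_cong)
  also have "\<dots> = cell m K a c (wprod us vs) (wprod us' vs') (kron us vs vs' B A)"
  proof (rule cell_eqI)
    fix i j assume "i < length (wprod us' vs')" "j < length (wprod us vs)"
    then have i: "i < length us' * length vs'" and j: "j < length us * length vs" by simp_all
    note ij = conjunct1[OF div_mod_less[OF i]] conjunct2[OF div_mod_less[OF i]]
      conjunct1[OF div_mod_less[OF j]] conjunct2[OF div_mod_less[OF j]]
    show "kron us vs vs' (?R us us' b B) (?R vs vs' a A) i j - kron us vs vs' B A i j
        \<in> ideal m K a (wprod us vs ! j) (wprod us' vs' ! i)"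
      unfolding kron_def nth_wprod[OF i] nth_wprod[OF j]
      using ij rep_cell[OF B ij(1,3)] rep_cell(2)[OF A ij(2,4)] entriesD[OF A ij(2,4)]
        wds_nth[OF vs(2) ij(2)] wds_nth[OF us(1) ij(3)]
      by (intro hmul_cong[where b = b]) simp_all
  qed
  finally show ?thesis .
qed

lemma kron_entries:
  assumes us: "wds m b c us" "wds m b c us'" and vs: "wds m a b vs" "wds m a b vs'"
    and B: "entries (diagrams m) b us us' B" and A: "entries (diagrams m) a vs vs' A"
  shows "entries (diagrams m) a (wprod us vs) (wprod us' vs') (kron us vs vs' B A)"
  unfolding entries_def
proof (intro allI impI)
  fix i j assume "i < length (wprod us' vs')" "j < length (wprod us vs)"
  then have i: "i < length us' * length vs'" and j: "j < length us * length vs" by simp_all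
  note ij = conjunct1[OF div_mod_less[OF i]] conjunct2[OF div_mod_less[OF i]]
    conjunct1[OF div_mod_less[OF j]] conjunct2[OF div_mod_less[OF j]]
  show "kron us vs vs' B A i j \<in> Hsp m a (wprod us vs ! j) (wprod us' vs' ! i)"
    unfolding kron_def nth_wprod[OF i] nth_wprod[OF j]
    using wds_nth[OF vs(2) ij(2)] wds_nth[OF us(1) ij(3)]
    by (intro hmul_Hsp[OF entriesD[OF B ij(1,3)] entriesD[OF A ij(2,4)]]) simp_all
qed

lemma kron_entries_deg:
  assumes us: "wds m b c us" "wds m b c us'" and vs: "wds m a b vs" "wds m a b vs'"
    and B: "entries (\<lambda>a. diagrams_of_deg m a n) b us us' B"
    and A: "entries (\<lambda>a. diagrams_of_deg m a n') a vs vs' A"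
  shows "entries (\<lambda>a. diagrams_of_deg m a (n + n')) a (wprod us vs) (wprod us' vs') (kron us vs vs' B A)"
  unfolding entries_def
proof (intro allI impI)
  fix i j assume "i < length (wprod us' vs')" "j < length (wprod us vs)"
  then have i: "i < length us' * length vs'" and j: "j < length us * length vs" by simp_all
  note ij = conjunct1[OF div_mod_less[OF i]] conjunct2[OF div_mod_less[OF i]]
    conjunct1[OF div_mod_less[OF j]] conjunct2[OF div_mod_less[OF j]]
  show "kron us vs vs' B A i j \<in> Hdeg m (n + n') a (wprod us vs ! j) (wprod us' vs' ! i)"
    unfolding kron_def nth_wprod[OF i] nth_wprod[OF j]
    using wds_nth[OF vs(2) ij(2)] wds_nth[OF us(1) ij(3)]
    by (intro hmul_Hdeg[OF entriesD[OF B ij(1,3)] entriesD[OF A ij(2,4)]]) simp_all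
qed

lemma lc_cell:
  assumes A: "entries (diagrams m) a us vs A" and B: "entries (diagrams m) a us vs B"
  shows "lc (UQ m K) s (cell m K a b us vs A) t (cell m K a b us vs B)
    = cell m K a b us vs (\<lambda>i j. scl s (A i j) + scl t (B i j))"
proof -
  have sc: "scale2 (UQ m K) s (cell m K a b us vs A) = cell m K a b us vs (\<lambda>i j. scl s (A i j))" for s A
  proof -
    have "scale2 (UQ m K) s (cell m K a b us vs A) = cell m K a b us vs (\<lambda>i j. scl s
        (rep (mat (length vs) (length us) (\<lambda>i j. coset (ideal m K a (us ! j) (vs ! i)) (A i j)) i j)))"
      by (simp add: UQ_def cell_def)
    also have "\<dots> = cell m K a b us vs (\<lambda>i j. scl s (A i j))"
      using free_vs.subspace_scale[OF subspace_ideal rep_coset[OF subspace_ideal]]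
      by (intro cell_eqI) (simp add: free_vs.scale_right_diff_distrib[symmetric])
    finally show ?thesis .
  qed
  have ad: "add2 (UQ m K) (cell m K a b us vs A) (cell m K a b us vs B)
      = cell m K a b us vs (\<lambda>i j. A i j + B i j)" for A B
  proof -
    let ?R = "\<lambda>A i j. rep (mat (length vs) (length us) (\<lambda>i j. coset (ideal m K a (us ! j) (vs ! i)) (A i j)) i j)"
    have "add2 (UQ m K) (cell m K a b us vs A) (cell m K a b us vs B)
        = cell m K a b us vs (\<lambda>i j. ?R A i j + ?R B i j)"
      by (simp add: UQ_def cell_def)
    also have "\<dots> = cell m K a b us vs (\<lambda>i j. A i j + B i j)"
    proof (rule cell_eqI)
      fix i j assume ij: "i < length vs" "j < length us"
      have "(?R A i j - A i j) + (?R B i j - B i j) \<in> ideal m K a (us ! j) (vs ! i)"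
        using ij by (intro free_vs.subspace_add[OF subspace_ideal]) (simp_all add: rep_coset[OF subspace_ideal])
      then show "?R A i j + ?R B i j - (A i j + B i j) \<in> ideal m K a (us ! j) (vs ! i)"
        by (simp add: algebra_simps)
    qed
    finally show ?thesis .
  qed
  show ?thesis by (simp add: lc_def sc ad)
qed

lemma lc_entries:
  assumes "entries S a us vs A" "entries S a us vs B"
  shows "entries S a us vs (\<lambda>i j. scl s (A i j) + scl t (B i j))"
  using assms unfolding entries_def by (auto intro!: free_vs.span_add free_vs.span_scale)

lemma id_entries:
  assumes "wds m a b us"
  shows "entries (\<lambda>a. diagrams_of_deg m a 0) a us us (\<lambda>i j. if i = j then basis [] else 0)"
  unfolding entries_def
  using assms by (auto intro!: Hdeg_basis simp: free_vs.span_zero deg_def dest: wds_nth)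

theorem linear_2cat_UQ: "linear_2cat (UQ m K)"
proof
  fix c assume "c \<in> obj (UQ m K)"
  then show "id1 (UQ m K) c \<in> cells1 (UQ m K) c c" by (auto simp: UQ_simps cells1_iff wds_def)
next
  fix p c d assume "p \<in> cells1 (UQ m K) c d"
  then show "c \<in> obj (UQ m K) \<and> d \<in> obj (UQ m K)"
    by (cases p) (auto simp: UQ_simps cells1_iff dest: wds_weights)
next
  fix r d e p c assume "r \<in> cells1 (UQ m K) d e" "p \<in> cells1 (UQ m K) c d"
  then show "comp1 (UQ m K) r p \<in> cells1 (UQ m K) c e"
    by (cases r; cases p) (auto simp: UQ_simps cells1_iff comp1_UQ intro: wprod_wds)
next
  fix s r p
  show "comp1 (UQ m K) (comp1 (UQ m K) s r) p = comp1 (UQ m K) s (comp1 (UQ m K) r p)"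
    by (cases s; cases r; cases p) (simp add: comp1_UQ wprod_assoc)
next
  fix p c d assume p: "p \<in> cells1 (UQ m K) c d"
  have "wprod [[]] us = us" for us by (simp add: wprod_def comp_def)
  then show "comp1 (UQ m K) (id1 (UQ m K) d) p = p"
    using p by (cases p) (auto simp: UQ_simps cells1_iff comp1_UQ)
  have "wprod us [[]] = us" for us by (induction us) (auto simp: wprod_def)
  then show "comp1 (UQ m K) p (id1 (UQ m K) c) = p"
    using p by (cases p) (auto simp: UQ_simps cells1_iff comp1_UQ)
  obtain us where pu: "p = (c, d, us)" and us: "wds m c d us"
    using p by (cases p) (auto simp: UQ_simps cells1_iff)
  show "arr (UQ m K) c d p p (id2 (UQ m K) p)"
    unfolding pu id2_cell by (rule arr_cell[OF us us entries_deg[OF id_entries[OF us]]])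
  show "id2 (UQ m K) p \<in> homog (UQ m K) 0"
    unfolding pu id2_cell by (rule cell_homog[OF us us id_entries[OF us]])
next
  fix c d q r \<sigma> p \<tau>
  assume "arr (UQ m K) c d q r \<sigma>"
  then obtain vs ws B where q: "q = (c, d, vs)" "r = (c, d, ws)" "wds m c d vs" "wds m c d ws"
    and \<sigma>: "\<sigma> = cell m K c d vs ws B" "entries (diagrams m) c vs ws B" by (rule arr_UQE)
  {
    assume "arr (UQ m K) c d p q \<tau>"
    then obtain us A where p: "p = (c, d, us)" "wds m c d us"
      and \<tau>: "\<tau> = cell m K c d us vs A" "entries (diagrams m) c us vs A"
      by (rule arr_UQE) (auto simp: q)
    show "arr (UQ m K) c d p r (vcomp (UQ m K) \<sigma> \<tau>)"
      unfolding p q \<sigma> \<tau> vcomp_cell[OF \<sigma>(2) \<tau>(2)]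
      by (rule arr_cell[OF p(2) q(4) vcomp_entries[OF \<sigma>(2) \<tau>(2)]])
    fix n n'
    assume "\<sigma> \<in> homog (UQ m K) n" "\<tau> \<in> homog (UQ m K) n'"
    then obtain B' A' where B': "\<sigma> = cell m K c d vs ws B'" "entries (\<lambda>a. diagrams_of_deg m a n) c vs ws B'"
      and A': "\<tau> = cell m K c d us vs A'" "entries (\<lambda>a. diagrams_of_deg m a n') c us vs A'"
      unfolding \<sigma> \<tau> by (elim homog_UQE) 
    show "vcomp (UQ m K) \<sigma> \<tau> \<in> homog (UQ m K) (n + n')"
      unfolding B'(1) A'(1) vcomp_cell[OF entries_deg[OF B'(2)] entries_deg[OF A'(2)]]
      by (rule cell_homog[OF p(2) q(4) vcomp_entries_deg[OF B'(2) A'(2)]])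
  }
next
  fix d e r s \<rho> c p q \<tau>
  assume "arr (UQ m K) d e r s \<rho>" "arr (UQ m K) c d p q \<tau>"
  then obtain us us' B vs vs' A where rs: "r = (d, e, us)" "s = (d, e, us')" and us: "wds m d e us" "wds m d e us'"
    and \<rho>: "\<rho> = cell m K d e us us' B" "entries (diagrams m) d us us' B"
    and pq: "p = (c, d, vs)" "q = (c, d, vs')" and vs: "wds m c d vs" "wds m c d vs'"
    and \<tau>: "\<tau> = cell m K c d vs vs' A" "entries (diagrams m) c vs vs' A"
    by (elim arr_UQE)
  show "arr (UQ m K) c e (comp1 (UQ m K) r p) (comp1 (UQ m K) s q) (hcomp (UQ m K) \<rho> \<tau>)"
    unfolding rs pq \<rho> \<tau> hcomp_cell[OF us vs \<rho>(2) \<tau>(2)] comp1_UQ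
    by (rule arr_cell[OF wprod_wds[OF us(1) vs(1)] wprod_wds[OF us(2) vs(2)] kron_entries[OF us vs \<rho>(2) \<tau>(2)]])
  fix n n'
  assume "\<rho> \<in> homog (UQ m K) n" "\<tau> \<in> homog (UQ m K) n'"
  then obtain B' A' where B': "\<rho> = cell m K d e us us' B'" "entries (\<lambda>a. diagrams_of_deg m a n) d us us' B'"
    and A': "\<tau> = cell m K c d vs vs' A'" "entries (\<lambda>a. diagrams_of_deg m a n') c vs vs' A'"
    unfolding \<rho> \<tau> by (elim homog_UQE)
  show "hcomp (UQ m K) \<rho> \<tau> \<in> homog (UQ m K) (n + n')"
    unfolding B'(1) A'(1) hcomp_cell[OF us vs entries_deg[OF B'(2)] entries_deg[OF A'(2)]]
    by (rule cell_homog[OF wprod_wds[OF us(1) vs(1)] wprod_wds[OF us(2) vs(2)] kron_entries_deg[OF us vs B'(2) A'(2)]])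
next
  fix c d p q \<sigma> \<tau> x y
  assume "arr (UQ m K) c d p q \<sigma>" "arr (UQ m K) c d p q \<tau>"
  then obtain us vs A B where pq: "p = (c, d, us)" "q = (c, d, vs)" "wds m c d us" "wds m c d vs"
    and A: "\<sigma> = cell m K c d us vs A" "entries (diagrams m) c us vs A"
    and B: "\<tau> = cell m K c d us vs B" "entries (diagrams m) c us vs B"
    by (elim arr_UQE) auto
  show "arr (UQ m K) c d p q (lc (UQ m K) x \<sigma> y \<tau>)"
    unfolding pq A B lc_cell[OF A(2) B(2)]
    by (rule arr_cell[OF pq(3,4) lc_entries[OF A(2) B(2)]])
next
  fix c d r s \<omega> q \<sigma> p \<tau>
  assume "arr (UQ m K) c d r s \<omega>" "arr (UQ m K) c d q r \<sigma>" "arr (UQ m K) c d p q \<tau>"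
  then obtain us vs ws xs A B D where
    A: "\<tau> = cell m K c d us vs A" "entries (diagrams m) c us vs A" and
    B: "\<sigma> = cell m K c d vs ws B" "entries (diagrams m) c vs ws B" and
    D: "\<omega> = cell m K c d ws xs D" "entries (diagrams m) c ws xs D"
    by (elim arr_UQE) auto
  show "vcomp (UQ m K) (vcomp (UQ m K) \<omega> \<sigma>) \<tau> = vcomp (UQ m K) \<omega> (vcomp (UQ m K) \<sigma> \<tau>)"
    unfolding A B D vcomp_cell[OF D(2) B(2)] vcomp_cell[OF B(2) A(2)]
      vcomp_cell[OF vcomp_entries[OF D(2) B(2)] A(2)] vcomp_cell[OF D(2) vcomp_entries[OF B(2) A(2)]]
  proof (rule cell_cong)
    fix i l
    have "(\<Sum>j<length vs. vmul (\<Sum>k<length ws. vmul (D i k) (B k j)) (A j l))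
        = (\<Sum>j<length vs. \<Sum>k<length ws. vmul (D i k) (vmul (B k j) (A j l)))"
      by (simp add: bilin_sum vmul_assoc)
    also have "\<dots> = (\<Sum>k<length ws. \<Sum>j<length vs. vmul (D i k) (vmul (B k j) (A j l)))"
      by (rule sum.swap)
    finally show "(\<Sum>j<length vs. vmul (\<Sum>k<length ws. vmul (D i k) (B k j)) (A j l))
        = (\<Sum>k<length ws. vmul (D i k) (\<Sum>j<length vs. vmul (B k j) (A j l)))"
      by (simp add: bilin_sum)
  qed
next
  fix c d p q \<sigma>
  assume "arr (UQ m K) c d p q \<sigma>"
  then obtain us vs A where pq: "p = (c, d, us)" "q = (c, d, vs)" "wds m c d us" "wds m c d vs"
    and A: "\<sigma> = cell m K c d us vs A" "entries (diagrams m) c us vs A"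
    by (rule arr_UQE)
  have idc: "wds m d d [[]]" "wds m c c [[]]" using wds_weights[OF pq(3)] by (auto simp: wds_def)
  note ide = entries_deg[OF id_entries[OF pq(3)]] entries_deg[OF id_entries[OF pq(4)]]
    entries_deg[OF id_entries[OF idc(1)]] entries_deg[OF id_entries[OF idc(2)]]
  show "vcomp (UQ m K) (id2 (UQ m K) q) \<sigma> = \<sigma>"
    unfolding pq A id2_cell vcomp_cell[OF ide(2) A(2)]
    by (rule cell_cong, subst sum_single) (auto simp: bilin_simps)
  show "vcomp (UQ m K) \<sigma> (id2 (UQ m K) p) = \<sigma>"
    unfolding pq A id2_cell vcomp_cell[OF A(2) ide(1)]
    by (rule cell_cong, subst sum_single) (auto simp: bilin_simps)
  have w1: "wprod [[]] us = us" "wprod us [[]] = us" for us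
    by (simp add: wprod_def comp_def) (induction us, auto simp: wprod_def)
  show "hcomp (UQ m K) (id2 (UQ m K) (id1 (UQ m K) d)) \<sigma> = \<sigma>"
    unfolding UQ_simps A id2_cell hcomp_cell[OF idc(1,1) pq(3,4) ide(3) A(2)] w1
    by (rule cell_cong) (simp add: kron_def hmul_def whisker_Nil)
  show "hcomp (UQ m K) \<sigma> (id2 (UQ m K) (id1 (UQ m K) c)) = \<sigma>"
    unfolding UQ_simps A id2_cell hcomp_cell[OF pq(3,4) idc(2,2) A(2) ide(4)] w1
    by (rule cell_cong) (simp add: kron_def hmul_def whisker_Nil)
next
  fix e b s t \<omega> d r u \<sigma> c p q \<tau>
  assume "arr (UQ m K) e b s t \<omega>" "arr (UQ m K) d e r u \<sigma>" "arr (UQ m K) c d p q \<tau>"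
  then obtain us us' D vs vs' B ws ws' A where
    us: "wds m e b us" "wds m e b us'" and vs: "wds m d e vs" "wds m d e vs'"
    and ws: "wds m c d ws" "wds m c d ws'" and
    D: "\<omega> = cell m K e b us us' D" "entries (diagrams m) e us us' D" and
    B: "\<sigma> = cell m K d e vs vs' B" "entries (diagrams m) d vs vs' B" and
    A: "\<tau> = cell m K c d ws ws' A" "entries (diagrams m) c ws ws' A"
    by (elim arr_UQE)
  note uv = wprod_wds[OF us(1) vs(1)] wprod_wds[OF us(2) vs(2)]
    and vw = wprod_wds[OF vs(1) ws(1)] wprod_wds[OF vs(2) ws(2)]
  show "hcomp (UQ m K) (hcomp (UQ m K) \<omega> \<sigma>) \<tau> = hcomp (UQ m K) \<omega> (hcomp (UQ m K) \<sigma> \<tau>)"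
    unfolding A B D hcomp_cell[OF us vs D(2) B(2)] hcomp_cell[OF vs ws B(2) A(2)]
      hcomp_cell[OF uv ws kron_entries[OF us vs D(2) B(2)] A(2)]
      hcomp_cell[OF us vw D(2) kron_entries[OF vs ws B(2) A(2)]] wprod_assoc
  proof (rule cell_cong)
    fix i j assume "i < length (wprod us' (wprod vs' ws'))" "j < length (wprod us (wprod vs ws))"
    then have i: "i < (length us' * length vs') * length ws'" and j: "j < (length us * length vs) * length ws"
      by (simp_all add: mult.assoc)
    have i': "i mod (length vs' * length ws') < length vs' * length ws'"
      and j': "j mod (length vs * length ws) < length vs * length ws"
      using i j by (intro mod_less_divisor; cases "length vs' * length ws'"; cases "length vs * length ws"; auto)+
    have idx: "k div r div s = k div (s * r)" "(k div r) mod s = k mod (s * r) div r" "k mod (s * r) mod r = k mod r"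
      for k r s :: nat
      by (simp_all add: div_mult2_eq mult.commute[of s r] mod_mult2_eq)
        (cases "r = 0"; simp add: div_mult2_eq mod_mult2_eq)+
    show "kron (wprod us vs) ws ws' (kron us vs vs' D B) A i j
        = kron us (wprod vs ws) (wprod vs' ws') D (kron vs ws ws' B A) i j"
      using div_mod_less[OF i] div_mod_less[OF j] i' j'
      by (simp add: kron_def nth_wprod hmul_assoc idx)
  qed
next
  fix d e s t \<rho>' r \<rho> c q u \<tau>' p \<tau>
  assume "arr (UQ m K) d e s t \<rho>'" "arr (UQ m K) d e r s \<rho>" "arr (UQ m K) c d q u \<tau>'" "arr (UQ m K) c d p q \<tau>"
  then obtain us us' us'' B B' vs vs' vs'' A A' where
    us: "wds m d e us" "wds m d e us'" "wds m d e us''" and vs: "wds m c d vs" "wds m c d vs'" "wds m c d vs''" and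
    B: "\<rho> = cell m K d e us us' B" "entries (diagrams m) d us us' B" and
    B': "\<rho>' = cell m K d e us' us'' B'" "entries (diagrams m) d us' us'' B'" and
    A: "\<tau> = cell m K c d vs vs' A" "entries (diagrams m) c vs vs' A" and
    A': "\<tau>' = cell m K c d vs' vs'' A'" "entries (diagrams m) c vs' vs'' A'"
    by (elim arr_UQE) auto
  show "hcomp (UQ m K) (vcomp (UQ m K) \<rho>' \<rho>) (vcomp (UQ m K) \<tau>' \<tau>)
      = vcomp (UQ m K) (hcomp (UQ m K) \<rho>' \<tau>') (hcomp (UQ m K) \<rho> \<tau>)"
    unfolding B(1) B'(1) A(1) A'(1) vcomp_cell[OF B'(2) B(2)] vcomp_cell[OF A'(2) A(2)]
      hcomp_cell[OF us(1,3) vs(1,3) vcomp_entries[OF B'(2) B(2)] vcomp_entries[OF A'(2) A(2)]]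
      hcomp_cell[OF us(2,3) vs(2,3) B'(2) A'(2)] hcomp_cell[OF us(1,2) vs(1,2) B(2) A(2)]
      vcomp_cell[OF kron_entries[OF us(2,3) vs(2,3) B'(2) A'(2)] kron_entries[OF us(1,2) vs(1,2) B(2) A(2)]]
  proof (rule cell_eqI)
    fix i k assume "i < length (wprod us'' vs'')" "k < length (wprod us vs)"
    then have i: "i < length us'' * length vs''" and k: "k < length us * length vs" by simp_all
    note ik = conjunct1[OF div_mod_less[OF i]] conjunct2[OF div_mod_less[OF i]]
      conjunct1[OF div_mod_less[OF k]] conjunct2[OF div_mod_less[OF k]]
    let ?i1 = "i div length vs''" and ?i2 = "i mod length vs''"
      and ?k1 = "k div length vs" and ?k2 = "k mod length vs"
    let ?f = "\<lambda>j1 j2. vmul (hmul (us' ! j1) (vs'' ! ?i2) (B' ?i1 j1) (A' ?i2 j2))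
        (hmul (us ! ?k1) (vs' ! j2) (B j1 ?k1) (A j2 ?k2))"
    let ?g = "\<lambda>j1 j2. hmul (us ! ?k1) (vs'' ! ?i2) (vmul (B' ?i1 j1) (B j1 ?k1)) (vmul (A' ?i2 j2) (A j2 ?k2))"
    have 1: "(\<Sum>j<length (wprod us' vs'). vmul (kron us' vs' vs'' B' A' i j) (kron us vs vs' B A j k))
        = (\<Sum>j1<length us'. \<Sum>j2<length vs'. ?f j1 j2)"
      unfolding length_wprod sum_div_mod[symmetric] kron_def by simp
    have 2: "kron us vs vs'' (\<lambda>i k. \<Sum>j<length us'. vmul (B' i j) (B j k))
        (\<lambda>i k. \<Sum>j<length vs'. vmul (A' i j) (A j k)) i k
        = (\<Sum>j1<length us'. \<Sum>j2<length vs'. ?g j1 j2)"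
      unfolding kron_def by (simp add: lin_sum[OF lin_hmul_left] lin_sum[OF lin_hmul_right]) (rule sum.swap)
    have "?g j1 j2 - ?f j1 j2 \<in> ideal m K c (us ! ?k1 @ vs ! ?k2) (us'' ! ?i1 @ vs'' ! ?i2)"
      if "j1 < length us'" "j2 < length vs'" for j1 j2
      using that wds_weights[OF vs(1)] wds_nth[OF us(1) ik(3)] wds_nth[OF us(2) that(1)]
        wds_nth[OF vs(2) that(2)] wds_nth[OF vs(3) ik(2)]
      by (intro hmul_interchange[where b = d]
          entriesD[OF B(2)] entriesD[OF B'(2)] entriesD[OF A(2)] entriesD[OF A'(2)]) (auto simp: ik)
    then show "kron us vs vs'' (\<lambda>i k. \<Sum>j<length us'. vmul (B' i j) (B j k))
        (\<lambda>i k. \<Sum>j<length vs'. vmul (A' i j) (A j k)) i k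
        - (\<Sum>j<length (wprod us' vs'). vmul (kron us' vs' vs'' B' A' i j) (kron us vs vs' B A j k))
        \<in> ideal m K c (wprod us vs ! k) (wprod us'' vs'' ! i)"
      unfolding 1 2 nth_wprod[OF i] nth_wprod[OF k] sum_subtractf[symmetric]
      by (intro free_vs.subspace_sum[OF subspace_ideal]) auto
  qed
next
  fix r d e p c assume "r \<in> cells1 (UQ m K) d e" "p \<in> cells1 (UQ m K) c d"
  then obtain us vs where r: "r = (d, e, us)" "wds m d e us" and p: "p = (c, d, vs)" "wds m c d vs"
    by (cases r; cases p) (auto simp: UQ_simps cells1_iff)
  show "hcomp (UQ m K) (id2 (UQ m K) r) (id2 (UQ m K) p) = id2 (UQ m K) (comp1 (UQ m K) r p)"
    unfolding r p comp1_UQ id2_cell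
      hcomp_cell[OF r(2,2) p(2,2) entries_deg[OF id_entries[OF r(2)]] entries_deg[OF id_entries[OF p(2)]]]
  proof (rule cell_cong)
    fix i j assume "i < length (wprod us vs)" "j < length (wprod us vs)"
    have "i = j \<longleftrightarrow> i div length vs = j div length vs \<and> i mod length vs = j mod length vs"
      by (metis div_mult_mod_eq)
    then show "kron us vs vs (\<lambda>i j. if i = j then basis [] else 0) (\<lambda>i j. if i = j then basis [] else 0) i j
        = (if i = j then basis [] else 0)"
      by (auto simp: kron_def lin_0[OF lin_hmul_left] lin_0[OF lin_hmul_right]) (simp_all add: hmul_def)
  qed
next
  fix c d q r \<sigma> \<sigma>' p \<tau> x y
  assume "arr (UQ m K) c d q r \<sigma>" "arr (UQ m K) c d q r \<sigma>'" "arr (UQ m K) c d p q \<tau>"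
  then obtain us vs ws A B B' where
    A: "\<tau> = cell m K c d us vs A" "entries (diagrams m) c us vs A" and
    B: "\<sigma> = cell m K c d vs ws B" "entries (diagrams m) c vs ws B" and
    B': "\<sigma>' = cell m K c d vs ws B'" "entries (diagrams m) c vs ws B'"
    by (elim arr_UQE) auto
  show "vcomp (UQ m K) (lc (UQ m K) x \<sigma> y \<sigma>') \<tau>
      = lc (UQ m K) x (vcomp (UQ m K) \<sigma> \<tau>) y (vcomp (UQ m K) \<sigma>' \<tau>)"
    unfolding A(1) B(1) B'(1) lc_cell[OF B(2) B'(2)] vcomp_cell[OF lc_entries[OF B(2) B'(2)] A(2)]
      vcomp_cell[OF B(2) A(2)] vcomp_cell[OF B'(2) A(2)]
      lc_cell[OF vcomp_entries[OF B(2) A(2)] vcomp_entries[OF B'(2) A(2)]]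
    by (rule cell_cong) (simp add: bilin_simps sum.distrib free_vs.scale_sum_right)
next
  fix c d q r \<tau> p \<sigma> \<sigma>' x y
  assume "arr (UQ m K) c d q r \<tau>" "arr (UQ m K) c d p q \<sigma>" "arr (UQ m K) c d p q \<sigma>'"
  then obtain us vs ws A B B' where
    A: "\<tau> = cell m K c d vs ws A" "entries (diagrams m) c vs ws A" and
    B: "\<sigma> = cell m K c d us vs B" "entries (diagrams m) c us vs B" and
    B': "\<sigma>' = cell m K c d us vs B'" "entries (diagrams m) c us vs B'"
    by (elim arr_UQE) auto
  show "vcomp (UQ m K) \<tau> (lc (UQ m K) x \<sigma> y \<sigma>')
      = lc (UQ m K) x (vcomp (UQ m K) \<tau> \<sigma>) y (vcomp (UQ m K) \<tau> \<sigma>')"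
    unfolding A(1) B(1) B'(1) lc_cell[OF B(2) B'(2)] vcomp_cell[OF A(2) lc_entries[OF B(2) B'(2)]]
      vcomp_cell[OF A(2) B(2)] vcomp_cell[OF A(2) B'(2)]
      lc_cell[OF vcomp_entries[OF A(2) B(2)] vcomp_entries[OF A(2) B'(2)]]
    by (rule cell_cong) (simp add: bilin_simps sum.distrib free_vs.scale_sum_right)
next
  fix d e r s \<sigma> \<sigma>' c p q \<tau> x y
  assume "arr (UQ m K) d e r s \<sigma>" "arr (UQ m K) d e r s \<sigma>'" "arr (UQ m K) c d p q \<tau>"
  then obtain us us' vs vs' A B B' where
    w: "wds m d e us" "wds m d e us'" "wds m c d vs" "wds m c d vs'" and
    A: "\<tau> = cell m K c d vs vs' A" "entries (diagrams m) c vs vs' A" and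
    B: "\<sigma> = cell m K d e us us' B" "entries (diagrams m) d us us' B" and
    B': "\<sigma>' = cell m K d e us us' B'" "entries (diagrams m) d us us' B'"
    by (elim arr_UQE) auto
  show "hcomp (UQ m K) (lc (UQ m K) x \<sigma> y \<sigma>') \<tau>
      = lc (UQ m K) x (hcomp (UQ m K) \<sigma> \<tau>) y (hcomp (UQ m K) \<sigma>' \<tau>)"
    unfolding A(1) B(1) B'(1) lc_cell[OF B(2) B'(2)] hcomp_cell[OF w lc_entries[OF B(2) B'(2)] A(2)]
      hcomp_cell[OF w B(2) A(2)] hcomp_cell[OF w B'(2) A(2)]
      lc_cell[OF kron_entries[OF w B(2) A(2)] kron_entries[OF w B'(2) A(2)]]
    by (rule cell_cong) (simp add: kron_def lin_add[OF lin_hmul_left] lin_scl[OF lin_hmul_left])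
next
  fix d e r s \<tau> c p q \<sigma> \<sigma>' x y
  assume "arr (UQ m K) d e r s \<tau>" "arr (UQ m K) c d p q \<sigma>" "arr (UQ m K) c d p q \<sigma>'"
  then obtain us us' vs vs' A B B' where
    w: "wds m d e us" "wds m d e us'" "wds m c d vs" "wds m c d vs'" and
    A: "\<tau> = cell m K d e us us' A" "entries (diagrams m) d us us' A" and
    B: "\<sigma> = cell m K c d vs vs' B" "entries (diagrams m) c vs vs' B" and
    B': "\<sigma>' = cell m K c d vs vs' B'" "entries (diagrams m) c vs vs' B'"
    by (elim arr_UQE) auto
  show "hcomp (UQ m K) \<tau> (lc (UQ m K) x \<sigma> y \<sigma>')
      = lc (UQ m K) x (hcomp (UQ m K) \<tau> \<sigma>) y (hcomp (UQ m K) \<tau> \<sigma>')"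
    unfolding A(1) B(1) B'(1) lc_cell[OF B(2) B'(2)] hcomp_cell[OF w A(2) lc_entries[OF B(2) B'(2)]]
      hcomp_cell[OF w A(2) B(2)] hcomp_cell[OF w A(2) B'(2)]
      lc_cell[OF kron_entries[OF w A(2) B(2)] kron_entries[OF w A(2) B'(2)]]
    by (rule cell_cong) (simp add: kron_def lin_add[OF lin_hmul_right] lin_scl[OF lin_hmul_right])
qed

interpretation UQ: linear_2cat "UQ m K" for m K
  by (rule linear_2cat_UQ)

section \<open>Splitting endo-1-morphisms in the horizontal trace\<close>

text \<open>The shifted identity 1-morphisms, which are the image of the inclusion on single summands.\<close>

definition ids :: "nat \<Rightarrow> weight set \<Rightarrow> (int \<times> weight \<times> cell1) set" where
  "ids m K = {(k, c, id1 (UQ m K) c) | k c. c \<in> obj (UQ m K)}"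

text \<open>The endo-1-morphism \<open>w\<close> of \<open>a\<close> is, in the horizontal trace, a direct sum of shifted identities.\<close>

definition good :: "nat \<Rightarrow> weight set \<Rightarrow> weight \<Rightarrow> word \<Rightarrow> bool" where
  "good m K a w \<longleftrightarrow> (\<forall>k. UQ.H.splits m K (ids m K) (k, a, (a, a, [w])))"

lemma zero_entries: "entries S a us vs (\<lambda>_ _. 0)"
  by (simp add: entries_def free_vs.span_zero)

text \<open>Up to the relations of the trace, the class of a 2-morphism is additive in its matrix.\<close>

lemma cell_sum_rel:
  assumes us: "wds m a a us" and vs: "wds m a a vs"
    and "finite I" "\<And>i. i \<in> I \<Longrightarrow> entries (diagrams m) a us vs (A i)"
  shows "(\<Sum>i\<in>I. basis (id1 (UQ m K) a, cell m K a a us vs (A i)))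
      - basis (id1 (UQ m K) a, cell m K a a us vs (\<lambda>j k. \<Sum>i\<in>I. A i j k))
      \<in> hTr_rels (UQ m K) (0, a, (a, a, us)) (0, a, (a, a, vs))"
proof -
  let ?p = "id1 (UQ m K) a" and ?R = "hTr_rels (UQ m K) (0, a, (a, a, us)) (0, a, (a, a, vs))"
  let ?c = "\<lambda>A. basis (?p, cell m K a a us vs A)"
  have f: "(a, a, us) \<in> cells1 (UQ m K) a a" and g: "(a, a, vs) \<in> cells1 (UQ m K) a a"
    using us vs by (simp_all add: UQ_simps cells1_iff)
  have p: "?p \<in> cells1 (UQ m K) a a"
    using wds_weights[OF us] by (intro UQ.id1_cell) (simp add: UQ_simps)
  have lin: "?c (\<lambda>i j. scl s (A i j) + scl t (B i j)) - scl s (?c A) - scl t (?c B) \<in> ?R"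
    if A: "entries (diagrams m) a us vs A" and B: "entries (diagrams m) a us vs B" for s t A B
    using UQ.hTr_relsI(1)[OF UQ.hlinI[OF f g p], of "cell m K a a us vs A" "cell m K a a us vs B" s t 0 0]
      arr_cell[OF us vs A] arr_cell[OF us vs B]
    by (simp add: UQ.id1_comp1[OF f] UQ.comp1_id1[OF g] lc_cell[OF A B])
  have zero: "?c (\<lambda>_ _. 0) \<in> ?R"
    using lin[OF zero_entries zero_entries, of 0 0] by simp
  show ?thesis
    using assms(3,4)
  proof (induction I rule: finite_induct)
    case empty
    then show ?case using free_vs.subspace_neg[OF UQ.subspace_hTr_rels zero] by simp
  next
    case (insert i I)
    let ?S = "\<lambda>j k. \<Sum>i\<in>I. A i j k"
    have S: "entries (diagrams m) a us vs ?S"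
      using insert.prems unfolding entries_def by (auto intro!: free_vs.span_sum)
    have "?c (\<lambda>j k. A i j k + ?S j k) - ?c (A i) - ?c ?S \<in> ?R"
      using lin[OF insert.prems[of i] S, of 1 1] by simp
    from free_vs.subspace_diff[OF UQ.subspace_hTr_rels insert.IH this]
    show ?case using insert.hyps insert.prems by (simp add: algebra_simps)
  qed
qed

text \<open>Decompositions in the horizontal trace in terms of matrices of representatives.\<close>

lemma UQ_decomposition:
  assumes I: "finite I" and us: "wds m a a us" and vs: "\<And>i. i \<in> I \<Longrightarrow> wds m a a (vs i)"
    and P: "\<And>i. i \<in> I \<Longrightarrow> entries (\<lambda>a. diagrams_of_deg m a (\<delta> i)) a us (vs i) (P i)"
    and Q: "\<And>i. i \<in> I \<Longrightarrow> entries (\<lambda>a. diagrams_of_deg m a (- \<delta> i)) a (vs i) us (Q i)"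
    and PQ: "\<And>i r s. i \<in> I \<Longrightarrow> r < length (vs i) \<Longrightarrow> s < length (vs i) \<Longrightarrow>
      (\<Sum>l<length us. vmul (P i r l) (Q i l s)) - (if r = s then basis [] else 0)
        \<in> ideal m K a (vs i ! s) (vs i ! r)"
    and PQ0: "\<And>i j r s. i \<in> I \<Longrightarrow> j \<in> I \<Longrightarrow> i \<noteq> j \<Longrightarrow> r < length (vs i) \<Longrightarrow> s < length (vs j) \<Longrightarrow>
      (\<Sum>l<length us. vmul (P i r l) (Q j l s)) \<in> ideal m K a (vs j ! s) (vs i ! r)"
    and QP: "\<And>r s. r < length us \<Longrightarrow> s < length us \<Longrightarrow>
      (\<Sum>i\<in>I. \<Sum>l<length (vs i). vmul (Q i r l) (P i l s)) - (if r = s then basis [] else 0)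
        \<in> ideal m K a (us ! s) (us ! r)"
    and splits: "\<And>i k. i \<in> I \<Longrightarrow> UQ.H.splits m K B (k, a, (a, a, vs i))"
  shows "UQ.H.splits m K B (k, a, (a, a, us))"
proof -
  let ?C = "UQ m K"
  note Pd = entries_deg[OF P] and Qd = entries_deg[OF Q]
  have f: "(a, a, us) \<in> cells1 ?C a a" using us by (simp add: UQ_simps cells1_iff)
  have "UQ.H.is_sum_of m K (k, a, (a, a, us)) I (\<lambda>i. (k + \<delta> i, a, (a, a, vs i)))
      (\<lambda>i. basis (id1 ?C a, cell m K a a us (vs i) (P i))) (\<lambda>i. basis (id1 ?C a, cell m K a a (vs i) us (Q i)))"
  proof (rule UQ.hTr_decomposition[OF I f])
    fix i assume i: "i \<in> I"
    show "arr ?C a a (a, a, us) (a, a, vs i) (cell m K a a us (vs i) (P i))"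
      by (rule arr_cell[OF us vs[OF i] Pd[OF i]])
    show "arr ?C a a (a, a, vs i) (a, a, us) (cell m K a a (vs i) us (Q i))"
      by (rule arr_cell[OF vs[OF i] us Qd[OF i]])
    show "cell m K a a us (vs i) (P i) \<in> homog ?C (\<delta> i)"
      by (rule cell_homog[OF us vs[OF i] P[OF i]])
    show "cell m K a a (vs i) us (Q i) \<in> homog ?C (- \<delta> i)"
      by (rule cell_homog[OF vs[OF i] us Q[OF i]])
    show "vcomp ?C (cell m K a a us (vs i) (P i)) (cell m K a a (vs i) us (Q i)) = id2 ?C (a, a, vs i)"
      unfolding vcomp_cell[OF Pd[OF i] Qd[OF i]] id2_cell by (rule cell_eqI) (rule PQ[OF i])
  next
    fix i j assume ij: "i \<in> I" "j \<in> I" "i \<noteq> j"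
    have "vcomp ?C (cell m K a a us (vs i) (P i)) (cell m K a a (vs j) us (Q j))
        = cell m K a a (vs j) (vs i) (\<lambda>_ _. 0)"
      unfolding vcomp_cell[OF Pd[OF ij(1)] Qd[OF ij(2)]] using PQ0[OF ij] by (intro cell_eqI) simp
    moreover have "basis (id1 ?C a, cell m K a a (vs j) (vs i) (\<lambda>_ _. 0))
        \<in> hTr_rels ?C (0, a, a, a, vs j) (0, a, a, a, vs i)"
      using free_vs.subspace_neg[OF UQ.subspace_hTr_rels cell_sum_rel[OF vs[OF ij(2)] vs[OF ij(1)], of "{}"]]
      by simp
    ultimately show "basis (id1 ?C a, vcomp ?C (cell m K a a us (vs i) (P i)) (cell m K a a (vs j) us (Q j)))
        \<in> hTr_rels ?C (0, a, a, a, vs j) (0, a, a, a, vs i)"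
      by simp
  next
    let ?A = "\<lambda>i r s. \<Sum>l<length (vs i). vmul (Q i r l) (P i l s)"
    have "(\<Sum>i\<in>I. basis (id1 ?C a, vcomp ?C (cell m K a a (vs i) us (Q i)) (cell m K a a us (vs i) (P i))))
        = (\<Sum>i\<in>I. basis (id1 ?C a, cell m K a a us us (?A i)))"
      by (intro sum.cong refl) (simp add: vcomp_cell[OF Qd Pd])
    moreover have "id2 ?C (a, a, us) = cell m K a a us us (\<lambda>r s. \<Sum>i\<in>I. ?A i r s)"
      unfolding id2_cell by (rule cell_eqI[symmetric]) (rule QP)
    ultimately show "(\<Sum>i\<in>I. basis (id1 ?C a, vcomp ?C (cell m K a a (vs i) us (Q i)) (cell m K a a us (vs i) (P i))))
        - basis (id1 ?C a, id2 ?C (a, a, us)) \<in> hTr_rels ?C (0, a, a, a, us) (0, a, a, a, us)"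
      using cell_sum_rel[OF us us I, of ?A] vcomp_entries[OF Qd Pd] by simp
  qed
  then show ?thesis by (rule UQ.H.splits_trans) (rule splits)
qed

text \<open>A formal direct sum of words splits if its words do: the projections and inclusions are the
  matrix units.\<close>

lemma splits_if_good:
  assumes ws: "wds m a a ws" and good: "\<And>w. w \<in> set ws \<Longrightarrow> good m K a w"
  shows "UQ.H.splits m K (ids m K) (k, a, (a, a, ws))"
proof (rule UQ_decomposition[where I = "{..<length ws}" and vs = "\<lambda>i. [ws ! i]" and \<delta> = "\<lambda>_. 0"
      and P = "\<lambda>i r l. if l = i then basis [] else 0" and Q = "\<lambda>i l s. if l = i then basis [] else 0"])
  show "wds m a a ws" by fact
next
  fix i assume "i \<in> {..<length ws}"
  then have i: "i < length ws" by simp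
  show "wds m a a [ws ! i]" using ws i by (auto simp: wds_def)
  show "entries (\<lambda>a. diagrams_of_deg m a 0) a ws [ws ! i] (\<lambda>r l. if l = i then basis [] else 0)"
    using wds_nth[OF ws i] unfolding entries_def
    by (auto intro!: Hdeg_basis simp: free_vs.span_zero deg_def)
  show "entries (\<lambda>a. diagrams_of_deg m a (- 0)) a [ws ! i] ws (\<lambda>l s. if l = i then basis [] else 0)"
    using wds_nth[OF ws i] unfolding entries_def
    by (auto intro!: Hdeg_basis simp: free_vs.span_zero deg_def)
  show "UQ.H.splits m K (ids m K) (k, a, (a, a, [ws ! i]))" for k
    using good[of "ws ! i"] i by (simp add: good_def)
  fix r s assume "r < length [ws ! i]" "s < length [ws ! i]"
  then show "(\<Sum>l<length ws. vmul (if l = i then basis [] else 0) (if l = i then basis [] else 0))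
      - (if r = s then basis [] else 0) \<in> ideal m K a ([ws ! i] ! s) ([ws ! i] ! r)"
    using sum_single[OF i, of "\<lambda>l. vmul (if l = i then basis [] else 0) (if l = i then basis [] else 0)"]
    by (simp add: bilin_simps free_vs.subspace_0 subspace_ideal)
next
  fix i j r s assume "i \<in> {..<length ws}" "j \<in> {..<length ws}" "i \<noteq> j"
  then have "(\<Sum>l<length ws. vmul (if l = i then basis [] else 0) (if l = j then basis [] else 0)) = 0"
    by (intro sum.neutral) (auto simp: bilin_simps)
  then show "(\<Sum>l<length ws. vmul (if l = i then basis [] else 0) (if l = j then basis [] else 0))
      \<in> ideal m K a ([ws ! j] ! s) ([ws ! i] ! r)"
    by (simp add: free_vs.subspace_0 subspace_ideal)
next
  fix r s assume rs: "r < length ws" "s < length ws"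
  have "(\<Sum>i<length ws. \<Sum>l<length [ws ! i]. vmul (if r = i then basis [] else 0) (if s = i then basis [] else 0))
      = (if s = r then basis [] else 0)"
    using sum_single[OF rs(1), of "\<lambda>i. vmul (if r = i then basis [] else 0) (if s = i then basis [] else 0)"]
    by (simp add: bilin_simps)
  then show "(\<Sum>i<length ws. \<Sum>l<length [ws ! i]. vmul (if r = i then basis [] else 0) (if s = i then basis [] else 0))
      - (if r = s then basis [] else 0) \<in> ideal m K a (ws ! s) (ws ! r)"
    by (auto simp: free_vs.subspace_0 subspace_ideal)
qed simp_all

lemma good_Nil: "a \<in> weights m \<Longrightarrow> good m K a []"
  unfolding good_def
  by (intro allI UQ.H.splits_base) (auto simp: ids_def UQ.hX_def UQ_simps cells1_iff wds_def)

text \<open>A word \<open>a \<rightarrow> a\<close> one of whose subwords splits splits accordingly.\<close>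

lemma good_whisker:
  assumes a: "a \<in> weights m" and w: "x @ u @ y \<in> words m" "wt (x @ u @ y) a = a" and c: "c = wt y a"
    and I: "finite I" and v: "\<And>i. i \<in> I \<Longrightarrow> v i \<in> words m \<and> wt (v i) c = wt u c"
    and P: "\<And>i. i \<in> I \<Longrightarrow> P i \<in> Hdeg m (\<delta> i) c u (v i)"
    and Q: "\<And>i. i \<in> I \<Longrightarrow> Q i \<in> Hdeg m (- \<delta> i) c (v i) u"
    and PQ: "\<And>i. i \<in> I \<Longrightarrow> vmul (P i) (Q i) - basis [] \<in> ideal m K c (v i) (v i)"
    and PQ0: "\<And>i j. i \<in> I \<Longrightarrow> j \<in> I \<Longrightarrow> i \<noteq> j \<Longrightarrow> vmul (P i) (Q j) \<in> ideal m K c (v j) (v i)"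
    and QP: "(\<Sum>i\<in>I. vmul (Q i) (P i)) - basis [] \<in> ideal m K c u u"
    and good: "\<And>i. i \<in> I \<Longrightarrow> good m K a (x @ v i @ y)"
  shows "good m K a (x @ u @ y)"
  unfolding good_def
proof (rule allI, rule UQ_decomposition[where vs = "\<lambda>i. [x @ v i @ y]" and \<delta> = \<delta> and I = I
      and P = "\<lambda>i _ _. whisker x y (P i)" and Q = "\<lambda>i _ _. whisker x y (Q i)"])
  have xy: "x \<in> words m" "y \<in> words m" using w by auto
  have diff: "whisker x y (p - basis []) = whisker x y p - basis []" for p
    by (simp add: lin_diff[OF lin_whisker])
  show "wds m a a [x @ u @ y]" using a w by (simp add: wds_def)
  {
    fix i assume i: "i \<in> I"
    show "wds m a a [x @ v i @ y]" using a w v[OF i] c by (simp add: wds_def wt_append)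
    show "entries (\<lambda>a. diagrams_of_deg m a (\<delta> i)) a [x @ u @ y] [x @ v i @ y] (\<lambda>_ _. whisker x y (P i))"
      using whisker_Hdeg[OF P[OF i, unfolded c] xy] by (simp add: entries_def)
    show "entries (\<lambda>a. diagrams_of_deg m a (- \<delta> i)) a [x @ v i @ y] [x @ u @ y] (\<lambda>_ _. whisker x y (Q i))"
      using whisker_Hdeg[OF Q[OF i, unfolded c] xy] by (simp add: entries_def)
    show "UQ.H.splits m K (ids m K) (k, a, (a, a, [x @ v i @ y]))" for k
      using good[OF i] by (simp add: good_def)
    fix r s assume "r < length [x @ v i @ y]" "s < length [x @ v i @ y]"
    then show "(\<Sum>l<length [x @ u @ y]. vmul (whisker x y (P i)) (whisker x y (Q i)))
        - (if r = s then basis [] else 0) \<in> ideal m K a ([x @ v i @ y] ! s) ([x @ v i @ y] ! r)"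
      using ideal_whisker[OF PQ[OF i, unfolded c] xy] by (simp add: whisker_vmul[symmetric] diff)
  }
  fix i j r s assume "i \<in> I" "j \<in> I" "i \<noteq> j" "r < length [x @ v i @ y]" "s < length [x @ v j @ y]"
  then show "(\<Sum>l<length [x @ u @ y]. vmul (whisker x y (P i)) (whisker x y (Q j)))
      \<in> ideal m K a ([x @ v j @ y] ! s) ([x @ v i @ y] ! r)"
    using ideal_whisker[OF PQ0[of i j, unfolded c] xy] by (simp add: whisker_vmul[symmetric])
next
  fix r s assume "r < length [x @ u @ y]" "s < length [x @ u @ y]"
  moreover have "whisker x y ((\<Sum>i\<in>I. vmul (Q i) (P i)) - basis []) \<in> ideal m K a (x @ u @ y) (x @ u @ y)"
    using ideal_whisker[OF QP[unfolded c]] w by simp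
  ultimately show "(\<Sum>i\<in>I. \<Sum>l<length [x @ v i @ y]. vmul (whisker x y (Q i)) (whisker x y (P i)))
      - (if r = s then basis [] else 0) \<in> ideal m K a ([x @ u @ y] ! s) ([x @ u @ y] ! r)"
    by (simp add: lin_diff[OF lin_whisker] lin_sum[OF lin_whisker] whisker_vmul)
qed (fact I)

text \<open>Words passing through a killed weight are zero objects.\<close>

lemma good_killed:
  assumes a: "a \<in> weights m" and w: "l @ r \<in> words m" "wt (l @ r) a = a" and K: "wt r a \<in> K"
  shows "good m K a (l @ r)"
proof -
  have "basis [] \<in> ideal m K (wt r a) [] []"
    using ideal_base[of m K "[]" "wt r a" "[]" "[]" "basis []" "[]"] K by (simp add: base_rel_def)
  from free_vs.subspace_neg[OF subspace_ideal this]
  show ?thesis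
    using good_whisker[of a m l "[]" r "wt r a" "{}"] a w by simp
qed

lemma lam_add_root:
  assumes "1 \<le> i" "1 \<le> j" "i < length a" "j < length a"
  shows "lam (add_root s i a) j = lam a j + s * (if i = j then 2 else if adj i j then - 1 else 0)"
proof -
  have "lam (add_root s i a) j = lam a j + (if j - 1 = i - 1 then s else 0) - (if j - 1 = i then s else 0)
      - (if j = i - 1 then s else 0) + (if j = i then s else 0)"
    using assms by (simp add: lam_def nth_add_root)
  moreover have "j - 1 = i - 1 \<longleftrightarrow> i = j" "j - 1 = i \<longleftrightarrow> j = Suc i" "j = i - 1 \<longleftrightarrow> i = Suc j"
    using assms by auto
  ultimately show ?thesis by (auto simp: adj_def)
qed

lemma deg_sigma:
  assumes "a \<in> weights m" "i \<in> {1..<m}" "j \<in> {1..<m}"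
  shows "deg a (sigma i j) = 0"
  using assms by (auto simp: sigma_def deg_def lam_add_root weights_def adj_def)

lemma deg_kappa_dots: "deg a (kappa_dots i k) = 1 - lam a i + 2 * int k"
proof -
  have "(\<Sum>(l, g, r)\<leftarrow>replicate k ([], Dot i, [\<F> i]). gdeg (wt r a) g) = 2 * int k"
    by (induction k) auto
  then show ?thesis by (simp add: kappa_dots_def deg_def)
qed

lemma ideal_relator:
  assumes "relator m a u v x" "u \<in> words m" "v \<in> words m"
  shows "x \<in> ideal m K a u v"
  using ideal_base[of m K "[]" a u v x "[]"] assms by (simp add: base_rel_def whisker_Nil)

lemma wt_swap:
  "1 \<le> i \<Longrightarrow> 1 \<le> j \<Longrightarrow> wt [\<F> j, \<E> i] c = wt [\<E> i, \<F> j] c"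
  by (simp add: add_root_commute)

lemma good_swap_distinct:
  assumes a: "a \<in> weights m" and w: "x @ [\<E> i, \<F> j] @ y \<in> words m" "wt (x @ [\<E> i, \<F> j] @ y) a = a"
    and ij: "i \<noteq> j" and good: "good m K a (x @ [\<F> j, \<E> i] @ y)"
  shows "good m K a (x @ [\<E> i, \<F> j] @ y)"
proof -
  let ?c = "wt y a" and ?S = "[([], SigmaInv i j, [])]"
  have i: "i \<in> {1..<m}" "j \<in> {1..<m}" using w by (auto simp: words_Cons)
  have c: "?c \<in> weights m" using a by simp
  show ?thesis
  proof (rule good_whisker[where I = "{()}" and c = ?c and v = "\<lambda>_. [\<F> j, \<E> i]" and \<delta> = "\<lambda>_. 0"
        and P = "\<lambda>_. basis (sigma i j)" and Q = "\<lambda>_. basis ?S", OF a w refl])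
    show "basis (sigma i j) \<in> Hdeg m 0 ?c [\<E> i, \<F> j] [\<F> j, \<E> i]"
      by (intro Hdeg_basis is_diagram_sigma deg_sigma[OF c] i)
    show "basis ?S \<in> Hdeg m (- 0) ?c [\<F> j, \<E> i] [\<E> i, \<F> j]"
      using i by (intro Hdeg_basis) (simp_all add: words_Cons deg_def)
    show "vmul (basis (sigma i j)) (basis ?S) - basis [] \<in> ideal m K ?c [\<F> j, \<E> i] [\<F> j, \<E> i]"
      using relator.mixed_FE[OF c i ij] i by (intro ideal_relator) (simp_all add: words_Cons)
    show "(\<Sum>_\<in>{()}. vmul (basis ?S) (basis (sigma i j))) - basis [] \<in> ideal m K ?c [\<E> i, \<F> j] [\<E> i, \<F> j]"
      using relator.mixed_EF[OF c i ij] i by (intro ideal_relator) (simp_all add: words_Cons)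
    show "[\<F> j, \<E> i] \<in> words m \<and> wt [\<F> j, \<E> i] ?c = wt [\<E> i, \<F> j] ?c"
      using i wt_swap[of i j ?c] by (simp add: words_Cons)
  qed (use good in auto)
qed

text \<open>For \<open>\<lambda>\<^sub>i \<ge> 0\<close> the relations make \<open>\<E>\<^sub>i \<F>\<^sub>i\<close> the direct sum of \<open>\<F>\<^sub>i \<E>\<^sub>i\<close> and \<open>\<lambda>\<^sub>i\<close> shifted identities.\<close>

lemma good_swap_same:
  assumes a: "a \<in> weights m" and w: "x @ [\<E> i, \<F> i] @ y \<in> words m" "wt (x @ [\<E> i, \<F> i] @ y) a = a"
    and lam: "lam (wt y a) i \<ge> 0" and good: "good m K a (x @ [\<F> i, \<E> i] @ y)" "good m K a (x @ y)"
  shows "good m K a (x @ [\<E> i, \<F> i] @ y)"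
proof -
  let ?c = "wt y a" and ?n = "nat (lam (wt y a) i)"
  have i: "i \<in> {1..<m}" using w by (auto simp: words_Cons)
  have c: "?c \<in> weights m" using a by simp
  have FE: "[\<F> i, \<E> i] \<in> words m" "[\<E> i, \<F> i] \<in> words m" using i by (simp_all add: words_Cons)
  \<comment> \<open>Index \<open>0\<close> belongs to the summand \<open>\<F>\<^sub>i \<E>\<^sub>i\<close>, index \<open>l + 1\<close> to the \<open>l\<close>-th identity.\<close>
  define v where "v k = (case k of 0 \<Rightarrow> [\<F> i, \<E> i] | Suc _ \<Rightarrow> [])" for k :: nat
  define \<delta> where "\<delta> k = (case k of 0 \<Rightarrow> 0 | Suc l \<Rightarrow> 1 - lam ?c i + 2 * int l)" for k :: nat
  define P where "P k = (case k of 0 \<Rightarrow> sigma i i | Suc l \<Rightarrow> kappa_dots i l)" for k :: nat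
  define Q where "Q k = [([] :: word, case k of 0 \<Rightarrow> SigmaInv i i | Suc l \<Rightarrow> KappaInv i l, [] :: word)]" for k :: nat
  note defs = v_def \<delta>_def P_def Q_def
  show ?thesis
  proof (rule good_whisker[where I = "{..<Suc ?n}" and c = ?c and v = v and \<delta> = \<delta>
        and P = "\<lambda>k. basis (P k)" and Q = "\<lambda>k. basis (Q k)", OF a w refl])
    fix k assume "k \<in> {..<Suc ?n}"
    then have k: "k = Suc l \<Longrightarrow> int l < lam ?c i" for l by auto
    show "v k \<in> words m \<and> wt (v k) ?c = wt [\<E> i, \<F> i] ?c"
      using i wt_swap[of i i ?c] by (auto simp: v_def words_Cons add_root_inverse split: nat.split)
    show "basis (P k) \<in> Hdeg m (\<delta> k) ?c [\<E> i, \<F> i] (v k)"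
      using i is_diagram_sigma[OF i i] is_diagram_kappa_dots[OF i] deg_sigma[OF c i i]
      by (intro Hdeg_basis) (auto simp: defs deg_kappa_dots split: nat.split)
    show "basis (Q k) \<in> Hdeg m (- \<delta> k) ?c (v k) [\<E> i, \<F> i]"
      using i k by (intro Hdeg_basis) (auto simp: defs deg_def words_Cons split: nat.split)
    show "vmul (basis (P k)) (basis (Q k)) - basis [] \<in> ideal m K ?c (v k) (v k)"
    proof (cases k)
      case 0
      then show ?thesis
        using relator.pos_FE[OF c i lam] FE by (intro ideal_relator) (simp_all add: defs)
    next
      case (Suc l)
      then show ?thesis
        using relator.pos_1_1[OF c i k[OF Suc] k[OF Suc]] by (intro ideal_relator) (simp_all add: defs)
    qed
    show "good m K a (x @ v k @ y)" using good by (simp add: v_def split: nat.split)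
  next
    fix k k' assume "k \<in> {..<Suc ?n}" "k' \<in> {..<Suc ?n}" and ne: "k \<noteq> k'"
    then have k: "k = Suc l \<Longrightarrow> int l < lam ?c i" "k' = Suc l \<Longrightarrow> int l < lam ?c i" for l by auto
    show "vmul (basis (P k)) (basis (Q k')) \<in> ideal m K ?c (v k') (v k)"
    proof (cases k)
      case 0
      then obtain l where l: "k' = Suc l" using ne by (cases k') auto
      show ?thesis
        using relator.pos_1_FE[OF c i k(2)[OF l]] FE by (intro ideal_relator) (simp_all add: defs 0 l)
    next
      case (Suc l)
      show ?thesis
      proof (cases k')
        case 0
        show ?thesis
          using relator.pos_FE_1[OF c i k(1)[OF Suc]] FE by (intro ideal_relator) (simp_all add: defs Suc 0)
      next
        case (Suc l')
        show ?thesis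
          using relator.pos_1_1[OF c i k(1)[OF \<open>k = Suc l\<close>] k(2)[OF Suc]] ne
          by (intro ideal_relator) (simp_all add: defs \<open>k = Suc l\<close> Suc)
      qed
    qed
  next
    show "(\<Sum>k<Suc ?n. vmul (basis (Q k)) (basis (P k))) - basis [] \<in> ideal m K ?c [\<E> i, \<F> i] [\<E> i, \<F> i]"
      using relator.pos_EF[OF c i lam] FE
      by (intro ideal_relator) (simp_all add: defs sum.lessThan_Suc_shift del: sum.lessThan_Suc)
  qed simp
qed

lemma wprod_single: "wprod [u] [v] = [u @ v]"
  by (simp add: wprod_def)

text \<open>As \<open>\<E>\<^sub>i\<close> is left adjoint to \<open>\<F>\<^sub>i\<close>, a leftmost letter \<open>\<F>\<^sub>i\<close> can be moved to the right end.\<close>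

lemma good_rotate:
  assumes a: "a \<in> weights m" and w: "\<F> i # w \<in> words m" "wt (\<F> i # w) a = a"
    and good: "good m K (wt w a) (w @ [\<F> i])"
  shows "good m K a (\<F> i # w)"
proof -
  let ?C = "UQ m K"
  define c where "c = wt w a"
  have i: "i \<in> {1..<m}" and ww: "w \<in> words m" using w by (auto simp: words_Cons)
  have cw: "c \<in> weights m" using a by (simp add: c_def)
  have ca: "add_root (- 1) i c = a" using w by (simp add: c_def)
  have ac: "add_root 1 i a = c" using i add_root_inverse[of i "- 1" 1] by (simp add: ca[symmetric] add_root_inverse)
  have wds: "wds m c a [[\<F> i]]" "wds m a c [[\<E> i]]" "wds m a c [w]"
    "wds m a a [[\<F> i, \<E> i]]" "wds m c c [[\<E> i, \<F> i]]" "wds m a a [[]]" "wds m c c [[]]"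
    using i ww a cw by (auto simp: wds_def words_Cons ca ac c_def[symmetric])
  let ?\<eta> = "basis [([], Eta i, [])] :: lindiag" and ?\<kappa> = "basis [([], Kappa i, [])] :: lindiag"
  have \<eta>: "entries (\<lambda>a. diagrams_of_deg m a (lam c i - 1)) a [[]] [[\<F> i, \<E> i]] (\<lambda>_ _. ?\<eta>)"
    using i cw by (auto simp: entries_def words_Cons deg_def ca[symmetric] lam_add_root weights_def
        intro!: Hdeg_basis)
  have \<kappa>: "entries (\<lambda>a. diagrams_of_deg m a (- (lam c i - 1))) c [[\<E> i, \<F> i]] [[]] (\<lambda>_ _. ?\<kappa>)"
    using i by (auto simp: entries_def words_Cons deg_def intro!: Hdeg_basis)
  note \<eta>d = entries_deg[OF \<eta>] and \<kappa>d = entries_deg[OF \<kappa>]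
  let ?F = "(c, a, [[\<F> i]])" and ?E = "(a, c, [[\<E> i]])" and ?w = "(a, c, [w])"
  have cells: "?F \<in> cells1 ?C c a" "?E \<in> cells1 ?C a c" "?w \<in> cells1 ?C a c"
    using wds by (simp_all add: UQ_simps cells1_iff)
  \<comment> \<open>The zigzag identity for the unit and counit whiskered by \<open>\<F>\<^sub>i\<close>.\<close>
  have zigzag: "vcomp ?C (hcomp ?C (id2 ?C ?F) (cell m K c c [[\<E> i, \<F> i]] [[]] (\<lambda>_ _. ?\<kappa>)))
      (hcomp ?C (cell m K a a [[]] [[\<F> i, \<E> i]] (\<lambda>_ _. ?\<eta>)) (id2 ?C ?F)) = id2 ?C ?F"
  proof -
    note idF = entries_deg[OF id_entries[OF wds(1)]]
    note h1 = hcomp_cell[OF wds(1,1,5,7) idF \<kappa>d] kron_entries[OF wds(1,1,5,7) idF \<kappa>d]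
    note h2 = hcomp_cell[OF wds(6,4,1,1) \<eta>d idF] kron_entries[OF wds(6,4,1,1) \<eta>d idF]
    have l: "wprod [[\<F> i]] [[\<E> i, \<F> i]] = wprod [[\<F> i, \<E> i]] [[\<F> i]]"
      by (simp add: wprod_single)
    have "basis [([\<F> i], Kappa i, []), ([], Eta i, [\<F> i])] - basis [] \<in> ideal m K c [\<F> i] [\<F> i]"
      using relator.zigzag_F[OF cw i] i by (intro ideal_relator) (simp_all add: words_Cons)
    then have "cell m K c a [[\<F> i]] [[\<F> i]] (\<lambda>_ _. basis [([\<F> i], Kappa i, []), ([], Eta i, [\<F> i])])
        = cell m K c a [[\<F> i]] [[\<F> i]] (\<lambda>i j. if i = j then basis [] else 0)"
      by (intro cell_eqI) simp
    moreover have "vcomp ?C (hcomp ?C (id2 ?C ?F) (cell m K c c [[\<E> i, \<F> i]] [[]] (\<lambda>_ _. ?\<kappa>)))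
        (hcomp ?C (cell m K a a [[]] [[\<F> i, \<E> i]] (\<lambda>_ _. ?\<eta>)) (id2 ?C ?F))
      = cell m K c a [[\<F> i]] [[\<F> i]] (\<lambda>_ _. basis [([\<F> i], Kappa i, []), ([], Eta i, [\<F> i])])"
      unfolding id2_cell h1(1) h2(1)
      unfolding l vcomp_cell[OF h1(2)[unfolded l] h2(2)]
      by (simp add: wprod_single, rule cell_cong, simp add: kron_def hmul_def)
    ultimately show ?thesis by (simp add: id2_cell)
  qed
  have "\<exists>P Q. UQ.H.is_sum_of m K (k, a, comp1 ?C ?F ?w) {()} (\<lambda>_. (k, c, comp1 ?C ?w ?F)) P Q" for k
    by (rule UQ.hTr_rotate[OF cells _ _ zigzag cell_homog[OF wds(6,4) \<eta>] cell_homog[OF wds(5,7) \<kappa>]])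
      (use arr_cell[OF wds(6,4) \<eta>d] arr_cell[OF wds(5,7) \<kappa>d]
        in \<open>simp_all add: comp1_UQ wprod_single UQ_simps(5)\<close>)
  then have rot: "\<exists>P Q. UQ.H.is_sum_of m K (k, a, (a, a, [\<F> i # w])) {()} (\<lambda>_. (k, c, (c, c, [w @ [\<F> i]]))) P Q" for k
    by (simp add: comp1_UQ wprod_single)
  show ?thesis
    unfolding good_def
  proof
    fix k
    obtain P Q where "UQ.H.is_sum_of m K (k, a, (a, a, [\<F> i # w])) {()} (\<lambda>_. (k, c, (c, c, [w @ [\<F> i]]))) P Q"
      using rot by blast
    then show "UQ.H.splits m K (ids m K) (k, a, (a, a, [\<F> i # w]))"
      by (rule UQ.H.splits_trans) (use good in \<open>simp add: good_def c_def\<close>)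
  qed
qed

section \<open>Every endo-1-morphism splits\<close>

text \<open>The weights killed in the quotient.\<close>

definition killed :: "nat \<Rightarrow> weight set" where
  "killed m = {a \<in> weights m. \<not> set a \<subseteq> {0, 1, 2}}"

text \<open>The word \<open>w\<close> is an endo-1-morphism of the weight \<open>a\<close>.\<close>

definition closed_word :: "nat \<Rightarrow> weight \<Rightarrow> word \<Rightarrow> bool" where
  "closed_word m a w \<longleftrightarrow> a \<in> weights m \<and> w \<in> words m \<and> wt w a = a"

text \<open>For \<open>\<lambda>\<^sub>i < 0\<close> the composite \<open>\<E>\<^sub>i \<F>\<^sub>i\<close> passes through a killed weight, since only the pairs of entries
  \<open>(0, 1)\<close>, \<open>(0, 2)\<close> and \<open>(1, 2)\<close> are possible.\<close>

lemma killed_if_lam_neg: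
  assumes "c \<in> weights m" "i \<in> {1..<m}" "lam c i < 0" "c \<notin> killed m"
  shows "add_root (- 1) i c \<in> killed m"
proof -
  have len: "i < length c" "i - 1 < length c" "i \<noteq> i - 1" using assms by (auto simp: weights_def)
  have "c ! i \<in> {0, 1, 2}" "c ! (i - 1) \<in> {0, 1, 2}"
    using assms len nth_mem unfolding killed_def by blast+
  moreover have "c ! (i - 1) < c ! i" using assms by (simp add: lam_def)
  ultimately have "c ! i + 1 = 3 \<or> c ! (i - 1) - 1 = - 1" by auto
  moreover have "add_root (- 1) i c ! i = c ! i + 1" "add_root (- 1) i c ! (i - 1) = c ! (i - 1) - 1"
    using len assms(2) by (simp_all add: nth_add_root)
  moreover have "add_root (- 1) i c ! i \<in> set (add_root (- 1) i c)"
    "add_root (- 1) i c ! (i - 1) \<in> set (add_root (- 1) i c)"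
    using len by (simp_all add: nth_mem)
  ultimately have "\<not> set (add_root (- 1) i c) \<subseteq> {0, 1, 2}" by auto
  then show ?thesis using assms(1) by (simp add: killed_def weights_def)
qed

lemma good_swap:
  assumes w: "closed_word m a (x @ [\<E> i, \<F> j] @ y)"
    and good: "good m (killed m) a (x @ [\<F> j, \<E> i] @ y)"
    and shorter: "\<And>w. closed_word m a w \<Longrightarrow> length w < length (x @ [\<E> i, \<F> j] @ y) \<Longrightarrow> good m (killed m) a w"
  shows "good m (killed m) a (x @ [\<E> i, \<F> j] @ y)"
proof -
  have a: "a \<in> weights m" and W: "x @ [\<E> i, \<F> j] @ y \<in> words m" "wt (x @ [\<E> i, \<F> j] @ y) a = a"
    using w by (simp_all add: closed_word_def)
  have ij: "i \<in> {1..<m}" "j \<in> {1..<m}" using W by (auto simp: words_Cons)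
  let ?c = "wt y a"
  consider "i \<noteq> j" | "i = j" "lam ?c i \<ge> 0" | "i = j" "lam ?c i < 0" by linarith
  then show ?thesis
  proof cases
    case 1
    then show ?thesis by (rule good_swap_distinct[OF a W _ good])
  next
    case 2
    have "add_root 1 i (add_root (- 1) i ?c) = ?c"
      using ij by (intro add_root_inverse) auto
    then have "closed_word m a (x @ y)"
      using w 2 by (simp add: closed_word_def words_Cons wt_append)
    then have "good m (killed m) a (x @ y)" by (rule shorter) simp
    then show ?thesis using good_swap_same[of a m x i y "killed m"] a W good 2 by simp
  next
    case 3
    have "?c \<in> killed m \<or> wt ([\<F> j] @ y) a \<in> killed m"
      using killed_if_lam_neg[of ?c m i] a ij 3 by auto
    then show ?thesis
    proof
      assume "?c \<in> killed m"
      then show ?thesis using good_killed[of a m "x @ [\<E> i, \<F> j]" y] a W by simp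
    next
      assume "wt ([\<F> j] @ y) a \<in> killed m"
      then show ?thesis using good_killed[of a m "x @ [\<E> i]" "[\<F> j] @ y"] a W by simp
    qed
  qed
qed

fun is_F :: "letter \<Rightarrow> bool" where
  "is_F (\<E> i) = False"
| "is_F (\<F> i) = True"

lemma wt_add_root: "w \<in> words m \<Longrightarrow> 1 \<le> i \<Longrightarrow> wt w (add_root s i a) = add_root s i (wt w a)"
proof (induction w)
  case (Cons x w)
  then show ?case by (cases x) (auto simp: words_Cons add_root_commute)
qed simp

lemma wt_filter: "w \<in> words m \<Longrightarrow> wt (filter is_F w @ filter (\<lambda>x. \<not> is_F x) w) a = wt w a"
proof (induction w)
  case (Cons x w)
  have "filter is_F w \<in> words m" using Cons.prems by (auto simp: words_def)
  then show ?case
    using Cons by (cases x) (auto simp: words_Cons wt_append wt_add_root)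
qed simp

lemma closed_word_swap:
  "closed_word m a (x @ [\<E> i, \<F> j] @ y) \<Longrightarrow> closed_word m a (x @ [\<F> j, \<E> i] @ y)"
  using add_root_commute[of j i] by (auto simp: closed_word_def words_Cons wt_append)

text \<open>Straightening modulo shorter words: a letter \<open>\<E>\<close> can be moved to the right past letters \<open>\<F>\<close>, and
  hence all letters \<open>\<F>\<close> of a subword to its left end.\<close>

lemma good_straighten_E:
  assumes "list_all is_F fs" "closed_word m a (x @ [\<E> i] @ fs @ y)"
    and "\<And>w. closed_word m a w \<Longrightarrow> length w < length (x @ [\<E> i] @ fs @ y) \<Longrightarrow> good m (killed m) a w"
    and "good m (killed m) a (x @ fs @ [\<E> i] @ y)"
  shows "good m (killed m) a (x @ [\<E> i] @ fs @ y)"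
  using assms
proof (induction fs arbitrary: x)
  case (Cons f fs)
  then obtain j where f: "f = \<F> j" by (cases f) auto
  have 1: "closed_word m a (x @ [\<E> i, \<F> j] @ (fs @ y))" using Cons.prems(2) by (simp add: f)
  have "good m (killed m) a ((x @ [\<F> j]) @ [\<E> i] @ fs @ y)"
  proof (rule Cons.IH)
    show "closed_word m a ((x @ [\<F> j]) @ [\<E> i] @ fs @ y)"
      using closed_word_swap[OF 1] by simp
  qed (use Cons.prems in \<open>auto simp: f\<close>)
  then have "good m (killed m) a (x @ [\<E> i, \<F> j] @ (fs @ y))"
    using Cons.prems(3) by (intro good_swap[OF 1]) (auto simp: f)
  then show ?case by (simp add: f)
qed simp

lemma good_straighten:
  assumes "closed_word m a (x @ w @ y)"
    and "\<And>v. closed_word m a v \<Longrightarrow> length v < length (x @ w @ y) \<Longrightarrow> good m (killed m) a v"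
    and "good m (killed m) a (x @ filter is_F w @ filter (\<lambda>x. \<not> is_F x) w @ y)"
  shows "good m (killed m) a (x @ w @ y)"
  using assms
proof (induction w arbitrary: x)
  case (Cons f w)
  let ?fs = "filter is_F w" and ?es = "filter (\<lambda>x. \<not> is_F x) w"
  have len: "length ?fs + length ?es = length w"
    using sum_length_filter_compl[of is_F w] by simp
  show ?case
  proof (cases f)
    case (\<F> j)
    then show ?thesis using Cons.IH[of "x @ [f]"] Cons.prems by simp
  next
    case (\<E> i)
    have w: "w \<in> words m" using Cons.prems(1) by (simp add: closed_word_def words_Cons)
    have "closed_word m a (x @ [\<E> i] @ ?fs @ (?es @ y))"
      using Cons.prems(1) wt_filter[OF w, of "wt y a"]
      by (auto simp: closed_word_def words_Cons wt_append \<E>) (auto simp: words_def)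
    then have "good m (killed m) a (x @ [\<E> i] @ ?fs @ (?es @ y))"
      using Cons.prems(2,3) len
      by (intro good_straighten_E) (auto simp: \<E> list_all_iff)
    then show ?thesis using Cons.IH[of "x @ [f]"] Cons.prems by (simp add: \<E>)
  qed
qed simp

lemma good_rotate_all:
  assumes "list_all is_F fs" "closed_word m a (fs @ u)" "good m K (wt u a) (u @ fs)"
  shows "good m K a (fs @ u)"
  using assms
proof (induction fs arbitrary: a u)
  case (Cons f fs)
  then obtain i where f: "f = \<F> i" by (cases f) auto
  let ?c = "wt (fs @ u) a"
  have closed: "a \<in> weights m" "\<F> i # (fs @ u) \<in> words m" "wt (\<F> i # (fs @ u)) a = a"
    using Cons.prems(2) by (simp_all add: closed_word_def f)
  have "good m K ?c (fs @ (u @ [\<F> i]))"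
  proof (rule Cons.IH)
    show "closed_word m ?c (fs @ (u @ [\<F> i]))"
      using closed by (auto simp: closed_word_def words_Cons wt_append)
    have "wt (u @ [\<F> i]) ?c = wt u a" using closed by (simp add: wt_append)
    then show "good m K (wt (u @ [\<F> i]) ?c) ((u @ [\<F> i]) @ fs)" using Cons.prems(3) by (simp add: f)
  qed (use Cons.prems in auto)
  then show ?case using good_rotate[of a m i "fs @ u" K] closed by (simp add: f)
qed (simp add: closed_word_def)

text \<open>A potential on weights, which every \<open>\<E>\<close> lowers and every \<open>\<F>\<close> raises by one.\<close>

definition potential :: "weight \<Rightarrow> int" where
  "potential a = (\<Sum>k<length a. int k * a ! k)"

lemma potential_add_root:
  assumes "1 \<le> i" "i < length a"
  shows "potential (add_root s i a) = potential a - s"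
proof -
  have "potential (add_root s i a)
      = (\<Sum>k<length a. int k * a ! k + (if k = i - 1 then int k * s else 0) - (if k = i then int k * s else 0))"
    unfolding potential_def using assms by (intro sum.cong) (auto simp: nth_add_root algebra_simps)
  also have "\<dots> = potential a + int (i - 1) * s - int i * s"
    using assms less_imp_diff_less[OF assms(2), of 1] by (simp add: potential_def sum.distrib sum_subtractf)
  also have "\<dots> = potential a - s" using assms by (simp add: of_nat_diff algebra_simps)
  finally show ?thesis .
qed

lemma potential_wt:
  assumes "a \<in> weights m" "w \<in> words m"
  shows "potential (wt w a) = potential a - int (length (filter (\<lambda>x. \<not> is_F x) w)) + int (length (filter is_F w))"
  using assms
proof (induction w)
  case (Cons x w)
  then show ?case by (cases x) (auto simp: words_Cons potential_add_root weights_def)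
qed simp

text \<open>Rotating all the letters \<open>\<F>\<close> of \<open>\<F> \<dots> \<F> \<E> \<dots> \<E>\<close> and straightening again returns the same word at a
  weight of lower potential, so that a killed weight is reached in the end.\<close>

lemma good_straight_word:
  assumes shorter: "\<And>a w. closed_word m a w \<Longrightarrow> length w < length (fs @ es) \<Longrightarrow> good m (killed m) a w"
    and fs: "list_all is_F fs" and es: "list_all (\<lambda>x. \<not> is_F x) es"
  shows "closed_word m a (fs @ es) \<Longrightarrow> good m (killed m) a (fs @ es)"
\<comment> \<open>The shift by 1 lets the measure decrease also when the potential drops from 0 to a negative value.\<close>
proof (induction "nat (potential a + 1)" arbitrary: a rule: less_induct)
  case less
  have a: "a \<in> weights m" and W: "fs \<in> words m" "es \<in> words m" and wt: "wt fs (wt es a) = a"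
    using less.prems by (auto simp: closed_word_def wt_append)
  let ?c = "wt es a"
  have filters: "filter is_F fs = fs" "filter (\<lambda>x. \<not> is_F x) fs = []"
    "filter is_F es = []" "filter (\<lambda>x. \<not> is_F x) es = es"
    using fs es by (auto simp: list_all_iff filter_id_conv filter_empty_conv)
  have pot: "potential ?c = potential a - int (length es)" "potential a = potential ?c + int (length fs)"
    using potential_wt[OF a W(2)] potential_wt[of ?c m fs] a W wt by (simp_all add: filters)
  show ?case
  proof (cases "es = [] \<or> a \<in> killed m")
    case True
    then show ?thesis
    proof
      assume "es = []"
      moreover have "length fs = length es" using pot by linarith
      ultimately have "fs @ es = []" by simp
      then show ?thesis using good_Nil[OF a] by simp
    next
      assume "a \<in> killed m"
      then show ?thesis using good_killed[of a m "fs @ es" "[]"] less.prems by (simp add: closed_word_def)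
    qed
  next
    case False
    then have "set a \<subseteq> {0, 1, 2}" using a by (simp add: killed_def)
    then have "0 \<le> a ! k" if "k < length a" for k using nth_mem[OF that] by auto
    then have "0 \<le> potential a" unfolding potential_def by (intro sum_nonneg) auto
    moreover have "potential ?c < potential a" using False by (simp add: pot(1))
    ultimately have "nat (potential ?c + 1) < nat (potential a + 1)" by simp
    moreover have c: "closed_word m ?c (fs @ es)" "closed_word m ?c ([] @ (es @ fs) @ [])"
    proof -
      show "closed_word m ?c ([] @ (es @ fs) @ [])" using a W wt by (simp add: closed_word_def wt_append)
      then show "closed_word m ?c (fs @ es)"
        using wt_filter[of "es @ fs" m ?c] by (simp add: closed_word_def filters)
    qed
    ultimately have "good m (killed m) ?c (fs @ es)" using less.hyps by blast
    then have "good m (killed m) ?c ([] @ (es @ fs) @ [])"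
      using shorter by (intro good_straighten[OF c(2)]) (auto simp: filters)
    then show ?thesis using good_rotate_all[OF fs less.prems] by simp
  qed
qed

theorem good_closed_word: "closed_word m a w \<Longrightarrow> good m (killed m) a w"
proof (induction "length w" arbitrary: a w rule: less_induct)
  case less
  let ?fs = "filter is_F w" and ?es = "filter (\<lambda>x. \<not> is_F x) w"
  have w: "w \<in> words m" using less.prems by (simp add: closed_word_def)
  have len: "length (?fs @ ?es) = length w"
    using sum_length_filter_compl[of is_F w] by simp
  have "closed_word m a (?fs @ ?es)"
    using less.prems wt_filter[OF w, of a] by (auto simp: closed_word_def words_def)
  moreover have "good m (killed m) a' v" if "closed_word m a' v" "length v < length (?fs @ ?es)" for a' v
    using less.hyps[OF that(2)[unfolded len] that(1)] .
  ultimately have straight: "good m (killed m) a (?fs @ ?es)"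
    by (intro good_straight_word) (simp_all add: list_all_iff)
  have "good m (killed m) a ([] @ w @ [])"
  proof (rule good_straighten)
    show "closed_word m a ([] @ w @ [])" using less.prems by simp
    show "good m (killed m) a v" if "closed_word m a v" "length v < length ([] @ w @ [])" for v
      using less.hyps[of v a] that by simp
    show "good m (killed m) a ([] @ ?fs @ ?es @ [])" using straight by simp
  qed
  then show ?case by simp
qed

theorem corollary4p3:
  fixes m :: nat
  assumes "m \<ge> 2"
  shows "equivalence_of_categories
           (vTr (UQ_le2 m)) (hTr (UQ_le2 m)) (incl_ob (UQ_le2 m)) (incl_mor (UQ_le2 m))"
proof -
  let ?K = "killed m"
  have eq: "UQ_le2 m = UQ m ?K" by (simp add: UQ_le2_def killed_def)
  have "UQ.H.splits m ?K (ids m ?K) x" if "x \<in> UQ.hX m ?K" for x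
  proof -
    obtain k c f where x: "x = (k, c, f)" by (cases x)
    with that have "f \<in> UQ_cells1 m c c" by (simp add: UQ.hX_def UQ_simps)
    then obtain ws where f: "f = (c, c, ws)" and ws: "wds m c c ws"
      by (cases f) (auto simp: cells1_iff)
    have "closed_word m c w" if "w \<in> set ws" for w
      using ws that by (simp add: wds_def closed_word_def)
    then show ?thesis unfolding x f by (intro splits_if_good[OF ws] good_closed_word)
  qed
  then show ?thesis
    unfolding eq ids_def by (rule UQ.equivalence_if_splits)
qed

end
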